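(* Let $f\colon M\to\mathbb{R}^{2n+2}$ be an affine hypersurface with a $\widetilde J$-tangent transversal vector field $C$, let $\nabla$ be the affine connection on $M$ induced by $C$, and let $(\varphi,\xi,\eta)$ be the almost paracontact structure on $M$ induced by $C$. If $\nabla\eta=0$, then for every $p\in M$ there exist a neighbourhood $U$ of $p$ and a $\widetilde J$-tangent transversal vector field $\overline{\overline C}$ defined on $U$ such that, denoting by $\overline{\overline\nabla}$ and $(\overline{\overline\varphi},\overline{\overline\xi},\overline{\overline\eta})$ the affine connection and the almost paracontact structure induced by $\overline{\overline C}$, the structure $(\overline{\overline\varphi},\overline{\overline\xi},\overline{\overline\eta})$ is $\overline{\overline\nabla}$-parallel. Moreover, around $p$ there exists a local coordinate system $(x_1,\ldots,x_{2n},x_{2n+1})$ such that $\partial_{x_1},\ldots,\partial_{x_n}\in\mathcal D^+$, $\partial_{x_{n+1}},\ldots,\partial_{x_{2n}}\in\mathcal D^-$, $\overline{\overline\nabla}_{\partial_{x_i}}\partial_{x_j}=0$ for all $i,j=1,\ldots,2n+1$, and $\partial_{x_{2n+1}}=\overline{\overline\xi}$.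
   Context: All objects are smooth. The space $\mathbb{R}^{2n+2}$ carries its standard flat connection $D$ and the para-complex structure $\widetilde J(x_1,\ldots,x_{n+1},y_1,\ldots,y_{n+1})=(y_1,\ldots,y_{n+1},x_1,\ldots,x_{n+1})$. An affine hypersurface $f\colon M\to\mathbb{R}^{2n+2}$ is an immersion of an orientable connected manifold $M$ of dimension $2n+1$. A transversal vector field $C$ (an $\mathbb{R}^{2n+2}$-valued function on $M$ with $C_x\notin f_*(T_xM)$ for all $x$) induces a torsion-free connection $\nabla$ and a symmetric bilinear form $h$ via $D_Xf_*Y=f_*(\nabla_XY)+h(X,Y)C$. It is called $\widetilde J$-tangent if $\widetilde JC_x\in f_*(T_xM)$ for every $x\in M$. Let $\mathcal D_x=f_*^{-1}\big(f_*(T_xM)\cap\widetilde J(f_*(T_xM))\big)$; when a $\widetilde J$-tangent transversal vector field exists, $\mathcal D$ is a distribution of rank $2n$, invariant under $\widetilde J$ (identifying tangent vectors with their images under $f_*$). Set $\mathcal D^{\pm}=\{X\in\mathcal D:\widetilde JX=\pm X\}$; each has rank $n$. The almost paracontact structure $(\varphi,\xi,\eta)$ induced by a $\widetilde J$-tangent transversal vector field $C$ is defined by: $\xi$ is the tangent vector field with $f_*\xi=\widetilde JC$; $\eta$ is the 1-form with $\eta|_{\mathcal D}=0$, $\eta(\xi)=1$; $\varphi$ is the $(1,1)$-tensor with $\varphi|_{\mathcal D}=\widetilde J|_{\mathcal D}$, $\varphi(\xi)=0$. It is called $\nabla$-parallel if $\nabla\varphi=0$, $\nabla\eta=0$ and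 $\nabla\xi=0$. The same definitions apply to $f|_U$ for an open set $U\subset M$ and a transversal vector field defined on $U$. *)

theory Defs
  imports "HOL-Analysis.Analysis"
begin

subsection \<open>Smooth maps between Euclidean spaces\<close>

text \<open>The predicates below are only meant for open \<open>S\<close>. The clause \<open>Suc\<close> ranges over all
  directional derivatives, so in finite dimension \<open>Ck_on k\<close> is the usual class of \<open>k\<close> times
  continuously differentiable maps.\<close>

primrec Ck_on :: "nat \<Rightarrow> 'a::real_normed_vector set \<Rightarrow> ('a \<Rightarrow> 'b::real_normed_vector) \<Rightarrow> bool" where
  "Ck_on 0 S g \<longleftrightarrow> continuous_on S g"
| "Ck_on (Suc k) S g \<longleftrightarrow>
     (\<forall>x\<in>S. g differentiable (at x)) \<and> (\<forall>v. Ck_on k S (\<lambda>x. frechet_derivative g (at x) v))"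

definition smooth_on :: "'a::real_normed_vector set \<Rightarrow> ('a \<Rightarrow> 'b::real_normed_vector) \<Rightarrow> bool" where
  "smooth_on S g \<longleftrightarrow> (\<forall>k. Ck_on k S g)"


subsection \<open>Smooth manifolds\<close>

text \<open>The underlying topological space of the manifold is the whole type \<open>'m\<close>. A chart is a pair of
  its domain and a map that is relevant on the domain only; the model space is \<open>real ^ 'd\<close>.\<close>

type_synonym ('m, 'd) chart = "'m set \<times> ('m \<Rightarrow> real ^ 'd)"

abbreviation dom_of :: "('m, 'd::finite) chart \<Rightarrow> 'm set" where
  "dom_of c \<equiv> fst c"

abbreviation map_of_chart :: "('m, 'd::finite) chart \<Rightarrow> 'm \<Rightarrow> real ^ 'd" where
  "map_of_chart c \<equiv> snd c"

definition inv_chart :: "('m, 'd::finite) chart \<Rightarrow> real ^ 'd \<Rightarrow> 'm" where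
  "inv_chart c = inv_into (dom_of c) (map_of_chart c)"

definition is_chart :: "('m::topological_space, 'd::finite) chart \<Rightarrow> bool" where
  "is_chart c \<longleftrightarrow> open (dom_of c) \<and> open (map_of_chart c ` dom_of c) \<and>
     homeomorphism (dom_of c) (map_of_chart c ` dom_of c) (map_of_chart c) (inv_chart c)"

definition transition :: "('m, 'd::finite) chart \<Rightarrow> ('m, 'd) chart \<Rightarrow> real ^ 'd \<Rightarrow> real ^ 'd" where
  "transition c c' = map_of_chart c' \<circ> inv_chart c"

definition compatible_charts :: "('m, 'd::finite) chart \<Rightarrow> ('m, 'd) chart \<Rightarrow> bool" where
  "compatible_charts c c' \<longleftrightarrow>
     smooth_on (map_of_chart c ` (dom_of c \<inter> dom_of c')) (transition c c') \<and>
     smooth_on (map_of_chart c' ` (dom_of c \<inter> dom_of c')) (transition c' c)"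

text \<open>A smooth structure is a maximal smooth atlas, so its elements are exactly the local coordinate
  systems of the manifold.\<close>

definition smooth_structure ::
  "('m::{t2_space, second_countable_topology}, 'd::finite) chart set \<Rightarrow> bool" where
  "smooth_structure A \<longleftrightarrow>
     (\<forall>c\<in>A. is_chart c) \<and> (\<Union>c\<in>A. dom_of c) = UNIV \<and>
     (\<forall>c\<in>A. \<forall>c'\<in>A. compatible_charts c c') \<and>
     (\<forall>c. is_chart c \<and> (\<forall>c'\<in>A. compatible_charts c c') \<longrightarrow> c \<in> A)"

definition orientable :: "('m, 'd::finite) chart set \<Rightarrow> bool" where
  "orientable A \<longleftrightarrow> (\<exists>B\<subseteq>A. (\<Union>c\<in>B. dom_of c) = UNIV \<and>
     (\<forall>c\<in>B. \<forall>c'\<in>B. \<forall>x \<in> map_of_chart c ` (dom_of c \<inter> dom_of c').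
        det (matrix (frechet_derivative (transition c c') (at x))) > 0))"

definition smooth_map_on ::
  "('m, 'd::finite) chart set \<Rightarrow> 'm set \<Rightarrow> ('m \<Rightarrow> 'b::real_normed_vector) \<Rightarrow> bool" where
  "smooth_map_on A U g \<longleftrightarrow>
     (\<forall>c\<in>A. smooth_on (map_of_chart c ` (dom_of c \<inter> U)) (g \<circ> inv_chart c))"

text \<open>A tangent vector at \<open>p\<close> assigns to every chart around \<open>p\<close> its component vector, subject to the
  usual transformation law; it is set to \<open>0\<close> at all other arguments. The vector space operations
  are the pointwise ones.\<close>

type_synonym ('m, 'd) tvec = "('m, 'd) chart \<Rightarrow> real ^ 'd"

definition charts_at :: "('m, 'd::finite) chart set \<Rightarrow> 'm \<Rightarrow> ('m, 'd) chart set" where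
  "charts_at A p = {c \<in> A. p \<in> dom_of c}"

definition tangent_space :: "('m, 'd::finite) chart set \<Rightarrow> 'm \<Rightarrow> ('m, 'd) tvec set" where
  "tangent_space A p = {v.
     (\<forall>c \<in> charts_at A p. \<forall>c' \<in> charts_at A p.
        v c' = frechet_derivative (transition c c') (at (map_of_chart c p)) (v c)) \<and>
     (\<forall>c. c \<notin> charts_at A p \<longrightarrow> v c = 0)}"

definition tzero :: "('m, 'd::finite) tvec" where
  "tzero = (\<lambda>c. 0)"

definition tcomb ::
  "real \<Rightarrow> ('m, 'd::finite) tvec \<Rightarrow> real \<Rightarrow> ('m, 'd) tvec \<Rightarrow> ('m, 'd) tvec" where
  "tcomb a v b w = (\<lambda>c. a *\<^sub>R v c + b *\<^sub>R w c)"

text \<open>The derivative \<open>v(g)\<close> of a vector valued map \<open>g\<close> in the direction of a tangent vector \<open>v\<close> at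
  \<open>p\<close>, computed in a chart around \<open>p\<close>; by the transformation law the choice is irrelevant. It
  serves as the differential \<open>f\<^sub>*v\<close> of a map \<open>f\<close> into a Euclidean space, as the derivative \<open>X(g)\<close>
  of a function, and as the flat derivative \<open>D\<^sub>X Z\<close> of a vector field \<open>Z\<close> along \<open>f\<close>.\<close>

definition tderiv ::
  "('m, 'd::finite) chart set \<Rightarrow> ('m \<Rightarrow> 'b::real_normed_vector) \<Rightarrow> 'm \<Rightarrow> ('m, 'd) tvec \<Rightarrow> 'b" where
  "tderiv A g p v = (let c = (SOME c. c \<in> charts_at A p)
     in frechet_derivative (g \<circ> inv_chart c) (at (map_of_chart c p)) (v c))"

type_synonym ('m, 'd) vfield = "'m \<Rightarrow> ('m, 'd) tvec"

definition smooth_vfield_on ::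
  "('m, 'd::finite) chart set \<Rightarrow> 'm set \<Rightarrow> ('m, 'd) vfield \<Rightarrow> bool" where
  "smooth_vfield_on A U X \<longleftrightarrow> (\<forall>p\<in>U. X p \<in> tangent_space A p) \<and>
     (\<forall>c\<in>A. smooth_on (map_of_chart c ` (dom_of c \<inter> U)) (\<lambda>x. X (inv_chart c x) c))"

definition coord_field ::
  "('m, 'd::finite) chart set \<Rightarrow> ('m, 'd) chart \<Rightarrow> 'd \<Rightarrow> ('m, 'd) vfield" where
  "coord_field A c i p = (\<lambda>c'. if c' \<in> charts_at A p
     then frechet_derivative (transition c c') (at (map_of_chart c p)) (axis i 1) else 0)"

definition one_form_on ::
  "('m::topological_space, 'd::finite) chart set \<Rightarrow> 'm set \<Rightarrow>
   ('m \<Rightarrow> ('m, 'd) tvec \<Rightarrow> real) \<Rightarrow> bool" where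
  "one_form_on A U \<eta> \<longleftrightarrow>
     (\<forall>p\<in>U. \<forall>v \<in> tangent_space A p. \<forall>w \<in> tangent_space A p. \<forall>a b.
        \<eta> p (tcomb a v b w) = a * \<eta> p v + b * \<eta> p w) \<and>
     (\<forall>V X. open V \<and> V \<subseteq> U \<and> smooth_vfield_on A V X \<longrightarrow> smooth_map_on A V (\<lambda>p. \<eta> p (X p)))"

definition tensor11_on ::
  "('m::topological_space, 'd::finite) chart set \<Rightarrow> 'm set \<Rightarrow>
   ('m \<Rightarrow> ('m, 'd) tvec \<Rightarrow> ('m, 'd) tvec) \<Rightarrow> bool" where
  "tensor11_on A U \<phi> \<longleftrightarrow>
     (\<forall>p\<in>U. \<forall>v \<in> tangent_space A p. \<phi> p v \<in> tangent_space A p) \<and>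
     (\<forall>p\<in>U. \<forall>v \<in> tangent_space A p. \<forall>w \<in> tangent_space A p. \<forall>a b.
        \<phi> p (tcomb a v b w) = tcomb a (\<phi> p v) b (\<phi> p w)) \<and>
     (\<forall>V X. open V \<and> V \<subseteq> U \<and> smooth_vfield_on A V X \<longrightarrow> smooth_vfield_on A V (\<lambda>p. \<phi> p (X p)))"


subsection \<open>Affine hypersurfaces of the para-complex space\<close>

text \<open>The space of dimension \<open>2n+2\<close> is \<open>(real ^ 'k) \<times> (real ^ 'k)\<close> with \<open>CARD('k) = n + 1\<close>, the first
  factor carrying the coordinates \<open>x\<^sub>i\<close> and the second one the coordinates \<open>y\<^sub>i\<close>.\<close>

type_synonym 'k pspace = "(real ^ 'k) \<times> (real ^ 'k)"

definition paraJ :: "'k::finite pspace \<Rightarrow> 'k pspace" where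
  "paraJ z = (snd z, fst z)"

definition immersion :: "('m, 'd::finite) chart set \<Rightarrow> ('m \<Rightarrow> 'b::real_normed_vector) \<Rightarrow> bool" where
  "immersion A f \<longleftrightarrow> smooth_map_on A UNIV f \<and> (\<forall>p. inj_on (tderiv A f p) (tangent_space A p))"

definition affine_hypersurface ::
  "nat \<Rightarrow> ('m::{t2_space, second_countable_topology}, 'd::finite) chart set \<Rightarrow>
   ('m \<Rightarrow> 'k::finite pspace) \<Rightarrow> bool" where
  "affine_hypersurface n A f \<longleftrightarrow> CARD('d) = 2 * n + 1 \<and> CARD('k) = n + 1 \<and>
     smooth_structure A \<and> connected (UNIV :: 'm set) \<and> orientable A \<and> immersion A f"

definition transversal_on ::
  "('m, 'd::finite) chart set \<Rightarrow> ('m \<Rightarrow> 'b::real_normed_vector) \<Rightarrow> 'm set \<Rightarrow> ('m \<Rightarrow> 'b) \<Rightarrow> bool" where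
  "transversal_on A f U C \<longleftrightarrow> smooth_map_on A U C \<and>
     (\<forall>p\<in>U. C p \<notin> tderiv A f p ` tangent_space A p)"

definition J_tangent_on ::
  "('m, 'd::finite) chart set \<Rightarrow> ('m \<Rightarrow> 'k::finite pspace) \<Rightarrow> 'm set \<Rightarrow>
   ('m \<Rightarrow> 'k pspace) \<Rightarrow> bool" where
  "J_tangent_on A f U C \<longleftrightarrow> (\<forall>p\<in>U. paraJ (C p) \<in> tderiv A f p ` tangent_space A p)"

text \<open>A connection is applied to fields defined on arbitrary open subsets \<open>V\<close> of \<open>U\<close>. Since \<open>C\<close> is
  transversal and \<open>f\<close> is an immersion, the formula of Gauss below determines \<open>nabla X Y p\<close> and
  \<open>h p (X p) (Y p)\<close> for \<open>p \<in> V\<close>.\<close>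

type_synonym ('m, 'd) connection = "('m, 'd) vfield \<Rightarrow> ('m, 'd) vfield \<Rightarrow> ('m, 'd) vfield"

definition induced_connection_on ::
  "('m::topological_space, 'd::finite) chart set \<Rightarrow> ('m \<Rightarrow> 'b::real_normed_vector) \<Rightarrow> 'm set \<Rightarrow>
   ('m \<Rightarrow> 'b) \<Rightarrow> ('m, 'd) connection \<Rightarrow>
   ('m \<Rightarrow> ('m, 'd) tvec \<Rightarrow> ('m, 'd) tvec \<Rightarrow> real) \<Rightarrow> bool" where
  "induced_connection_on A f U C nabla h \<longleftrightarrow>
     (\<forall>V X Y. open V \<and> V \<subseteq> U \<and> smooth_vfield_on A V X \<and> smooth_vfield_on A V Y \<longrightarrow>
        smooth_vfield_on A V (nabla X Y) \<and>
        (\<forall>p\<in>V. tderiv A (\<lambda>q. tderiv A f q (Y q)) p (X p) =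
           tderiv A f p (nabla X Y p) + h p (X p) (Y p) *\<^sub>R C p))"

definition pdist ::
  "('m, 'd::finite) chart set \<Rightarrow> ('m \<Rightarrow> 'k::finite pspace) \<Rightarrow> 'm \<Rightarrow> ('m, 'd) tvec set" where
  "pdist A f p = {v \<in> tangent_space A p. tderiv A f p v \<in>
     tderiv A f p ` tangent_space A p \<inter> paraJ ` (tderiv A f p ` tangent_space A p)}"

definition pdist_plus ::
  "('m, 'd::finite) chart set \<Rightarrow> ('m \<Rightarrow> 'k::finite pspace) \<Rightarrow> 'm \<Rightarrow> ('m, 'd) tvec set" where
  "pdist_plus A f p = {v \<in> pdist A f p. paraJ (tderiv A f p v) = tderiv A f p v}"

definition pdist_minus ::
  "('m, 'd::finite) chart set \<Rightarrow> ('m \<Rightarrow> 'k::finite pspace) \<Rightarrow> 'm \<Rightarrow> ('m, 'd) tvec set" where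
  "pdist_minus A f p = {v \<in> pdist A f p. paraJ (tderiv A f p v) = - tderiv A f p v}"

definition induced_paracontact_on ::
  "('m::topological_space, 'd::finite) chart set \<Rightarrow> ('m \<Rightarrow> 'k::finite pspace) \<Rightarrow> 'm set \<Rightarrow>
   ('m \<Rightarrow> 'k pspace) \<Rightarrow> ('m \<Rightarrow> ('m, 'd) tvec \<Rightarrow> ('m, 'd) tvec) \<Rightarrow> ('m, 'd) vfield \<Rightarrow>
   ('m \<Rightarrow> ('m, 'd) tvec \<Rightarrow> real) \<Rightarrow> bool" where
  "induced_paracontact_on A f U C \<phi> \<xi> \<eta> \<longleftrightarrow>
     smooth_vfield_on A U \<xi> \<and> one_form_on A U \<eta> \<and> tensor11_on A U \<phi> \<and>
     (\<forall>p\<in>U. tderiv A f p (\<xi> p) = paraJ (C p) \<and>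
        (\<forall>v \<in> pdist A f p. \<eta> p v = 0) \<and> \<eta> p (\<xi> p) = 1 \<and>
        (\<forall>v \<in> pdist A f p. tderiv A f p (\<phi> p v) = paraJ (tderiv A f p v)) \<and>
        \<phi> p (\<xi> p) = tzero)"


subsection \<open>Parallel structures\<close>

definition parallel_vfield_on ::
  "('m::topological_space, 'd::finite) chart set \<Rightarrow> 'm set \<Rightarrow> ('m, 'd) connection \<Rightarrow>
   ('m, 'd) vfield \<Rightarrow> bool" where
  "parallel_vfield_on A U nabla \<xi> \<longleftrightarrow>
     (\<forall>V X. open V \<and> V \<subseteq> U \<and> smooth_vfield_on A V X \<longrightarrow> (\<forall>p\<in>V. nabla X \<xi> p = tzero))"

definition parallel_form_on ::
  "('m::topological_space, 'd::finite) chart set \<Rightarrow> 'm set \<Rightarrow> ('m, 'd) connection \<Rightarrow>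
   ('m \<Rightarrow> ('m, 'd) tvec \<Rightarrow> real) \<Rightarrow> bool" where
  "parallel_form_on A U nabla \<eta> \<longleftrightarrow>
     (\<forall>V X Y. open V \<and> V \<subseteq> U \<and> smooth_vfield_on A V X \<and> smooth_vfield_on A V Y \<longrightarrow>
        (\<forall>p\<in>V. tderiv A (\<lambda>q. \<eta> q (Y q)) p (X p) - \<eta> p (nabla X Y p) = 0))"

definition parallel_tensor11_on ::
  "('m::topological_space, 'd::finite) chart set \<Rightarrow> 'm set \<Rightarrow> ('m, 'd) connection \<Rightarrow>
   ('m \<Rightarrow> ('m, 'd) tvec \<Rightarrow> ('m, 'd) tvec) \<Rightarrow> bool" where
  "parallel_tensor11_on A U nabla \<phi> \<longleftrightarrow>
     (\<forall>V X Y. open V \<and> V \<subseteq> U \<and> smooth_vfield_on A V X \<and> smooth_vfield_on A V Y \<longrightarrow>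
        (\<forall>p\<in>V. tcomb 1 (nabla X (\<lambda>q. \<phi> q (Y q)) p) (- 1) (\<phi> p (nabla X Y p)) = tzero))"

definition parallel_structure_on ::
  "('m::topological_space, 'd::finite) chart set \<Rightarrow> 'm set \<Rightarrow> ('m, 'd) connection \<Rightarrow>
   ('m \<Rightarrow> ('m, 'd) tvec \<Rightarrow> ('m, 'd) tvec) \<Rightarrow> ('m, 'd) vfield \<Rightarrow>
   ('m \<Rightarrow> ('m, 'd) tvec \<Rightarrow> real) \<Rightarrow> bool" where
  "parallel_structure_on A U nabla \<phi> \<xi> \<eta> \<longleftrightarrow> parallel_tensor11_on A U nabla \<phi> \<and>
     parallel_form_on A U nabla \<eta> \<and> parallel_vfield_on A U nabla \<xi>"

end

theory Submission
  imports Defs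
begin

text \<open>Write \<open>D\<^sup>\<sigma>\<close>, \<open>\<sigma> = \<plusminus>1\<close>, for the two eigendistributions of \<open>J\<close>.
  Since \<open>\<nabla>\<eta> = 0\<close>, the formula of Gauss shows that a section of \<open>D\<^sup>\<sigma>\<close> is differentiated
  by the flat connection into \<open>D\<^sup>\<sigma>\<close> again, without a component along \<open>C\<close>. Hence
  \<open>f\<^sub>*D\<^sup>\<sigma>\<close> is locally a constant subspace, a hyperplane of the \<open>\<sigma>\<close>-eigenspace of \<open>J\<close>, and \<open>f(M)\<close>
  is locally the product of these two \<open>n\<close>-planes with a curve in a plane spanned by eigenvectors
  \<open>ya\<close>, \<open>yb\<close> of \<open>J\<close>, on which neither component of the velocity vanishes. Reparametrise the curve so
  that the product of the two components of its velocity \<open>w\<close> is constant. Then \<open>w'\<close> is proportional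
  to \<open>J w\<close>, so for the transversal field \<open>J w\<close> all Christoffel symbols in the product coordinates
  vanish and \<open>\<xi>\<close> is the last coordinate field.\<close>

subsection \<open>Calculus of smooth maps\<close>

text \<open>Constancy of the eigendistributions is obtained dually and without integrating
  distributions: a fixed vector orthogonal to the image of one of them at \<open>p\<close> stays
  orthogonal along every ray of a chart, because its pairings with a spanning family of sections
  solve a homogeneous linear system of differential equations. The coordinates are then inner
  products of \<open>f\<close> with a fixed frame, and the inverse function theorem turns them into
  a chart. The two conormals \<open>ya\<close>, \<open>yb\<close> restrict to nonzero multiples of
  the same form \<eta>, so locally the inner product of \<open>f\<close> with \<open>yb\<close> is a
  function of s, the one with \<open>ya\<close>, with nowhere vanishing derivative \<gamma>. The
  condition on the velocity comes from J keeping the \<open>ya\<close>-component of \<open>w\<close>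
  and negating its \<open>yb\<close>-component: w' = \<lambda> J w says that the logarithmic
  derivatives of the two components are opposite, hence that their product is constant. If the new
  parameter has derivative \<tau> with respect to s, the components are 1/\<tau> and
  \<gamma>/\<tau>, with product \<gamma>/\<tau>^2; this dictates that \<tau> is the square root of
  \<epsilon>\<gamma>, where \<epsilon> is the sign of \<gamma>.\<close>

lemma Ck_on_cong:
  assumes "open S" "\<And>x. x \<in> S \<Longrightarrow> f x = g x" "Ck_on k S f"
  shows "Ck_on k S g"
  using assms(2,3)
proof (induction k arbitrary: f g)
  case 0
  then show ?case by (simp cong: continuous_on_cong)
next
  case (Suc k)
  have d: "f differentiable at x" if "x \<in> S" for x using Suc.prems that by simp
  have eq: "frechet_derivative f (at x) = frechet_derivative g (at x)" if "x \<in> S" for x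
    using frechet_derivative_transform_within_open[OF d[OF that] assms(1) that] Suc.prems(1) by blast
  have "g differentiable at x" if "x \<in> S" for x
    using d[OF that] Suc.prems(1) assms(1) that
    by (meson has_derivative_transform_within_open differentiable_def)
  moreover have "Ck_on k S (\<lambda>x. frechet_derivative g (at x) v)" for v
    using Suc.IH[of "\<lambda>x. frechet_derivative f (at x) v" "\<lambda>x. frechet_derivative g (at x) v"]
      eq Suc.prems(2) by simp
  ultimately show ?case by simp
qed

text \<open>Uniqueness of derivatives lets an explicit formula replace
  \<open>frechet_derivative\<close>. The induction steps of the closure lemmas below rest on
  this.\<close>

lemma Ck_on_SucI:
  assumes "open S" "\<And>x. x \<in> S \<Longrightarrow> (g has_derivative g' x) (at x)" "\<And>v. Ck_on k S (\<lambda>x. g' x v)"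
  shows "Ck_on (Suc k) S g"
proof -
  have "g' x v = frechet_derivative g (at x) v" if "x \<in> S" for x v
    using frechet_derivative_at[OF assms(2)[OF that]] by simp
  then have "Ck_on k S (\<lambda>x. frechet_derivative g (at x) v)" for v
    by (rule Ck_on_cong[OF assms(1) _ assms(3)])
  moreover have "g differentiable at x" if "x \<in> S" for x
    using assms(2)[OF that] differentiableI by blast
  ultimately show ?thesis by simp
qed

lemma Ck_on_Suc_has_derivative:
  "Ck_on (Suc k) S g \<Longrightarrow> x \<in> S \<Longrightarrow> (g has_derivative frechet_derivative g (at x)) (at x)"
  using frechet_derivative_works by auto

lemma Ck_on_Suc_continuous: "Ck_on (Suc k) S g \<Longrightarrow> continuous_on S g"
  by (auto intro!: continuous_at_imp_continuous_on differentiable_imp_continuous_within)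

lemma Ck_on_SucD: "Ck_on (Suc k) S g \<Longrightarrow> Ck_on k S g"
proof (induction k arbitrary: g)
  case 0
  then show ?case using Ck_on_Suc_continuous[of 0] unfolding Ck_on.simps(1) by blast
next
  case (Suc k)
  have *: "\<forall>x\<in>S. g differentiable (at x)" "\<And>v. Ck_on (Suc k) S (\<lambda>x. frechet_derivative g (at x) v)"
    using Suc.prems unfolding Ck_on.simps(2)[of "Suc k"] by blast+
  have "Ck_on k S (\<lambda>x. frechet_derivative g (at x) v)" for v
    using Suc.IH *(2) by blast
  then show ?case using *(1) by simp
qed

lemma Ck_on_subset: "Ck_on k S g \<Longrightarrow> T \<subseteq> S \<Longrightarrow> Ck_on k T g"
  by (induction k arbitrary: g) (auto intro: continuous_on_subset)

lemma Ck_on_const: "open S \<Longrightarrow> Ck_on k S (\<lambda>x. c)"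
  by (induction k arbitrary: c) (auto intro!: continuous_intros)

lemma Ck_on_add:
  assumes "open S"
  shows "Ck_on k S f \<Longrightarrow> Ck_on k S g \<Longrightarrow> Ck_on k S (\<lambda>x. f x + g x)"
proof (induction k arbitrary: f g)
  case (Suc k)
  show ?case
    by (rule Ck_on_SucI[OF assms has_derivative_add[OF Ck_on_Suc_has_derivative Ck_on_Suc_has_derivative]])
      (use Suc in auto)
qed (auto intro: continuous_intros)

lemma Ck_on_sum:
  assumes "open S" "\<And>i. i \<in> I \<Longrightarrow> Ck_on k S (f i)"
  shows "Ck_on k S (\<lambda>x. \<Sum>i\<in>I. f i x)"
  using assms(2)
  by (induction I rule: infinite_finite_induct) (auto intro: Ck_on_const Ck_on_add assms(1))

lemma Ck_on_linear:
  assumes "open S" "bounded_linear L" "Ck_on k S f"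
  shows "Ck_on k S (\<lambda>x. L (f x))"
  using assms(3)
proof (induction k arbitrary: f)
  case 0
  then show ?case using assms(2) by (auto intro: bounded_linear.continuous_on)
next
  case (Suc k)
  show ?case
    by (rule Ck_on_SucI[OF assms(1) bounded_linear.has_derivative[OF assms(2) Ck_on_Suc_has_derivative]])
      (use Suc in auto)
qed

lemma (in bounded_bilinear) Ck_on:
  assumes "open S"
  shows "Ck_on k S f \<Longrightarrow> Ck_on k S g \<Longrightarrow> Ck_on k S (\<lambda>x. prod (f x) (g x))"
proof (induction k arbitrary: f g)
  case 0
  then show ?case by (auto intro: continuous_on)
next
  case (Suc k)
  have "Ck_on k S f" "Ck_on k S g" using Suc.prems Ck_on_SucD by blast+
  then show ?case
    by (intro Ck_on_SucI[OF assms FDERIV[OF Ck_on_Suc_has_derivative[OF Suc.prems(1)]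
        Ck_on_Suc_has_derivative[OF Suc.prems(2)]]])
      (use Suc in \<open>auto intro!: Ck_on_add assms\<close>)
qed

text \<open>The chain rule applies the derivative of \<open>g\<close> to a direction that moves with
  \<open>x\<close>, whereas \<open>Ck_on\<close> speaks of fixed directions only. Expanding the
  moving direction in \<open>Basis\<close> leaves fixed directions with coefficients of class
  \<open>k\<close>.\<close>

lemma Ck_on_compose:
  fixes f :: "'a::real_normed_vector \<Rightarrow> 'b::euclidean_space" and g :: "'b \<Rightarrow> 'c::real_normed_vector"
  assumes "open S" "f ` S \<subseteq> T"
  shows "Ck_on k T g \<Longrightarrow> Ck_on k S f \<Longrightarrow> Ck_on k S (\<lambda>x. g (f x))"
  using assms(2)
proof (induction k arbitrary: g)
  case 0
  then show ?case by (auto intro: continuous_on_compose2)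
next
  case (Suc k)
  let ?Dg = "\<lambda>x. frechet_derivative g (at (f x))" and ?Df = "\<lambda>x. frechet_derivative f (at x)"
  show ?case
  proof (rule Ck_on_SucI[OF assms(1)])
    fix x assume x: "x \<in> S"
    then have fx: "f x \<in> T" using Suc.prems(3) by blast
    have "((\<lambda>x. g (f x)) has_derivative (\<lambda>v. ?Dg x (?Df x v))) (at x)"
      using has_derivative_compose[OF Ck_on_Suc_has_derivative[OF Suc.prems(2) x]
          Ck_on_Suc_has_derivative[OF Suc.prems(1) fx]] .
    moreover have "?Dg x (?Df x v) = (\<Sum>b\<in>Basis. (?Df x v \<bullet> b) *\<^sub>R ?Dg x b)" for v
    proof -
      have lin: "linear (?Dg x)"
        using Suc.prems(1) fx linear_frechet_derivative by auto
      have "?Dg x (?Df x v) = ?Dg x (\<Sum>b\<in>Basis. (?Df x v \<bullet> b) *\<^sub>R b)"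
        by (simp add: euclidean_representation)
      also have "\<dots> = (\<Sum>b\<in>Basis. (?Df x v \<bullet> b) *\<^sub>R ?Dg x b)"
        using lin by (simp add: linear_sum linear_scale)
      finally show ?thesis .
    qed
    ultimately show "((\<lambda>x. g (f x)) has_derivative
        (\<lambda>v. \<Sum>b\<in>Basis. (?Df x v \<bullet> b) *\<^sub>R ?Dg x b)) (at x)" by simp
  next
    fix v
    have f: "Ck_on k S f" using Suc.prems(2) Ck_on_SucD by blast
    have "Ck_on k S (\<lambda>x. ?Dg x b)" for b
      by (rule Suc.IH[of "\<lambda>y. frechet_derivative g (at y) b"]) (use Suc.prems f in auto)
    moreover have "Ck_on k S (\<lambda>x. ?Df x v)" using Suc.prems by simp
    ultimately show "Ck_on k S (\<lambda>x. \<Sum>b\<in>Basis. (?Df x v \<bullet> b) *\<^sub>R ?Dg x b)"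
      by (intro Ck_on_sum bounded_bilinear.Ck_on[OF bounded_bilinear_scaleR]
          Ck_on_linear[OF _ bounded_linear_inner_left] assms(1))
  qed
qed

text \<open>The derivative of the reciprocal contains the reciprocal itself, undifferentiated, so
  class \<open>k\<close> of the reciprocal yields class \<open>k\<close> of its derivative.\<close>

lemma Ck_on_inverse:
  fixes f :: "'a::real_normed_vector \<Rightarrow> real"
  assumes "open S" "\<And>x. x \<in> S \<Longrightarrow> f x \<noteq> 0"
  shows "Ck_on k S f \<Longrightarrow> Ck_on k S (\<lambda>x. inverse (f x))"
proof (induction k)
  case 0
  then show ?case using assms by (auto intro: continuous_intros)
next
  case (Suc k)
  have "Ck_on k S (\<lambda>x. inverse (f x))" using Suc Ck_on_SucD by blast
  then have "Ck_on k S (\<lambda>x. - (inverse (f x) * frechet_derivative f (at x) v * inverse (f x)))" for v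
    using Suc.prems assms(1)
    by (intro Ck_on_linear[OF _ bounded_linear_minus[OF bounded_linear_ident]]
        bounded_bilinear.Ck_on[OF bounded_bilinear_mult]) auto
  then show ?case
    using Suc.prems assms
    by (intro Ck_on_SucI[OF assms(1) Deriv.has_derivative_inverse[OF _ Ck_on_Suc_has_derivative]]) auto
qed

text \<open>Same bootstrapping: the derivative is a multiple of the reciprocal of
  \<open>sqrt\<close>, which has class \<open>k\<close> by the induction hypothesis.\<close>

lemma Ck_on_sqrt: "Ck_on k {0<..} sqrt"
proof (induction k)
  case 0
  then show ?case by (auto intro: continuous_intros)
next
  case (Suc k)
  have "Ck_on k {0<..} (\<lambda>x. inverse (sqrt x))"
    by (rule Ck_on_inverse[OF open_greaterThan _ Suc]) auto
  then have "Ck_on k {0<..} (\<lambda>x. (v / 2) *\<^sub>R inverse (sqrt x))" for v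
    by (intro Ck_on_linear[OF open_greaterThan bounded_linear_scaleR_right])
  moreover have "(sqrt has_derivative (\<lambda>v. (v / 2) *\<^sub>R inverse (sqrt x))) (at x)" if "x \<in> {0<..}" for x
  proof -
    have "(\<lambda>v. (v / 2) *\<^sub>R inverse (sqrt x)) = (*) (inverse (sqrt x) / 2)" by auto
    then show ?thesis using DERIV_real_sqrt[of x] that by (simp add: has_field_derivative_def)
  qed
  ultimately show ?case by (intro Ck_on_SucI) auto
qed

section \<open>Closure properties of smooth maps\<close>

lemma smooth_on_imp_differentiable: "smooth_on S f \<Longrightarrow> x \<in> S \<Longrightarrow> f differentiable at x"
  unfolding smooth_on_def using Ck_on.simps(2)[of 0 S f] by blast

lemma smooth_on_has_derivative:
  "smooth_on S f \<Longrightarrow> x \<in> S \<Longrightarrow> (f has_derivative frechet_derivative f (at x)) (at x)"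
  using smooth_on_imp_differentiable frechet_derivative_works by blast

lemma smooth_on_imp_continuous_on: "smooth_on S f \<Longrightarrow> continuous_on S f"
  unfolding smooth_on_def using Ck_on.simps(1)[of S f] by blast

lemma smooth_on_frechet: "smooth_on S f \<Longrightarrow> smooth_on S (\<lambda>x. frechet_derivative f (at x) v)"
  unfolding smooth_on_def using Ck_on.simps(2)[of _ S f] by blast

lemma smooth_onI_deriv:
  assumes "open S" "\<And>x. x \<in> S \<Longrightarrow> (g has_derivative g' x) (at x)" "\<And>v. smooth_on S (\<lambda>x. g' x v)"
  shows "smooth_on S g"
proof -
  have "Ck_on (Suc k) S g" for k using Ck_on_SucI[OF assms(1,2)] assms(3) unfolding smooth_on_def by blast
  then show ?thesis unfolding smooth_on_def using Ck_on_SucD by blast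
qed

lemma smooth_on_cong:
  "smooth_on S f \<Longrightarrow> open S \<Longrightarrow> (\<And>x. x \<in> S \<Longrightarrow> f x = g x) \<Longrightarrow> smooth_on S g"
  unfolding smooth_on_def using Ck_on_cong by blast

lemma smooth_on_subset: "smooth_on S f \<Longrightarrow> T \<subseteq> S \<Longrightarrow> smooth_on T f"
  unfolding smooth_on_def using Ck_on_subset by blast

lemma smooth_on_const [simp]: "open S \<Longrightarrow> smooth_on S (\<lambda>x. c)"
  unfolding smooth_on_def using Ck_on_const by blast

lemma smooth_on_add:
  "smooth_on S f \<Longrightarrow> smooth_on S g \<Longrightarrow> open S \<Longrightarrow> smooth_on S (\<lambda>x. f x + g x)"
  unfolding smooth_on_def using Ck_on_add by blast

lemma smooth_on_sum:
  "(\<And>i. i \<in> I \<Longrightarrow> smooth_on S (f i)) \<Longrightarrow> open S \<Longrightarrow> smooth_on S (\<lambda>x. \<Sum>i\<in>I. f i x)"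
  unfolding smooth_on_def by (intro allI Ck_on_sum) auto

lemma smooth_on_linear:
  "bounded_linear L \<Longrightarrow> smooth_on S f \<Longrightarrow> open S \<Longrightarrow> smooth_on S (\<lambda>x. L (f x))"
  unfolding smooth_on_def using Ck_on_linear by blast

lemma smooth_on_ident: "open S \<Longrightarrow> smooth_on S (\<lambda>x. x)"
  by (rule smooth_onI_deriv[OF _ has_derivative_ident]) auto

lemma (in bounded_bilinear) smooth_on:
  "smooth_on S f \<Longrightarrow> smooth_on S g \<Longrightarrow> open S \<Longrightarrow> smooth_on S (\<lambda>x. prod (f x) (g x))"
  unfolding smooth_on_def using Ck_on by blast

lemmas smooth_on_scaleR = bounded_bilinear.smooth_on[OF bounded_bilinear_scaleR]
lemma smooth_on_compose:
  fixes f :: "'a::real_normed_vector \<Rightarrow> 'b::euclidean_space"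
  shows "smooth_on T g \<Longrightarrow> smooth_on S f \<Longrightarrow> f ` S \<subseteq> T \<Longrightarrow> open S \<Longrightarrow> smooth_on S (\<lambda>x. g (f x))"
  unfolding smooth_on_def using Ck_on_compose by blast

lemma smooth_on_sqrt:
  fixes f :: "'a::real_normed_vector \<Rightarrow> real"
  assumes "smooth_on S f" "\<And>x. x \<in> S \<Longrightarrow> f x > 0" "open S"
  shows "smooth_on S (\<lambda>x. sqrt (f x))"
proof (rule smooth_on_compose[OF _ assms(1) _ assms(3)])
  show "smooth_on {0<..} sqrt" unfolding smooth_on_def using Ck_on_sqrt by blast
qed (use assms(2) in auto)

lemma Ck_on_vec:
  fixes f :: "'a::real_normed_vector \<Rightarrow> real ^ 'n"
  assumes "\<And>i. Ck_on k S (\<lambda>x. f x $ i)" "open S"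
  shows "Ck_on k S f"
proof -
  have eq: "f = (\<lambda>x. \<Sum>i\<in>UNIV. (f x $ i) *\<^sub>R axis i 1)"
    using basis_expansion[of "f _"] by (auto simp: scalar_mult_eq_scaleR)
  show ?thesis
    by (subst eq, intro Ck_on_sum bounded_bilinear.Ck_on[OF bounded_bilinear_scaleR] assms Ck_on_const)
qed

lemma smooth_on_vec:
  fixes f :: "'a::real_normed_vector \<Rightarrow> real ^ 'n"
  shows "(\<And>i. smooth_on S (\<lambda>x. f x $ i)) \<Longrightarrow> open S \<Longrightarrow> smooth_on S f"
  unfolding smooth_on_def by (intro allI Ck_on_vec) auto

lemma smooth_on_vec_nth:
  fixes f :: "'a::real_normed_vector \<Rightarrow> real ^ 'n"
  shows "smooth_on S f \<Longrightarrow> open S \<Longrightarrow> smooth_on S (\<lambda>x. f x $ i)"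
  by (rule smooth_on_linear[OF bounded_linear_vec_nth])

section \<open>Determinants and the smooth inverse function theorem\<close>

lemma Ck_on_prod_fin:
  fixes f :: "'i \<Rightarrow> 'a::real_normed_vector \<Rightarrow> real"
  assumes "open S" "\<And>i. i \<in> I \<Longrightarrow> Ck_on k S (f i)"
  shows "Ck_on k S (\<lambda>x. \<Prod>i\<in>I. f i x)"
  using assms(2)
  by (induction I rule: infinite_finite_induct)
    (auto intro: Ck_on_const bounded_bilinear.Ck_on[OF bounded_bilinear_mult] assms(1))

lemma Ck_on_det:
  fixes M :: "'a::real_normed_vector \<Rightarrow> real ^ 'n ^ 'n"
  assumes "open S" "\<And>i j. Ck_on k S (\<lambda>x. M x $ i $ j)"
  shows "Ck_on k S (\<lambda>x. det (M x))"
  unfolding det_def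
  by (intro Ck_on_sum bounded_bilinear.Ck_on[OF bounded_bilinear_mult] Ck_on_prod_fin Ck_on_const assms)

text \<open>Bootstrapping by Cramer's rule: \<open>g' y v\<close> is a quotient of determinants in
  the entries of \<open>M y\<close>, the Jacobian matrix of \<open>G\<close> at \<open>g y\<close>.
  If \<open>g\<close> has class \<open>k\<close>, so have these entries by composition, hence so has
  \<open>g'\<close>, and \<open>g\<close> gains one order.\<close>

lemma smooth_on_inverse_map:
  fixes G :: "real ^ 'd \<Rightarrow> real ^ 'd"
  assumes "open S" "open V" "smooth_on S G" "g ` V \<subseteq> S"
    and der: "\<And>y. y \<in> V \<Longrightarrow> (g has_derivative g' y) (at y)"
    and inv: "\<And>y. y \<in> V \<Longrightarrow> g' y = inv (frechet_derivative G (at (g y)))"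
    and bij: "\<And>y. y \<in> V \<Longrightarrow> bij (frechet_derivative G (at (g y)))"
  shows "smooth_on V g"
proof -
  define M where "M y = matrix (frechet_derivative G (at (g y)))" for y
  have det: "det (M y) \<noteq> 0" if "y \<in> V" for y
  proof -
    have "linear (frechet_derivative G (at (g y)))"
      using assms(3,4) that smooth_on_imp_differentiable linear_frechet_derivative by blast
    then show ?thesis unfolding M_def using det_nz_iff_inj bij[OF that] bij_is_inj by blast
  qed
  have cr: "g' y v = (\<chi> k. det (\<chi> i j. if j = k then v $ i else M y $ i $ j) * inverse (det (M y)))"
    if y: "y \<in> V" for y v
  proof -
    have lin: "linear (frechet_derivative G (at (g y)))"
      using assms(3,4) y smooth_on_imp_differentiable linear_frechet_derivative by blast
    have "M y *v g' y v = frechet_derivative G (at (g y)) (g' y v)"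
      unfolding M_def by (simp add: matrix_vector_mul(2)[OF lin])
    also have "\<dots> = v"
      using inv[OF y] bij[OF y] by (simp add: bij_is_surj surj_f_inv_f)
    finally show ?thesis using cramer[OF det[OF y], of "g' y v" v] by (simp add: divide_inverse)
  qed
  have "Ck_on k V g" for k
  proof (induction k)
    case 0
    then show ?case using der
      by (auto intro!: continuous_at_imp_continuous_on intro: has_derivative_continuous)
  next
    case (Suc k)
    have M: "Ck_on k V (\<lambda>y. M y $ i $ j)" for i j
    proof -
      have "Ck_on k S (\<lambda>x. frechet_derivative G (at x) (axis j 1))"
        using smooth_on_frechet[OF assms(3)] unfolding smooth_on_def by blast
      from Ck_on_compose[OF assms(2,4) this Suc]
      have "Ck_on k V (\<lambda>y. frechet_derivative G (at (g y)) (axis j 1) $ i)"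
        by (rule Ck_on_linear[OF assms(2) bounded_linear_vec_nth])
      then show ?thesis unfolding M_def matrix_def by simp
    qed
    have N: "Ck_on k V (\<lambda>y. (\<chi> i j. if j = l then v $ i else M y $ i $ j) $ i $ j)" for l v i j
      by (cases "j = l") (auto simp: M Ck_on_const[OF assms(2)])
    show ?case
    proof (rule Ck_on_SucI[OF assms(2)])
      fix y assume "y \<in> V"
      then show "(g has_derivative (\<lambda>v. \<chi> k. det (\<chi> i j. if j = k then v $ i else M y $ i $ j)
          * inverse (det (M y)))) (at y)"
        using has_derivative_eq_rhs[OF der ext[OF cr]] by blast
    next
      fix v
      show "Ck_on k V (\<lambda>y. \<chi> k. det (\<chi> i j. if j = k then v $ i else M y $ i $ j)
          * inverse (det (M y)))"
        by (rule Ck_on_vec[OF _ assms(2)], simp)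
          (intro bounded_bilinear.Ck_on[OF bounded_bilinear_mult] Ck_on_inverse Ck_on_det assms(2) N M det)
    qed
  qed
  then show ?thesis by (simp add: smooth_on_def)
qed

text \<open>The inverse function theorem supplies a differentiable inverse together with the formula
  for its derivative, which is all that \<open>smooth_on_inverse_map\<close> needs to raise the
  regularity.\<close>

lemma smooth_inverse_function:
  fixes G :: "real ^ 'd \<Rightarrow> real ^ 'd"
  assumes "open S" "x0 \<in> S" "smooth_on S G" "inj (frechet_derivative G (at x0))"
  obtains U V g where "open U" "U \<subseteq> S" "x0 \<in> U" "open V" "homeomorphism U V G g" "smooth_on V g"
proof -
  \<comment> \<open>\<open>inverse_function_theorem\<close> expects the derivative as a continuous
    map into the bounded linear functions.\<close>
  define B where "B x = Blinfun (frechet_derivative G (at x))" for x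
  have ap: "blinfun_apply (B x) = frechet_derivative G (at x)" if "x \<in> S" for x
    unfolding B_def
    using smooth_on_has_derivative[OF assms(3) that] has_derivative_bounded_linear bounded_linear_Blinfun_apply
    by blast
  have 1: "(G has_derivative blinfun_apply (B x)) (at x)" if "x \<in> S" for x
    using smooth_on_has_derivative[OF assms(3) that] ap[OF that] by simp
  have 2: "continuous_on S B"
  proof (rule continuous_on_blinfun_componentwise)
    fix i :: "real ^ 'd"
    have "continuous_on S (\<lambda>x. frechet_derivative G (at x) i)"
      by (intro smooth_on_imp_continuous_on smooth_on_frechet assms(3))
    then show "continuous_on S (\<lambda>x. blinfun_apply (B x) i)"
      using ap by (simp cong: continuous_on_cong)
  qed
  have lin: "linear (frechet_derivative G (at x0))"
    using assms(2,3) smooth_on_imp_differentiable linear_frechet_derivative by blast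
  obtain L where L: "linear L" "L \<circ> frechet_derivative G (at x0) = id"
    using linear_injective_left_inverse[OF lin assms(4)] by auto
  have "Blinfun L o\<^sub>L B x0 = id_blinfun"
    using L ap[OF assms(2)]
    by (intro blinfun_eqI) (simp add: bounded_linear_Blinfun_apply linear_linear pointfree_idE)
  from inverse_function_theorem[OF assms(1) 1 2 assms(2) this]
  obtain U V g g' where *: "open U" "U \<subseteq> S" "x0 \<in> U" "open V" "homeomorphism U V G g"
    "\<And>y. y \<in> V \<Longrightarrow> (g has_derivative (g' y)) (at y)"
    "\<And>y. y \<in> V \<Longrightarrow> g' y = inv (blinfun_apply (B (g y)))"
    "\<And>y. y \<in> V \<Longrightarrow> bij (blinfun_apply (B (g y)))"
    by metis
  have gS: "g ` V \<subseteq> S" using *(2,5) by (auto simp: homeomorphism_def)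
  have "smooth_on V g"
  proof (rule smooth_on_inverse_map[OF assms(1) *(4) assms(3) gS *(6)])
    fix y assume y: "y \<in> V"
    then have "blinfun_apply (B (g y)) = frechet_derivative G (at (g y))" using ap gS by blast
    then show "g' y = inv (frechet_derivative G (at (g y)))" "bij (frechet_derivative G (at (g y)))"
      using *(7,8)[OF y] by simp_all
  qed
  then show thesis using that * by blast
qed

section \<open>Antiderivatives and linear differential equations\<close>

lemma smooth_antiderivative:
  fixes \<tau> :: "real \<Rightarrow> real"
  assumes "smooth_on {a<..<b} \<tau>" "a < a'" "b' < b"
  obtains T where "smooth_on {a'<..<b'} T"
    "\<And>s. s \<in> {a'<..<b'} \<Longrightarrow> (T has_real_derivative \<tau> s) (at s)"
proof -
  \<comment> \<open>The interval is shrunk because the antiderivative is taken on a compact interval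
    inside the open one.\<close>
  have "continuous_on {a'..b'} \<tau>"
    by (rule continuous_on_subset[OF smooth_on_imp_continuous_on[OF assms(1)]]) (use assms in auto)
  then obtain T where T: "\<And>x. x \<in> {a'..b'} \<Longrightarrow> (T has_vector_derivative \<tau> x) (at x within {a'..b'})"
    using antiderivative_continuous by metis
  have D: "(T has_real_derivative \<tau> s) (at s)" if "s \<in> {a'<..<b'}" for s
  proof -
    have "(T has_vector_derivative \<tau> s) (at s within {a'<..<b'})"
      by (rule has_vector_derivative_within_subset[OF T]) (use that in auto)
    moreover have "at s within {a'<..<b'} = at s" by (rule at_within_open[OF that]) simp
    ultimately show ?thesis by (simp only: has_real_derivative_iff_has_vector_derivative)
  qed
  have "smooth_on {a'<..<b'} T"
  proof (rule smooth_onI_deriv)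
    show "(T has_derivative (\<lambda>v. v *\<^sub>R \<tau> s)) (at s)" if "s \<in> {a'<..<b'}" for s
      using D[OF that] by (simp add: has_field_derivative_def mult_commute_abs)
    show "smooth_on {a'<..<b'} (\<lambda>s. v *\<^sub>R \<tau> s)" for v
      by (rule smooth_on_linear[OF bounded_linear_scaleR_right smooth_on_subset[OF assms(1)]])
        (use assms in auto)
  qed simp
  with D show thesis using that by blast
qed

text \<open>Gronwall's argument: the energy \<open>E\<close>, the sum of the squares, satisfies E'
  \<le> c E on the unit interval, so E exp(-c t) does not increase. It starts at 0 and is
  nonnegative.\<close>

lemma linear_ode_zero:
  fixes u :: "'i::finite \<Rightarrow> real \<Rightarrow> real"
  assumes der: "\<And>i t. t \<in> {0..1} \<Longrightarrow> (u i has_real_derivative (\<Sum>j\<in>UNIV. K i j t * u j t)) (at t)"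
    and cont: "\<And>i j. continuous_on {0..1} (K i j)"
    and init: "\<And>i. u i 0 = 0" and t: "t \<in> {0..1}"
  shows "u i t = 0"
proof -
  have "\<exists>M. \<forall>s\<in>{0..1}. \<bar>K i j s\<bar> \<le> M" for i j
    using compact_imp_bounded[OF compact_continuous_image[OF cont compact_Icc]]
    by (auto simp: bounded_iff)
  then obtain M where M: "\<And>i j s. s \<in> {0..1} \<Longrightarrow> \<bar>K i j s\<bar> \<le> M i j" by metis
  define m where "m = (\<Sum>i\<in>UNIV. \<Sum>j\<in>UNIV. M i j)"
  have M0: "0 \<le> M i j" for i j using M[of 0 i j] by (smt (verit) atLeastAtMost_iff)
  have m: "\<bar>K i j s\<bar> \<le> m" if "s \<in> {0..1}" for i j s
  proof -
    have "M i j \<le> (\<Sum>j\<in>UNIV. M i j)" by (rule member_le_sum) (use M0 in auto)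
    also have "\<dots> \<le> m" unfolding m_def
      by (rule member_le_sum[where f = "\<lambda>i. \<Sum>j\<in>UNIV. M i j"]) (auto intro: sum_nonneg M0)
    finally show ?thesis using M[OF that, of i j] by linarith
  qed
  define E where "E s = (\<Sum>i\<in>UNIV. (u i s)\<^sup>2)" for s
  define E' where "E' s = (\<Sum>i\<in>UNIV. 2 * u i s * (\<Sum>j\<in>UNIV. K i j s * u j s))" for s
  \<comment> \<open>In the double sum of \<open>m * (u_i^2 + u_j^2)\<close> every square occurs
    \<open>CARD('i)\<close> times in the first place and as often in the second.\<close>
  define c where "c = 2 * real CARD('i) * m"
  have E0: "E s \<ge> 0" for s unfolding E_def by (intro sum_nonneg) auto
  have dE: "(E has_real_derivative E' s) (at s)" if "s \<in> {0..1}" for s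
    unfolding E_def E'_def
    by (rule DERIV_sum) (auto intro!: derivative_eq_intros der[OF that])
  have E'_le: "E' s \<le> c * E s" if s: "s \<in> {0..1}" for s
  proof -
    have "2 * u i s * (K i j s * u j s) \<le> m * ((u i s)\<^sup>2 + (u j s)\<^sup>2)" for i j
    proof -
      have "2 * u i s * (K i j s * u j s) \<le> \<bar>K i j s\<bar> * (2 * \<bar>u i s\<bar> * \<bar>u j s\<bar>)"
        by (metis (no_types, opaque_lifting) abs_ge_self abs_mult abs_numeral mult.assoc mult.left_commute)
      also have "\<dots> \<le> m * (2 * \<bar>u i s\<bar> * \<bar>u j s\<bar>)"
        by (rule mult_right_mono[OF m[OF s]]) auto
      also have "\<dots> \<le> m * ((u i s)\<^sup>2 + (u j s)\<^sup>2)"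
        using m[OF s, of i j] sum_squares_bound[of "\<bar>u i s\<bar>" "\<bar>u j s\<bar>"]
        by (intro mult_left_mono) auto
      finally show ?thesis .
    qed
    then have "E' s \<le> (\<Sum>i\<in>UNIV. \<Sum>j\<in>UNIV. m * ((u i s)\<^sup>2 + (u j s)\<^sup>2))"
      unfolding E'_def sum_distrib_left by (intro sum_mono)
    also have "\<dots> = c * E s"
      unfolding E_def c_def
      by (simp add: distrib_left sum.distrib sum_distrib_left[symmetric] algebra_simps)
    finally show ?thesis .
  qed
  have "E t * exp (- c * t) \<le> E 0 * exp (- c * 0)"
  proof (rule DERIV_nonpos_imp_nonincreasing[where f = "\<lambda>s. E s * exp (- c * s)"])
    fix s assume s: "0 \<le> s" "s \<le> t"
    then have s': "s \<in> {0..1}" using t by auto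
    have "((\<lambda>s. E s * exp (- c * s)) has_real_derivative (E' s - c * E s) * exp (- c * s)) (at s)"
      by (auto intro!: derivative_eq_intros dE[OF s'] simp: algebra_simps)
    moreover have "(E' s - c * E s) * exp (- c * s) \<le> 0"
      using E'_le[OF s'] by (simp add: mult_nonpos_nonneg)
    ultimately show "\<exists>y. ((\<lambda>s. E s * exp (- c * s)) has_real_derivative y) (at s) \<and> y \<le> 0" by blast
  qed (use t in auto)
  then have "E t * exp (- c * t) \<le> 0" by (simp add: E_def init)
  then have "E t = 0" using E0[of t] by (simp add: mult_le_0_iff)
  then show ?thesis unfolding E_def by (simp add: sum_nonneg_eq_0_iff)
qed

text \<open>Smoothness of a derivative is defined for constant directions; a direction
  \<open>u x\<close> depending on the point is reduced to these by its basis expansion. Components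
  of vector fields make this necessary.\<close>

lemma smooth_on_frechet_apply:
  fixes g :: "'a::euclidean_space \<Rightarrow> 'b::real_normed_vector"
  assumes "smooth_on S g" "smooth_on S u" "open S"
  shows "smooth_on S (\<lambda>x. frechet_derivative g (at x) (u x))"
proof -
  have "smooth_on S (\<lambda>x. \<Sum>b\<in>Basis. (u x \<bullet> b) *\<^sub>R frechet_derivative g (at x) b)"
    by (intro smooth_on_sum smooth_on_scaleR smooth_on_frechet
        smooth_on_linear[OF bounded_linear_inner_left] assms)
  moreover have "(\<Sum>b\<in>Basis. (u x \<bullet> b) *\<^sub>R frechet_derivative g (at x) b) = frechet_derivative g (at x) (u x)"
    if "x \<in> S" for x
  proof -
    have "linear (frechet_derivative g (at x))"
      using assms(1) that smooth_on_imp_differentiable linear_frechet_derivative by blast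
    then have "(\<Sum>b\<in>Basis. (u x \<bullet> b) *\<^sub>R frechet_derivative g (at x) b)
        = frechet_derivative g (at x) (\<Sum>b\<in>Basis. (u x \<bullet> b) *\<^sub>R b)"
      by (simp add: linear_sum linear_scale)
    then show ?thesis by (simp add: euclidean_representation)
  qed
  ultimately show ?thesis by (rule smooth_on_cong[OF _ assms(3)])
qed

subsection \<open>Charts and tangent vectors\<close>

lemma is_chart_inv:
  assumes "is_chart c"
  shows "p \<in> fst c \<Longrightarrow> inv_chart c (snd c p) = p"
    and "x \<in> snd c ` fst c \<Longrightarrow> snd c (inv_chart c x) = x"
    and "x \<in> snd c ` fst c \<Longrightarrow> inv_chart c x \<in> fst c"
  using assms by (auto simp: is_chart_def homeomorphism_def)

lemma is_chart_open_image:
  assumes "is_chart c" "open U"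
  shows "open (snd c ` (fst c \<inter> U))"
proof -
  have "snd c ` (fst c \<inter> U) = snd c ` fst c \<inter> inv_chart c -` U"
    using is_chart_inv[OF assms(1)] by force
  moreover have "continuous_on (snd c ` fst c) (inv_chart c)" "open (snd c ` fst c)"
    using assms(1) by (auto simp: is_chart_def homeomorphism_def)
  ultimately show ?thesis using assms(2) continuous_on_open_vimage
    by (metis Int_commute)
qed

lemma is_chart_open_inv_image:
  assumes "is_chart c" "open X" "X \<subseteq> snd c ` fst c"
  shows "open (inv_chart c ` X)"
proof -
  have "inv_chart c ` X = fst c \<inter> snd c -` X"
    using is_chart_inv[OF assms(1)] assms(3) by force
  moreover have "continuous_on (fst c) (snd c)" "open (fst c)"
    using assms(1) by (auto simp: is_chart_def homeomorphism_def)
  ultimately show ?thesis using assms(2) continuous_on_open_vimage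
    by (metis Int_commute)
qed

lemma transition_apply: "transition c c' x = snd c' (inv_chart c x)"
  by (simp add: transition_def)

text \<open>For a chart \<open>c\<close> of \<open>A\<close> around \<open>p\<close> this is the
  tangent vector whose component in \<open>c\<close> is \<open>u\<close>, that is, the inverse of
  reading off the \<open>c\<close>-component. With \<open>u\<close> constant it is a
  constant-coefficient field of the chart.\<close>

definition tvec_at ::
  "('m, 'd::finite) chart set \<Rightarrow> ('m, 'd) chart \<Rightarrow> 'm \<Rightarrow> real ^ 'd \<Rightarrow> ('m, 'd) tvec" where
  "tvec_at A c p u = (\<lambda>c'. if c' \<in> charts_at A p
     then frechet_derivative (transition c c') (at (snd c p)) u else 0)"

lemma coord_field_eq_tvec_at: "coord_field A c i p = tvec_at A c p (axis i 1)"
  by (simp add: coord_field_def tvec_at_def)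

locale smooth_manifold =
  fixes A :: "('m::{t2_space, second_countable_topology}, 'd::finite) chart set"
  assumes smooth_structure: "smooth_structure A"
begin

lemma is_chart: "c \<in> A \<Longrightarrow> is_chart c"
  using smooth_structure by (simp add: smooth_structure_def)

lemmas inv_chart_left = is_chart_inv(1)[OF is_chart]
  and inv_chart_right = is_chart_inv(2)[OF is_chart]
  and inv_chart_dom = is_chart_inv(3)[OF is_chart]
  and open_chart_image = is_chart_open_image[OF is_chart]

lemma open_dom: "c \<in> A \<Longrightarrow> open (fst c)"
  using is_chart by (simp add: is_chart_def)

lemma open_image: "c \<in> A \<Longrightarrow> open (snd c ` fst c)"
  using is_chart by (simp add: is_chart_def)

lemma chart_exists: obtains c where "c \<in> A" "p \<in> fst c"
  using smooth_structure unfolding smooth_structure_def by blast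

lemma smooth_transition:
  "c \<in> A \<Longrightarrow> c' \<in> A \<Longrightarrow> smooth_on (snd c ` (fst c \<inter> fst c')) (transition c c')"
  using smooth_structure by (simp add: smooth_structure_def compatible_charts_def)

lemma transition_has_derivative:
  assumes "c \<in> A" "c' \<in> A" "p \<in> fst c" "p \<in> fst c'"
  shows "(transition c c' has_derivative frechet_derivative (transition c c') (at (snd c p))) (at (snd c p))"
  using smooth_on_has_derivative[OF smooth_transition[OF assms(1,2)]] assms(3,4) by blast

lemma linear_transition:
  assumes "c \<in> A" "c' \<in> A" "p \<in> fst c" "p \<in> fst c'"
  shows "linear (frechet_derivative (transition c c') (at (snd c p)))"
  using has_derivative_linear[OF transition_has_derivative[OF assms]] .

text \<open>Chain rule through the transition map. It is behind both the cocycle identity for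
  transitions and the independence of \<open>tderiv\<close> of the chosen chart.\<close>

lemma chart_change_has_derivative:
  assumes "c \<in> A" "c' \<in> A" "p \<in> fst c" "p \<in> fst c'"
    and g: "(g \<circ> inv_chart c' has_derivative g') (at (snd c' p))"
  shows "(g \<circ> inv_chart c has_derivative
    g' \<circ> frechet_derivative (transition c c') (at (snd c p))) (at (snd c p))"
proof -
  have tp: "transition c c' (snd c p) = snd c' p"
    using assms by (simp add: transition_apply inv_chart_left)
  have "((g \<circ> inv_chart c') \<circ> transition c c' has_derivative
      g' \<circ> frechet_derivative (transition c c') (at (snd c p))) (at (snd c p))"
    by (rule diff_chain_at[OF transition_has_derivative[OF assms(1-4)]]) (use g tp in simp)
  then show ?thesis
  proof (rule has_derivative_transform_within_open)
    show "open (snd c ` (fst c \<inter> fst c'))" by (intro open_chart_image open_dom assms)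
    show "snd c p \<in> snd c ` (fst c \<inter> fst c')" using assms by blast
    fix x assume "x \<in> snd c ` (fst c \<inter> fst c')"
    then show "((g \<circ> inv_chart c') \<circ> transition c c') x = (g \<circ> inv_chart c) x"
      using assms by (auto simp: transition_apply inv_chart_left)
  qed
qed

lemma frechet_transition_self:
  assumes "c \<in> A" "p \<in> fst c"
  shows "frechet_derivative (transition c c) (at (snd c p)) u = u"
proof -
  have "(transition c c has_derivative (\<lambda>u. u)) (at (snd c p))"
    by (rule has_derivative_transform_within_open[OF has_derivative_ident open_image[OF assms(1)]])
      (use assms in \<open>auto simp: transition_apply inv_chart_left\<close>)
  then show ?thesis using frechet_derivative_at by metis
qed

text \<open>The cocycle identity, from the chain rule applied to the coordinate map of
  \<open>c''\<close>. It makes the components prescribed by \<open>tvec_at\<close> obey the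
  transformation law.\<close>

lemma frechet_transition_trans:
  assumes "c \<in> A" "c' \<in> A" "c'' \<in> A" "p \<in> fst c" "p \<in> fst c'" "p \<in> fst c''"
  shows "frechet_derivative (transition c c'') (at (snd c p)) u =
    frechet_derivative (transition c' c'') (at (snd c' p)) (frechet_derivative (transition c c') (at (snd c p)) u)"
proof -
  have "(snd c'' \<circ> inv_chart c has_derivative
      frechet_derivative (transition c' c'') (at (snd c' p)) \<circ>
      frechet_derivative (transition c c') (at (snd c p))) (at (snd c p))"
    by (rule chart_change_has_derivative[OF assms(1,2,4,5)])
      (use transition_has_derivative[OF assms(2,3,5,6)] in \<open>simp add: transition_def\<close>)
  then have "frechet_derivative (transition c' c'') (at (snd c' p)) \<circ>
      frechet_derivative (transition c c') (at (snd c p)) = frechet_derivative (transition c c'') (at (snd c p))"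
    unfolding transition_def[of c c''] by (rule frechet_derivative_at)
  then show ?thesis by (metis comp_apply)
qed

lemma tvec_at_self: "c \<in> A \<Longrightarrow> p \<in> fst c \<Longrightarrow> tvec_at A c p u c = u"
  by (simp add: tvec_at_def charts_at_def frechet_transition_self)

lemma tvec_at_tangent: "c \<in> A \<Longrightarrow> p \<in> fst c \<Longrightarrow> tvec_at A c p u \<in> tangent_space A p"
  unfolding tangent_space_def
proof (intro CollectI conjI ballI allI impI)
  fix c1 c2 assume "c1 \<in> charts_at A p" "c2 \<in> charts_at A p" and c: "c \<in> A" "p \<in> fst c"
  then show "tvec_at A c p u c2 = frechet_derivative (transition c1 c2) (at (snd c1 p)) (tvec_at A c p u c1)"
    using frechet_transition_trans[OF c(1) _ _ c(2), of c1 c2 u] by (simp add: tvec_at_def charts_at_def)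
qed (simp add: tvec_at_def)

lemma tangent_transform:
  assumes "v \<in> tangent_space A p" "c \<in> A" "c' \<in> A" "p \<in> fst c" "p \<in> fst c'"
  shows "v c' = frechet_derivative (transition c c') (at (snd c p)) (v c)"
proof -
  have "c \<in> charts_at A p" "c' \<in> charts_at A p" using assms by (simp_all add: charts_at_def)
  then show ?thesis using assms(1) unfolding tangent_space_def by blast
qed

lemma tvec_at_component:
  "c \<in> A \<Longrightarrow> p \<in> fst c \<Longrightarrow> v \<in> tangent_space A p \<Longrightarrow> tvec_at A c p (v c) = v"
proof (rule ext)
  fix c' assume *: "c \<in> A" "p \<in> fst c" "v \<in> tangent_space A p"
  show "tvec_at A c p (v c) c' = v c'"
  proof (cases "c' \<in> charts_at A p")
    case True
    then show ?thesis
      using tangent_transform[OF *(3,1) _ *(2), of c'] by (simp add: tvec_at_def charts_at_def)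
  next
    case False
    then have "v c' = 0" using *(3) unfolding tangent_space_def by blast
    then show ?thesis using False by (simp add: tvec_at_def)
  qed
qed

lemma tangent_eqI:
  "c \<in> A \<Longrightarrow> p \<in> fst c \<Longrightarrow> v \<in> tangent_space A p \<Longrightarrow> w \<in> tangent_space A p \<Longrightarrow> v c = w c \<Longrightarrow> v = w"
  using tvec_at_component by metis

lemma tzero_tangent: "tzero \<in> tangent_space A p"
proof -
  obtain c where c: "c \<in> A" "p \<in> fst c" by (rule chart_exists)
  have "tvec_at A c p 0 = tzero"
    using linear_0[OF linear_transition[OF c(1) _ c(2)]]
    by (auto simp: tvec_at_def tzero_def charts_at_def)
  then show ?thesis using tvec_at_tangent[OF c, of 0] by simp
qed

lemma tcomb_tangent:
  assumes "v \<in> tangent_space A p" "w \<in> tangent_space A p"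
  shows "tcomb a v b w \<in> tangent_space A p"
proof -
  obtain c where c: "c \<in> A" "p \<in> fst c" by (rule chart_exists)
  have "tvec_at A c p (a *\<^sub>R v c + b *\<^sub>R w c) c' = a *\<^sub>R tvec_at A c p (v c) c' + b *\<^sub>R tvec_at A c p (w c) c'" for c'
    using linear_transition[OF c(1) _ c(2)]
    by (auto simp: tvec_at_def charts_at_def linear_add linear_scale)
  then have "tvec_at A c p (a *\<^sub>R v c + b *\<^sub>R w c) = tcomb a v b w"
    using assms c by (simp add: tvec_at_component tcomb_def fun_eq_iff)
  then show ?thesis using tvec_at_tangent[OF c] by metis
qed

section \<open>Smooth maps, their differentials and vector fields in a chart\<close>

lemma smooth_map_onD: "smooth_map_on A U g \<Longrightarrow> c \<in> A \<Longrightarrow> smooth_on (snd c ` (fst c \<inter> U)) (g \<circ> inv_chart c)"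
  by (simp add: smooth_map_on_def)

lemma smooth_map_on_subset: "smooth_map_on A U g \<Longrightarrow> V \<subseteq> U \<Longrightarrow> smooth_map_on A V g"
  unfolding smooth_map_on_def by (meson Int_mono image_mono order_refl smooth_on_subset)

lemma smooth_map_on_has_derivative:
  assumes "smooth_map_on A U g" "p \<in> U" "c \<in> A" "p \<in> fst c"
  shows "(g \<circ> inv_chart c has_derivative frechet_derivative (g \<circ> inv_chart c) (at (snd c p))) (at (snd c p))"
  using smooth_on_has_derivative[OF smooth_map_onD[OF assms(1,3)]] assms by blast

text \<open>On a region covered by a single chart all other charts follow by composing with smooth
  transitions.\<close>

lemma smooth_map_onI_chart:
  assumes "c \<in> A" "U \<subseteq> fst c" "open U" "smooth_on (snd c ` U) (g \<circ> inv_chart c)"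
  shows "smooth_map_on A U g"
  unfolding smooth_map_on_def
proof
  fix c' assume c': "c' \<in> A"
  have o: "open (snd c' ` (fst c' \<inter> U))" by (intro open_chart_image c' assms)
  have "smooth_on (snd c' ` (fst c' \<inter> U)) (\<lambda>x. (g \<circ> inv_chart c) (transition c' c x))"
    by (rule smooth_on_compose[OF assms(4) smooth_on_subset[OF smooth_transition[OF c' assms(1)]] _ o])
      (use assms(2) c' in \<open>auto simp: transition_apply inv_chart_left\<close>)
  then show "smooth_on (snd c' ` (fst c' \<inter> U)) (g \<circ> inv_chart c')"
    by (rule smooth_on_cong[OF _ o]) (use assms(1,2) c' in \<open>auto simp: transition_apply inv_chart_left\<close>)
qed

text \<open>The arbitrary chart chosen inside \<open>tderiv\<close> is eliminated: the chain rule
  factor of \<open>g\<close> and the transformation law of \<open>v\<close> cancel.\<close>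

lemma tderiv_chart:
  assumes "c \<in> A" "p \<in> fst c" "v \<in> tangent_space A p"
    and "(g \<circ> inv_chart c has_derivative g') (at (snd c p))"
  shows "tderiv A g p v = g' (v c)"
proof -
  define c0 where "c0 = (SOME c. c \<in> charts_at A p)"
  have "c \<in> charts_at A p" using assms by (simp add: charts_at_def)
  then have "c0 \<in> charts_at A p" unfolding c0_def by (rule someI)
  then have c0: "c0 \<in> A" "p \<in> fst c0" by (auto simp: charts_at_def)
  have "(g \<circ> inv_chart c0 has_derivative
      g' \<circ> frechet_derivative (transition c0 c) (at (snd c0 p))) (at (snd c0 p))"
    by (rule chart_change_has_derivative[OF c0(1) assms(1) c0(2) assms(2,4)])
  then have "tderiv A g p v = g' (frechet_derivative (transition c0 c) (at (snd c0 p)) (v c0))"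
    unfolding tderiv_def c0_def[symmetric] Let_def using frechet_derivative_at by (metis comp_apply)
  also have "frechet_derivative (transition c0 c) (at (snd c0 p)) (v c0) = v c"
    using tangent_transform[OF assms(3) c0(1) assms(1) c0(2) assms(2)] by simp
  finally show ?thesis .
qed

lemma tderiv_eq_frechet:
  assumes "smooth_map_on A U g" "p \<in> U" "c \<in> A" "p \<in> fst c" "v \<in> tangent_space A p"
  shows "tderiv A g p v = frechet_derivative (g \<circ> inv_chart c) (at (snd c p)) (v c)"
  by (rule tderiv_chart[OF assms(3,4,5) smooth_map_on_has_derivative[OF assms(1-4)]])

lemma tderiv_tvec_at:
  assumes "smooth_map_on A U g" "p \<in> U" "c \<in> A" "p \<in> fst c"
  shows "tderiv A g p (tvec_at A c p u) = frechet_derivative (g \<circ> inv_chart c) (at (snd c p)) u"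
  using tderiv_eq_frechet[OF assms tvec_at_tangent[OF assms(3,4)]] tvec_at_self[OF assms(3,4)] by simp

lemma tderiv_tcomb:
  assumes "smooth_map_on A U g" "p \<in> U" "v \<in> tangent_space A p" "w \<in> tangent_space A p"
  shows "tderiv A g p (tcomb a v b w) = a *\<^sub>R tderiv A g p v + b *\<^sub>R tderiv A g p w"
proof -
  obtain c where c: "c \<in> A" "p \<in> fst c" by (rule chart_exists)
  have "linear (frechet_derivative (g \<circ> inv_chart c) (at (snd c p)))"
    using has_derivative_linear[OF smooth_map_on_has_derivative[OF assms(1,2) c]] .
  then show ?thesis
    using tderiv_eq_frechet[OF assms(1,2) c] assms(3,4) tcomb_tangent[OF assms(3,4)]
    by (simp add: tcomb_def linear_add linear_scale)
qed

lemma smooth_vfield_onD: 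
  "smooth_vfield_on A U X \<Longrightarrow> c \<in> A \<Longrightarrow> smooth_on (snd c ` (fst c \<inter> U)) (\<lambda>x. X (inv_chart c x) c)"
  "smooth_vfield_on A U X \<Longrightarrow> p \<in> U \<Longrightarrow> X p \<in> tangent_space A p"
  by (auto simp: smooth_vfield_on_def)

text \<open>In another chart the components are the derivative of the transition, applied to the
  components in \<open>c\<close>. Both depend on the point, which is the situation of
  \<open>smooth_on_frechet_apply\<close>.\<close>

lemma smooth_vfield_onI_chart:
  assumes "c \<in> A" "U \<subseteq> fst c" "open U" "\<And>p. p \<in> U \<Longrightarrow> X p \<in> tangent_space A p"
    and "smooth_on (snd c ` U) (\<lambda>x. X (inv_chart c x) c)"
  shows "smooth_vfield_on A U X"
  unfolding smooth_vfield_on_def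
proof (intro conjI ballI assms(4))
  fix c' assume c': "c' \<in> A"
  define S where "S = snd c' ` (fst c' \<inter> U)"
  have o: "open S" unfolding S_def by (intro open_chart_image c' assms)
  have tr: "smooth_on S (transition c' c)"
    unfolding S_def by (rule smooth_on_subset[OF smooth_transition[OF c' assms(1)]]) (use assms(2) in auto)
  have "snd c ` (fst c \<inter> U) = snd c ` U" using assms(2) by (simp add: Int_absorb1)
  then have oU: "open (snd c ` U)" using open_chart_image[OF assms(1,3)] by simp
  have "smooth_on (snd c ` (fst c \<inter> fst c' \<inter> U)) (\<lambda>y. frechet_derivative (transition c c') (at y) (X (inv_chart c y) c))"
    (is "smooth_on ?T ?F")
  proof (rule smooth_on_frechet_apply)
    show "smooth_on ?T (transition c c')"
      by (rule smooth_on_subset[OF smooth_transition[OF assms(1) c']]) auto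
    show "smooth_on ?T (\<lambda>y. X (inv_chart c y) c)"
      by (rule smooth_on_subset[OF assms(5)]) auto
    show "open ?T" using open_chart_image[OF assms(1), of "fst c' \<inter> U"] open_dom[OF c'] assms(3)
      by (simp add: Int_assoc open_Int)
  qed
  from smooth_on_compose[OF this tr _ o]
  have "smooth_on S (\<lambda>x. ?F (transition c' c x))"
    using assms(2) c' unfolding S_def by (force simp: transition_apply inv_chart_left)
  then show "smooth_on (snd c' ` (fst c' \<inter> U)) (\<lambda>x. X (inv_chart c' x) c')"
    unfolding S_def[symmetric]
  proof (rule smooth_on_cong[OF _ o])
    fix x assume "x \<in> S"
    then obtain q where q: "q \<in> fst c'" "q \<in> U" "x = snd c' q" unfolding S_def by blast
    then have qc: "q \<in> fst c" using assms(2) by blast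
    show "?F (transition c' c x) = X (inv_chart c' x) c'"
      using tangent_transform[OF assms(4)[OF q(2)] assms(1) c' qc q(1)]
      by (simp add: transition_apply q(3) inv_chart_left[OF c' q(1)] inv_chart_left[OF assms(1) qc])
  qed
qed

lemma smooth_tvec_at:
  assumes "c \<in> A" "U \<subseteq> fst c" "open U"
  shows "smooth_vfield_on A U (\<lambda>p. tvec_at A c p u)"
proof (rule smooth_vfield_onI_chart[OF assms])
  show "tvec_at A c p u \<in> tangent_space A p" if "p \<in> U" for p
    using tvec_at_tangent assms that by blast
  have o: "open (snd c ` U)" using open_chart_image[OF assms(1,3)] assms(2) by (simp add: Int_absorb1)
  show "smooth_on (snd c ` U) (\<lambda>x. tvec_at A c (inv_chart c x) u c)"
    by (rule smooth_on_cong[OF smooth_on_const[OF o, of u] o])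
      (use assms in \<open>auto simp: tvec_at_self inv_chart_left subset_iff\<close>)
qed

lemma smooth_vfield_tcomb:
  assumes "smooth_vfield_on A U X" "smooth_vfield_on A U Y" "open U"
  shows "smooth_vfield_on A U (\<lambda>p. tcomb a (X p) b (Y p))"
  unfolding smooth_vfield_on_def
proof (intro conjI ballI)
  fix c assume c: "c \<in> A"
  show "smooth_on (snd c ` (fst c \<inter> U)) (\<lambda>x. tcomb a (X (inv_chart c x)) b (Y (inv_chart c x)) c)"
    unfolding tcomb_def
    by (intro smooth_on_add smooth_on_linear[OF bounded_linear_scaleR_right] smooth_vfield_onD
        assms c open_chart_image)
qed (use assms tcomb_tangent smooth_vfield_onD in blast)

lemma smooth_map_tderiv:
  assumes "smooth_map_on A U g" "smooth_vfield_on A U X" "open U"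
  shows "smooth_map_on A U (\<lambda>q. tderiv A g q (X q))"
  unfolding smooth_map_on_def
proof
  fix c assume c: "c \<in> A"
  have o: "open (snd c ` (fst c \<inter> U))" by (intro open_chart_image c assms)
  have "smooth_on (snd c ` (fst c \<inter> U))
      (\<lambda>x. frechet_derivative (g \<circ> inv_chart c) (at x) (X (inv_chart c x) c))"
    by (intro smooth_on_frechet_apply smooth_map_onD smooth_vfield_onD assms c o)
  then show "smooth_on (snd c ` (fst c \<inter> U)) ((\<lambda>q. tderiv A g q (X q)) \<circ> inv_chart c)"
  proof (rule smooth_on_cong[OF _ o])
    fix x assume "x \<in> snd c ` (fst c \<inter> U)"
    then obtain q where q: "q \<in> fst c" "q \<in> U" "x = snd c q" by blast
    show "frechet_derivative (g \<circ> inv_chart c) (at x) (X (inv_chart c x) c) =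
        ((\<lambda>q. tderiv A g q (X q)) \<circ> inv_chart c) x"
      using tderiv_eq_frechet[OF assms(1) q(2) c q(1) smooth_vfield_onD(2)[OF assms(2) q(2)]]
      by (simp add: q(3) inv_chart_left[OF c q(1)])
  qed
qed

text \<open>A smooth map into the model space with injective differential at \<open>p\<close> is a
  local diffeomorphism there, so a restriction of it is a chart compatible with the atlas. The image
  is cut down to a ball because later arguments move along rays from its centre and along segments
  inside it.\<close>

lemma new_chart:
  assumes "c \<in> A" "p \<in> fst c" "open U" "p \<in> U" "smooth_map_on A U \<Phi>"
    and "inj (frechet_derivative (\<Phi> \<circ> inv_chart c) (at (snd c p)))"
  obtains W r where "(W, \<Phi>) \<in> A" "p \<in> W" "W \<subseteq> U" "r > 0" "\<Phi> ` W = ball (\<Phi> p) r"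
proof -
  define S where "S = snd c ` (fst c \<inter> U)"
  define G where "G = \<Phi> \<circ> inv_chart c"
  have oS: "open S" unfolding S_def by (intro open_chart_image assms)
  have xS: "snd c p \<in> S" unfolding S_def using assms by blast
  have GS: "smooth_on S G" unfolding S_def G_def by (intro smooth_map_onD assms)
  obtain U' V g where U': "open U'" "U' \<subseteq> S" "snd c p \<in> U'" and V: "open V"
    and hom: "homeomorphism U' V G g" and g: "smooth_on V g"
    using smooth_inverse_function[OF oS xS GS assms(6)[folded G_def]] .
  have Gp: "G (snd c p) = \<Phi> p" using assms by (simp add: G_def inv_chart_left)
  have "\<Phi> p \<in> V" using hom U'(3) Gp by (metis homeomorphism_def image_eqI)
  then obtain r where r: "r > 0" "ball (\<Phi> p) r \<subseteq> V" using V open_contains_ball by blast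
  define B where "B = ball (\<Phi> p) r"
  have BV: "B \<subseteq> V" using r B_def by simp
  have gB: "g ` B = U' \<inter> G -` B"
    using hom BV by (force simp: homeomorphism_def)
  have "continuous_on U' G" using hom by (simp add: homeomorphism_def)
  then have ogB: "open (g ` B)"
    unfolding gB using U'(1) continuous_on_open_vimage[OF U'(1)] B_def
    by (metis Int_commute open_ball)
  have gBS: "g ` B \<subseteq> S" using gB U' by blast
  define W where "W = inv_chart c ` g ` B"
  have oW: "open W" unfolding W_def
    by (rule is_chart_open_inv_image[OF is_chart[OF assms(1)] ogB]) (use gBS S_def in auto)
  have WU: "W \<subseteq> U" "W \<subseteq> fst c" unfolding W_def using gBS assms(1) by (auto simp: S_def inv_chart_left)
  have Gg: "\<Phi> (inv_chart c (g y)) = y" if "y \<in> B" for y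
    using hom that BV by (auto simp: homeomorphism_def G_def)
  have img: "\<Phi> ` W = B" unfolding W_def using Gg by (auto simp: image_iff)
  have pW: "p \<in> W"
  proof -
    have "g (\<Phi> p) = snd c p" using hom U'(3) Gp by (metis homeomorphism_def)
    then have "p = inv_chart c (g (\<Phi> p))" using assms by (simp add: inv_chart_left)
    then show ?thesis unfolding W_def B_def using r by (metis centre_in_ball image_eqI)
  qed
  have inj: "inj_on \<Phi> W" unfolding W_def using Gg by (auto simp: inj_on_def)
  have inv: "inv_chart (W, \<Phi>) y = inv_chart c (g y)" if "y \<in> B" for y
  proof -
    have "inv_chart (W, \<Phi>) (\<Phi> (inv_chart c (g y))) = inv_chart c (g y)"
      unfolding inv_chart_def[of "(W, \<Phi>)"] using inj that by (simp add: inv_into_f_f W_def)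
    then show ?thesis using Gg[OF that] by simp
  qed
  have cPhi: "continuous_on W \<Phi>"
  proof -
    have "continuous_on W (snd c)" using is_chart[OF assms(1)] WU(2)
      by (auto simp: is_chart_def homeomorphism_def intro: continuous_on_subset)
    moreover have "continuous_on (snd c ` W) G"
      by (rule continuous_on_subset[OF smooth_on_imp_continuous_on[OF GS]])
        (use WU S_def in auto)
    ultimately have "continuous_on W (G \<circ> snd c)" by (rule continuous_on_compose)
    then show ?thesis
      by (rule continuous_on_eq) (use WU(2) assms(1) in \<open>auto simp: G_def inv_chart_left\<close>)
  qed
  have chart: "is_chart (W, \<Phi>)"
    unfolding is_chart_def fst_conv snd_conv img
  proof (intro conjI)
    show "homeomorphism W B \<Phi> (inv_chart (W, \<Phi>))"
    proof (rule homeomorphismI)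
      have "continuous_on B g"
        using smooth_on_imp_continuous_on[OF g] BV continuous_on_subset by blast
      moreover have "continuous_on (g ` B) (inv_chart c)"
      proof (rule continuous_on_subset)
        show "continuous_on (snd c ` fst c) (inv_chart c)"
          using is_chart[OF assms(1)] by (auto simp: is_chart_def homeomorphism_def)
        show "g ` B \<subseteq> snd c ` fst c" using gBS S_def by auto
      qed
      ultimately have "continuous_on B (inv_chart c \<circ> g)" by (rule continuous_on_compose)
      then show "continuous_on B (inv_chart (W, \<Phi>))"
        by (rule continuous_on_eq) (simp add: inv)
    qed (use cPhi img inv Gg W_def in auto)
  qed (use oW B_def in auto)
  have "compatible_charts (W, \<Phi>) c'" if c': "c' \<in> A" for c'
    unfolding compatible_charts_def fst_conv snd_conv
  proof
    have o: "open (\<Phi> ` (W \<inter> fst c'))"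
      using is_chart_open_image[OF chart open_dom[OF c']] by simp
    have sub: "\<Phi> ` (W \<inter> fst c') \<subseteq> B" using img by blast
    have "smooth_on (\<Phi> ` (W \<inter> fst c')) (\<lambda>y. transition c c' (g y))"
    proof (rule smooth_on_compose[OF smooth_transition[OF assms(1) c'] smooth_on_subset[OF g] _ o])
      show "\<Phi> ` (W \<inter> fst c') \<subseteq> V" using sub BV by blast
      show "g ` \<Phi> ` (W \<inter> fst c') \<subseteq> snd c ` (fst c \<inter> fst c')"
      proof clarify
        fix q assume q: "q \<in> W" "q \<in> fst c'"
        then obtain y where y: "y \<in> B" "q = inv_chart c (g y)" unfolding W_def by blast
        then have "g (\<Phi> q) = g y" using Gg by simp
        also have "\<dots> = snd c q" using y gBS assms(1) inv_chart_right[OF assms(1)] S_def by force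
        finally show "g (\<Phi> q) \<in> snd c ` (fst c \<inter> fst c')" using q WU by auto
      qed
    qed
    then show "smooth_on (\<Phi> ` (W \<inter> fst c')) (transition (W, \<Phi>) c')"
      by (rule smooth_on_cong[OF _ o]) (use sub inv in \<open>auto simp: transition_apply\<close>)
    show "smooth_on (snd c' ` (W \<inter> fst c')) (transition c' (W, \<Phi>))"
      unfolding transition_def snd_conv
      by (rule smooth_on_subset[OF smooth_map_onD[OF assms(5) c']]) (use WU in auto)
  qed
  \<comment> \<open>This is where maximality of the atlas enters.\<close>
  then have "(W, \<Phi>) \<in> A"
    using smooth_structure chart unfolding smooth_structure_def by blast
  then show thesis using that pW WU(1) r(1) img B_def by blast
qed

end

subsection \<open>Hypersurfaces of the para-complex space\<close>

lemma paraJ_invol [simp]: "paraJ (paraJ z) = z"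
  by (simp add: paraJ_def)

lemma linear_paraJ: "linear paraJ"
  by (rule linearI) (auto simp: paraJ_def)

lemma bounded_linear_paraJ: "bounded_linear paraJ"
  by (rule linear_linear[THEN iffD2, OF linear_paraJ])

lemmas paraJ_simps = linear_add[OF linear_paraJ] linear_diff[OF linear_paraJ]
  linear_scale[OF linear_paraJ] linear_neg[OF linear_paraJ] linear_0[OF linear_paraJ]

lemma paraJ_inner: "paraJ y \<bullet> z = y \<bullet> paraJ z"
  by (cases y; cases z) (simp add: paraJ_def inner_commute add.commute)

text \<open>J is self-adjoint for the Euclidean inner product, so its two eigenspaces are
  orthogonal.\<close>

lemma inner_eig_opposite:
  assumes "paraJ y = \<sigma> *\<^sub>R y" "paraJ z = - \<sigma> *\<^sub>R z" "\<sigma> * \<sigma> = 1"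
  shows "y \<bullet> z = 0"
proof -
  have "\<sigma> * (y \<bullet> z) = - \<sigma> * (y \<bullet> z)" using paraJ_inner[of y z] assms by simp
  then show ?thesis using assms(3) by auto
qed

text \<open>Used to differentiate a linear identity with constant coefficients, such as the
  eigenvector equation of a section of \<open>eigdist\<close>.\<close>

lemma (in smooth_manifold) tderiv_linear_eq_0:
  assumes "open V" "p \<in> V" "smooth_map_on A V g" "bounded_linear L" "\<And>q. q \<in> V \<Longrightarrow> L (g q) = 0"
    and v: "v \<in> tangent_space A p"
  shows "L (tderiv A g p v) = 0"
proof -
  obtain c where c: "c \<in> A" "p \<in> fst c" by (rule chart_exists)
  let ?g' = "frechet_derivative (g \<circ> inv_chart c) (at (snd c p))"
  have "((\<lambda>x. L ((g \<circ> inv_chart c) x)) has_derivative (\<lambda>u. L (?g' u))) (at (snd c p))"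
    by (rule bounded_linear.has_derivative[OF assms(4) smooth_map_on_has_derivative[OF assms(3,2) c]])
  moreover have "((\<lambda>x. L ((g \<circ> inv_chart c) x)) has_derivative (\<lambda>u. 0)) (at (snd c p))"
    by (rule has_derivative_transform_within_open[OF has_derivative_const open_chart_image[OF c(1) assms(1)]])
      (use assms c in \<open>auto simp: inv_chart_left\<close>)
  ultimately have "L (?g' (v c)) = 0" using has_derivative_unique by metis
  then show ?thesis using tderiv_eq_frechet[OF assms(3,2) c v] by simp
qed

lemma (in smooth_manifold) tvec_at_linear_comb:
  assumes "c \<in> A" "p \<in> fst c"
  shows "tvec_at A c p (a *\<^sub>R u + b *\<^sub>R w) = tcomb a (tvec_at A c p u) b (tvec_at A c p w)"
  by (rule tangent_eqI[OF assms])
    (simp_all add: tvec_at_tangent tcomb_tangent tvec_at_self assms, simp add: tcomb_def tvec_at_self assms)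

locale para_hypersurface =
  fixes n :: nat
    and A :: "('m::{t2_space, second_countable_topology}, 'd::finite) chart set"
    and f :: "'m \<Rightarrow> 'k::finite pspace"
  assumes affine_hypersurface: "affine_hypersurface n A f"
begin

sublocale smooth_manifold A
  by unfold_locales (use affine_hypersurface in \<open>simp add: affine_hypersurface_def\<close>)

abbreviation df :: "'m \<Rightarrow> ('m, 'd) tvec \<Rightarrow> 'k pspace" where
  "df \<equiv> tderiv A f"

lemma card_d: "CARD('d) = 2 * n + 1" and card_k: "CARD('k) = n + 1"
  using affine_hypersurface by (auto simp: affine_hypersurface_def)

lemma smooth_f: "smooth_map_on A UNIV f"
  using affine_hypersurface by (simp add: affine_hypersurface_def immersion_def)

lemma df_inj: "v \<in> tangent_space A p \<Longrightarrow> w \<in> tangent_space A p \<Longrightarrow> df p v = df p w \<Longrightarrow> v = w"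
  using affine_hypersurface by (auto simp: affine_hypersurface_def immersion_def dest: inj_onD)

lemma df_tcomb:
  "v \<in> tangent_space A p \<Longrightarrow> w \<in> tangent_space A p \<Longrightarrow> df p (tcomb a v b w) = a *\<^sub>R df p v + b *\<^sub>R df p w"
  using tderiv_tcomb[OF smooth_f] by blast

lemma df_image:
  assumes "c \<in> A" "p \<in> fst c"
  shows "df p ` tangent_space A p = range (frechet_derivative (f \<circ> inv_chart c) (at (snd c p)))"
  using tderiv_eq_frechet[OF smooth_f UNIV_I assms] tderiv_tvec_at[OF smooth_f UNIV_I assms]
    tvec_at_tangent[OF assms]
  by (metis (no_types, lifting) image_eqI image_subsetI rangeI subset_antisym)

lemma linear_frechet_f:
  assumes "c \<in> A" "p \<in> fst c"
  shows "linear (frechet_derivative (f \<circ> inv_chart c) (at (snd c p)))"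
  using has_derivative_linear[OF smooth_map_on_has_derivative[OF smooth_f UNIV_I assms]] .

lemma inj_frechet_f:
  assumes "c \<in> A" "p \<in> fst c"
  shows "inj (frechet_derivative (f \<circ> inv_chart c) (at (snd c p)))"
proof (rule injI)
  fix u w assume "frechet_derivative (f \<circ> inv_chart c) (at (snd c p)) u
    = frechet_derivative (f \<circ> inv_chart c) (at (snd c p)) w"
  then have "tvec_at A c p u = tvec_at A c p w"
    using df_inj tvec_at_tangent[OF assms] tderiv_tvec_at[OF smooth_f UNIV_I assms] by metis
  then show "u = w" using tvec_at_self[OF assms] by metis
qed

text \<open>A dimension count: the image of the tangent space has dimension 2n+1 in a space of
  dimension 2n+2, so adjoining any vector outside it gives everything.\<close>

lemma tangent_plus_transversal:
  assumes "Cp \<notin> df p ` tangent_space A p"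
  obtains v r where "v \<in> tangent_space A p" "z = df p v + r *\<^sub>R Cp"
proof -
  let ?H = "df p ` tangent_space A p"
  obtain c where c: "c \<in> A" "p \<in> fst c" by (rule chart_exists)
  have sub: "subspace ?H"
    unfolding df_image[OF c] using linear_subspace_image[OF linear_frechet_f[OF c] subspace_UNIV] by simp
  have "dim ?H = 2 * n + 1"
    unfolding df_image[OF c] using dim_image_eq[OF linear_frechet_f[OF c], of UNIV] inj_frechet_f[OF c]
    by (simp add: card_d)
  then have "dim (insert Cp ?H) = DIM('k pspace)"
    using assms sub by (simp add: dim_insert span_eq_iff[THEN iffD2, OF sub] card_k)
  then have "z \<in> span (insert Cp ?H)" using dim_eq_full by blast
  then obtain r where "z - r *\<^sub>R Cp \<in> ?H"
    using sub by (auto simp: span_breakdown_eq span_eq_iff[THEN iffD2, OF sub])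
  then obtain v where "v \<in> tangent_space A p" "z - r *\<^sub>R Cp = df p v" by blast
  then show thesis using that[of v r] by (simp add: algebra_simps)
qed

text \<open>For \<open>\<sigma> = \<plusminus>1\<close> these are the distributions \<open>D\<^sup>+\<close> and \<open>D\<^sup>-\<close>.\<close>

definition eigdist :: "real \<Rightarrow> 'm \<Rightarrow> ('m, 'd) tvec set" where
  "eigdist \<sigma> p = {v \<in> tangent_space A p. paraJ (df p v) = \<sigma> *\<^sub>R df p v}"

lemma pdistI:
  assumes "v \<in> tangent_space A p" "w \<in> tangent_space A p" "df p v = paraJ (df p w)"
  shows "v \<in> pdist A f p"
proof -
  have "df p v \<in> paraJ ` df p ` tangent_space A p"
    unfolding assms(3) by (intro imageI assms(2))
  then show ?thesis unfolding pdist_def using assms(1) by blast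
qed

lemma pdist_iff: "v \<in> pdist A f p \<longleftrightarrow> v \<in> tangent_space A p \<and> (\<exists>w\<in>tangent_space A p. df p v = paraJ (df p w))"
proof
  show "v \<in> pdist A f p \<Longrightarrow> v \<in> tangent_space A p \<and> (\<exists>w\<in>tangent_space A p. df p v = paraJ (df p w))"
    unfolding pdist_def by blast
qed (use pdistI in blast)

text \<open>Since \<sigma>^2 = 1, the image of \<open>v\<close> is J applied to the image of the
  tangent vector \<sigma> v.\<close>

lemma eigdist_subset_pdist:
  assumes "v \<in> eigdist \<sigma> p" "\<sigma> * \<sigma> = 1"
  shows "v \<in> pdist A f p"
proof (rule pdistI)
  show "v \<in> tangent_space A p" using assms by (simp add: eigdist_def)
  then show "tcomb \<sigma> v 0 v \<in> tangent_space A p" "df p v = paraJ (df p (tcomb \<sigma> v 0 v))"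
    using assms by (simp_all add: tcomb_tangent df_tcomb paraJ_simps eigdist_def)
qed

lemma pdist_plus_eq: "pdist_plus A f p = eigdist 1 p"
  using eigdist_subset_pdist[of _ 1 p] by (auto simp: pdist_plus_def eigdist_def pdist_def)

lemma pdist_minus_eq: "pdist_minus A f p = eigdist (-1) p"
  using eigdist_subset_pdist[of _ "-1" p] by (auto simp: pdist_minus_def eigdist_def pdist_def)

end

section \<open>The eigendistributions when eta is parallel\<close>

locale parallel_eta = para_hypersurface n A f
  for n and A :: "('m::{t2_space, second_countable_topology}, 'd::finite) chart set"
    and f :: "'m \<Rightarrow> 'k::finite pspace" +
  fixes C :: "'m \<Rightarrow> 'k pspace"
    and nabla :: "('m, 'd) connection"
    and h :: "'m \<Rightarrow> ('m, 'd) tvec \<Rightarrow> ('m, 'd) tvec \<Rightarrow> real"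
    and \<phi> :: "'m \<Rightarrow> ('m, 'd) tvec \<Rightarrow> ('m, 'd) tvec"
    and \<xi> :: "('m, 'd) vfield"
    and \<eta> :: "'m \<Rightarrow> ('m, 'd) tvec \<Rightarrow> real"
  assumes transversal: "transversal_on A f UNIV C"
    and connection: "induced_connection_on A f UNIV C nabla h"
    and paracontact: "induced_paracontact_on A f UNIV C \<phi> \<xi> \<eta>"
    and parallel: "parallel_form_on A UNIV nabla \<eta>"
begin

lemma C_transversal: "C p \<notin> df p ` tangent_space A p"
  using transversal by (simp add: transversal_on_def)

lemma xi: "\<xi> p \<in> tangent_space A p" "df p (\<xi> p) = paraJ (C p)" "\<eta> p (\<xi> p) = 1" "\<phi> p (\<xi> p) = tzero"
  using paracontact by (auto simp: induced_paracontact_on_def smooth_vfield_on_def)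

lemma eta_pdist: "v \<in> pdist A f p \<Longrightarrow> \<eta> p v = 0"
  using paracontact by (auto simp: induced_paracontact_on_def)

lemma phi_pdist: "v \<in> pdist A f p \<Longrightarrow> df p (\<phi> p v) = paraJ (df p v)"
  using paracontact by (auto simp: induced_paracontact_on_def)

lemma phi_tangent: "v \<in> tangent_space A p \<Longrightarrow> \<phi> p v \<in> tangent_space A p"
  using paracontact by (auto simp: induced_paracontact_on_def tensor11_on_def)

lemma phi_tcomb:
  "v \<in> tangent_space A p \<Longrightarrow> w \<in> tangent_space A p \<Longrightarrow> \<phi> p (tcomb a v b w) = tcomb a (\<phi> p v) b (\<phi> p w)"
  using paracontact by (auto simp: induced_paracontact_on_def tensor11_on_def)

lemma phi_smooth: "open V \<Longrightarrow> smooth_vfield_on A V X \<Longrightarrow> smooth_vfield_on A V (\<lambda>p. \<phi> p (X p))"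
  using paracontact by (auto simp: induced_paracontact_on_def tensor11_on_def)

lemma eta_tcomb:
  "v \<in> tangent_space A p \<Longrightarrow> w \<in> tangent_space A p \<Longrightarrow> \<eta> p (tcomb a v b w) = a * \<eta> p v + b * \<eta> p w"
  using paracontact by (auto simp: induced_paracontact_on_def one_form_on_def)

text \<open>Decompose J(df v) as df w + r C and apply J: as J C is the image of
  \<open>\<xi>\<close>, the vector v - r \<xi> is mapped to J(df w). Evaluating
  \<open>\<eta>\<close> identifies r.\<close>

lemma minus_xi_pdist:
  assumes v: "v \<in> tangent_space A p"
  shows "tcomb 1 v (- \<eta> p v) (\<xi> p) \<in> pdist A f p"
proof -
  obtain w r where w: "w \<in> tangent_space A p" and eq: "paraJ (df p v) = df p w + r *\<^sub>R C p"
    using tangent_plus_transversal[OF C_transversal] .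
  have "df p v = paraJ (df p w) + r *\<^sub>R paraJ (C p)"
    using arg_cong[OF eq, of paraJ] by (simp add: paraJ_simps)
  then have d: "tcomb 1 v (- r) (\<xi> p) \<in> pdist A f p"
    using v w xi by (intro pdistI[OF _ w]) (simp_all add: tcomb_tangent df_tcomb)
  then have "\<eta> p v = r" using eta_pdist[OF d] eta_tcomb[OF v xi(1)] xi(3) by simp
  then show ?thesis using d by simp
qed

lemma eta_eq_0_pdist:
  assumes "v \<in> tangent_space A p" "\<eta> p v = 0"
  shows "v \<in> pdist A f p"
proof -
  have "tcomb 1 v (- \<eta> p v) (\<xi> p) = v" by (simp add: tcomb_def assms(2))
  then show ?thesis using minus_xi_pdist[OF assms(1)] by simp
qed

text \<open>\<open>proj \<sigma> p\<close> is twice the projection onto \<open>eigdist \<sigma> p\<close>; composed with smooth fields it yields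
  smooth sections of that distribution.\<close>

definition proj :: "real \<Rightarrow> 'm \<Rightarrow> ('m, 'd) tvec \<Rightarrow> ('m, 'd) tvec" where
  "proj \<sigma> p v = tcomb 1 (\<phi> p (\<phi> p v)) \<sigma> (\<phi> p v)"

lemma proj_smooth: "open V \<Longrightarrow> smooth_vfield_on A V X \<Longrightarrow> smooth_vfield_on A V (\<lambda>p. proj \<sigma> p (X p))"
  unfolding proj_def by (intro smooth_vfield_tcomb phi_smooth)

lemma proj_tangent: "v \<in> tangent_space A p \<Longrightarrow> proj \<sigma> p v \<in> tangent_space A p"
  unfolding proj_def by (intro tcomb_tangent phi_tangent)

lemma df_phi:
  assumes v: "v \<in> pdist A f p"
  shows "df p (\<phi> p (\<phi> p v)) = df p v"
proof -
  have t: "v \<in> tangent_space A p" using v by (simp add: pdist_iff)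
  have "\<phi> p v \<in> pdist A f p"
    by (rule pdistI[OF phi_tangent[OF t] t phi_pdist[OF v]])
  then show ?thesis using phi_pdist v by simp
qed

lemma df_proj:
  assumes v: "v \<in> pdist A f p"
  shows "df p (proj \<sigma> p v) = df p v + \<sigma> *\<^sub>R paraJ (df p v)"
proof -
  have t: "v \<in> tangent_space A p" using v by (simp add: pdist_iff)
  then show ?thesis unfolding proj_def by (simp add: df_tcomb phi_tangent df_phi[OF v] phi_pdist[OF v])
qed

lemma proj_tcomb:
  assumes "v \<in> tangent_space A p" "w \<in> tangent_space A p"
  shows "proj \<sigma> p (tcomb a v b w) = tcomb a (proj \<sigma> p v) b (proj \<sigma> p w)"
  using assms by (simp add: proj_def phi_tcomb phi_tangent)
    (simp add: tcomb_def fun_eq_iff algebra_simps)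

text \<open>\<open>\<phi>\<close> kills \<open>\<xi>\<close>, so \<open>v\<close> may be replaced by
  its part in \<open>pdist\<close>, on which \<open>\<phi>\<close> acts as J; and z + \<sigma> J z
  is always a \<sigma>-eigenvector of J.\<close>

lemma proj_eigdist:
  assumes v: "v \<in> tangent_space A p" and \<sigma>: "\<sigma> * \<sigma> = 1"
  shows "proj \<sigma> p v \<in> eigdist \<sigma> p"
proof -
  define d where "d = tcomb 1 v (- \<eta> p v) (\<xi> p)"
  have d: "d \<in> pdist A f p" using minus_xi_pdist[OF v] by (simp add: d_def)
  have "\<phi> p d = tcomb 1 (\<phi> p v) (- \<eta> p v) (\<phi> p (\<xi> p))"
    unfolding d_def by (rule phi_tcomb[OF v xi(1)])
  then have "\<phi> p d = \<phi> p v" by (simp add: xi(4) tcomb_def tzero_def)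
  then have "df p (proj \<sigma> p v) = df p d + \<sigma> *\<^sub>R paraJ (df p d)"
    using df_proj[OF d, of \<sigma>] by (simp add: proj_def)
  then show ?thesis
    unfolding eigdist_def using proj_tangent[OF v] \<sigma> by (simp add: paraJ_simps scaleR_add_right add.commute)
qed

lemma df_proj_eigdist:
  assumes "v \<in> eigdist \<sigma> p" and \<sigma>: "\<sigma> * \<sigma> = 1"
  shows "df p (proj \<sigma> p v) = 2 *\<^sub>R df p v"
proof -
  have "paraJ (df p v) = \<sigma> *\<^sub>R df p v" using assms by (simp add: eigdist_def)
  then show ?thesis
    using df_proj[OF eigdist_subset_pdist[OF assms], of \<sigma>] \<sigma> by (simp add: scaleR_2)
qed

text \<open>Since \<open>\<nabla>\<eta> = 0\<close>, the derivative of a section of \<open>eigdist \<sigma>\<close> has no component along \<open>C\<close>: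
  otherwise comparing both sides of the formula of Gauss under \<open>paraJ\<close> would make \<open>C\<close> tangent.\<close>

lemma nabla_eigdist:
  assumes "open V" "p \<in> V" "smooth_vfield_on A V X" "smooth_vfield_on A V Y" and \<sigma>: "\<sigma> * \<sigma> = 1"
    and Y: "\<And>q. q \<in> V \<Longrightarrow> Y q \<in> eigdist \<sigma> q"
  shows "nabla X Y p \<in> eigdist \<sigma> p"
    and "tderiv A (\<lambda>q. df q (Y q)) p (X p) = df p (nabla X Y p)"
proof -
  define K where "K = nabla X Y p"
  define r where "r = h p (X p) (Y p)"
  have K: "K \<in> tangent_space A p" and gauss: "tderiv A (\<lambda>q. df q (Y q)) p (X p) = df p K + r *\<^sub>R C p"
    using connection assms(1-4) unfolding induced_connection_on_def K_def r_def
    by (auto simp: smooth_vfield_on_def)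
  have Xp: "X p \<in> tangent_space A p" using smooth_vfield_onD(2)[OF assms(3,2)] .
  have sm: "smooth_map_on A V (\<lambda>q. df q (Y q))"
    by (rule smooth_map_tderiv[OF smooth_map_on_subset[OF smooth_f] assms(4,1)]) simp
  \<comment> \<open>J has constant coefficients, so the eigenvector equation for the section
    \<open>Y\<close> can be differentiated.\<close>
  have "paraJ (tderiv A (\<lambda>q. df q (Y q)) p (X p)) - \<sigma> *\<^sub>R tderiv A (\<lambda>q. df q (Y q)) p (X p) = 0"
    by (rule tderiv_linear_eq_0[OF assms(1,2) sm _ _ Xp, of "\<lambda>z. paraJ z - \<sigma> *\<^sub>R z"])
      (use Y in \<open>auto simp: eigdist_def intro!: bounded_linear_sub bounded_linear_paraJ bounded_linear_scaleR_right\<close>)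
  then have J: "paraJ (df p K) + r *\<^sub>R paraJ (C p) = \<sigma> *\<^sub>R (df p K + r *\<^sub>R C p)"
    unfolding gauss by (simp add: paraJ_simps)
  have eta0: "\<eta> q (Y q) = 0" if "q \<in> V" for q
    using Y[OF that] eigdist_subset_pdist \<sigma> eta_pdist by blast
  have "tderiv A (\<lambda>q. \<eta> q (Y q)) p (X p) = 0"
  proof -
    obtain c where c: "c \<in> A" "p \<in> fst c" by (rule chart_exists)
    have "((\<lambda>q. \<eta> q (Y q)) \<circ> inv_chart c has_derivative (\<lambda>u. 0)) (at (snd c p))"
      by (rule has_derivative_transform_within_open[OF has_derivative_const open_chart_image[OF c(1) assms(1)]])
        (use assms(2) c eta0 in \<open>auto simp: inv_chart_left\<close>)
    from tderiv_chart[OF c Xp this] show ?thesis .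
  qed
  \<comment> \<open>Parallelism reads X(\<eta>(Y)) = \<eta>(\<nabla>_X Y), and \<eta>(Y) vanishes on
    \<open>V\<close>.\<close>
  then have "\<eta> p K = 0"
    using parallel assms(1-4) unfolding parallel_form_on_def K_def by fastforce
  then have "K \<in> pdist A f p" using eta_eq_0_pdist K by blast
  then have "df p (\<phi> p K) = paraJ (df p K)" by (rule phi_pdist)
  \<comment> \<open>The relation \<open>J\<close> multiplied by \<sigma> and solved for r C: J(df K)
    is the image of \<open>\<phi> p K\<close> and J C the image of \<open>\<xi> p\<close>, so only
    tangent vectors remain on the right.\<close>
  then have eq: "r *\<^sub>R C p = df p (tcomb 1 (tcomb \<sigma> (\<phi> p K) (-1) K) (\<sigma> * r) (\<xi> p))"
    using J K \<sigma> xi by (simp add: df_tcomb tcomb_tangent phi_tangent)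
      (metis (no_types, opaque_lifting) add.commute add_diff_cancel_left' diff_add_eq scaleR_add_right scaleR_one scaleR_scaleR uminus_add_conv_diff)
  have "r = 0"
  proof (rule ccontr)
    assume "r \<noteq> 0"
    define W where "W = tcomb 1 (tcomb \<sigma> (\<phi> p K) (-1) K) (\<sigma> * r) (\<xi> p)"
    have W: "W \<in> tangent_space A p" unfolding W_def by (intro tcomb_tangent phi_tangent K xi)
    have "C p = df p (tcomb (1 / r) W 0 W)"
      using eq \<open>r \<noteq> 0\<close> by (simp add: df_tcomb[OF W W] W_def[symmetric]) (metis \<open>r \<noteq> 0\<close> divide_inverse mult_1 scaleR_one left_inverse scaleR_scaleR)
    then show False using C_transversal tcomb_tangent[OF W W] by blast
  qed
  then show "nabla X Y p \<in> eigdist \<sigma> p" "tderiv A (\<lambda>q. df q (Y q)) p (X p) = df p (nabla X Y p)"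
    using J K gauss by (auto simp: eigdist_def K_def)
qed

text \<open>The projected coordinate fields span the eigendistribution at every point of the chart.
  Being 2n+1 fields in rank n they are no basis, but chart components serve as smooth coefficients,
  so no local basis of sections has to be chosen.\<close>

lemma df_proj_expansion:
  assumes "c \<in> A" "p \<in> fst c"
  shows "df p (proj \<sigma> p (tvec_at A c p u)) =
    (\<Sum>j\<in>UNIV. (u $ j) *\<^sub>R df p (proj \<sigma> p (tvec_at A c p (axis j 1))))"
proof -
  define L where "L u = df p (proj \<sigma> p (tvec_at A c p u))" for u
  have comb: "L (a *\<^sub>R u + b *\<^sub>R w) = a *\<^sub>R L u + b *\<^sub>R L w" for a b u w
    unfolding L_def tvec_at_linear_comb[OF assms]
    using tvec_at_tangent[OF assms] by (simp add: proj_tcomb df_tcomb proj_tangent)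
  have "linear L"
    by (rule linearI) (use comb[of 1 _ 1] comb[of _ _ 0] in simp_all)
  then have "L (\<Sum>j\<in>UNIV. (u $ j) *\<^sub>R axis j 1) = (\<Sum>j\<in>UNIV. (u $ j) *\<^sub>R L (axis j 1))"
    by (simp add: linear_sum linear_scale)
  moreover have "(\<Sum>j\<in>UNIV. (u $ j) *\<^sub>R axis j 1) = u"
    using basis_expansion[of u] by (simp add: scalar_mult_eq_scaleR)
  ultimately show ?thesis unfolding L_def by simp
qed

text \<open>Along a ray of the chart the components of a frame of \<open>eigdist \<sigma>\<close> in the fixed direction \<open>y\<close>
  satisfy a homogeneous linear system of differential equations, so they stay zero.\<close>

lemma eigdist_orthogonal_in_ball:
  assumes c: "c \<in> A" "p \<in> fst c" and ball: "snd c ` fst c = ball (snd c p) r"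
    and \<sigma>: "\<sigma> * \<sigma> = 1"
    and y: "\<And>v. v \<in> eigdist \<sigma> p \<Longrightarrow> y \<bullet> df p v = 0"
    and q: "q \<in> fst c" and v: "v \<in> eigdist \<sigma> q"
  shows "y \<bullet> df q v = 0"
proof -
  define V where "V = fst c"
  have V: "open V" "V \<subseteq> fst c" using open_dom[OF c(1)] by (simp_all add: V_def)
  define w where "w = snd c q - snd c p"
  define X where "X q = tvec_at A c q w" for q
  define Y where "Y i q = proj \<sigma> q (tvec_at A c q (axis i 1))" for i q
  have Xs: "smooth_vfield_on A V X" unfolding X_def by (rule smooth_tvec_at[OF c(1) V(2,1)])
  have Ys: "smooth_vfield_on A V (Y i)" for i
    unfolding Y_def by (intro proj_smooth smooth_tvec_at c V)
  have Ye: "Y i q \<in> eigdist \<sigma> q" if "q \<in> V" for i q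
    unfolding Y_def using proj_eigdist tvec_at_tangent[OF c(1)] \<sigma> that V by blast
  define K where "K i = nabla X (Y i)" for i
  have Ks: "smooth_vfield_on A V (K i)" for i
    using connection V Xs Ys unfolding induced_connection_on_def K_def by blast
  define U where "U i q = y \<bullet> df q (Y i q)" for i q
  have fY: "smooth_map_on A V (\<lambda>q. df q (Y i q))" for i
    by (rule smooth_map_tderiv[OF smooth_map_on_subset[OF smooth_f] Ys V(1)]) simp
  have dU: "((U i \<circ> inv_chart c) has_derivative (\<lambda>u. y \<bullet>
      frechet_derivative ((\<lambda>q. df q (Y i q)) \<circ> inv_chart c) (at (snd c q)) u)) (at (snd c q))"
    if "q \<in> V" for i q
    using bounded_linear.has_derivative[OF bounded_linear_inner_right
        smooth_map_on_has_derivative[OF fY that c(1)], of y i] that V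
    unfolding U_def comp_def by blast
  \<comment> \<open>The derivative of a section of the eigendistribution lies in it again, by
    \<open>nabla_eigdist\<close>, and therefore expands in the \<open>Y j\<close>. The factor 1/2
    compensates for \<open>proj\<close> being twice the projection.\<close>
  have dUw: "y \<bullet> frechet_derivative ((\<lambda>q. df q (Y i q)) \<circ> inv_chart c) (at (snd c q)) w
      = (\<Sum>j\<in>UNIV. (1/2) * (K i q c $ j) * U j q)" if q: "q \<in> V" for i q
  proof -
    have qc: "q \<in> fst c" using q V by blast
    have Kt: "K i q \<in> tangent_space A q" using smooth_vfield_onD(2)[OF Ks q] .
    have Ke: "K i q \<in> eigdist \<sigma> q" and "tderiv A (\<lambda>q. df q (Y i q)) q (X q) = df q (K i q)"
      unfolding K_def using nabla_eigdist[OF V(1) q Xs Ys \<sigma> Ye] by blast+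
    then have "frechet_derivative ((\<lambda>q. df q (Y i q)) \<circ> inv_chart c) (at (snd c q)) w = df q (K i q)"
      using tderiv_tvec_at[OF fY q c(1) qc] by (simp add: X_def)
    also have "2 *\<^sub>R df q (K i q) = df q (proj \<sigma> q (K i q))"
      using df_proj_eigdist[OF Ke \<sigma>] by simp
    also have "\<dots> = (\<Sum>j\<in>UNIV. (K i q c $ j) *\<^sub>R df q (Y j q))"
      using df_proj_expansion[OF c(1) qc, of \<sigma> "K i q c"] tvec_at_component[OF c(1) qc Kt]
      by (simp add: Y_def)
    finally have "2 *\<^sub>R frechet_derivative ((\<lambda>q. df q (Y i q)) \<circ> inv_chart c) (at (snd c q)) w
      = (\<Sum>j\<in>UNIV. (K i q c $ j) *\<^sub>R df q (Y j q))" .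
    from arg_cong[OF this, of "\<lambda>z. (1/2) * (y \<bullet> z)"] show ?thesis
      by (simp add: inner_sum_right sum_divide_distrib U_def)
  qed
  define \<gamma> where "\<gamma> t = inv_chart c (snd c p + t *\<^sub>R w)" for t
  have ray: "snd c p + t *\<^sub>R w \<in> snd c ` fst c" if "t \<in> {0..1}" for t
  proof -
    have "snd c q \<in> ball (snd c p) r" using q ball by blast
    then have "norm w < r" unfolding w_def by (simp add: dist_norm norm_minus_commute)
    moreover have "norm (t *\<^sub>R w) \<le> norm w" using that by (simp add: mult_left_le_one_le)
    ultimately show ?thesis unfolding ball by (simp add: dist_norm)
  qed
  have \<gamma>: "\<gamma> t \<in> V" "snd c (\<gamma> t) = snd c p + t *\<^sub>R w" if "t \<in> {0..1}" for t
    using inv_chart_dom[OF c(1) ray[OF that]] inv_chart_right[OF c(1) ray[OF that]] V_def \<gamma>_def by simp_all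
  have zero: "U i (\<gamma> 1) = 0" for i
  proof (rule linear_ode_zero[where u = "\<lambda>i t. U i (\<gamma> t)" and K = "\<lambda>i j t. (1/2) * (K i (\<gamma> t) c $ j)"])
    fix i t assume t: "t \<in> {0..1::real}"
    have "((\<lambda>t. snd c p + t *\<^sub>R w) has_derivative (\<lambda>s. s *\<^sub>R w)) (at t)"
      by (auto intro!: derivative_eq_intros)
    from diff_chain_at[OF this dU[OF \<gamma>(1)[OF t], of i, unfolded \<gamma>(2)[OF t]]]
    have D: "((\<lambda>t. U i (\<gamma> t)) has_derivative (\<lambda>s. y \<bullet>
      frechet_derivative ((\<lambda>q. df q (Y i q)) \<circ> inv_chart c) (at (snd c p + t *\<^sub>R w)) (s *\<^sub>R w))) (at t)"
      by (simp add: comp_def \<gamma>_def)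
    have lin: "linear (frechet_derivative ((\<lambda>q. df q (Y i q)) \<circ> inv_chart c) (at (snd c p + t *\<^sub>R w)))"
      using has_derivative_linear[OF smooth_map_on_has_derivative[OF fY \<gamma>(1)[OF t] c(1), of i]]
        \<gamma>[OF t] V by auto
    have "(\<lambda>s. y \<bullet> frechet_derivative ((\<lambda>q. df q (Y i q)) \<circ> inv_chart c) (at (snd c p + t *\<^sub>R w)) (s *\<^sub>R w))
        = (*) (\<Sum>j\<in>UNIV. (1/2) * (K i (\<gamma> t) c $ j) * U j (\<gamma> t))"
      using dUw[OF \<gamma>(1)[OF t], of i] by (simp add: linear_scale[OF lin] \<gamma>(2)[OF t] fun_eq_iff mult.commute)
    then show "((\<lambda>t. U i (\<gamma> t)) has_real_derivative
        (\<Sum>j\<in>UNIV. (1/2) * (K i (\<gamma> t) c $ j) * U j (\<gamma> t))) (at t)"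
      using D by (simp add: has_field_derivative_def)
  next
    fix i j
    have "continuous_on (snd c ` fst c) (\<lambda>x. K i (inv_chart c x) c)"
      using smooth_on_imp_continuous_on[OF smooth_vfield_onD(1)[OF Ks c(1), of i]] by (simp add: V_def)
    moreover have "continuous_on {0..1} (\<lambda>t::real. snd c p + t *\<^sub>R w)" by (intro continuous_intros)
    ultimately have "continuous_on {0..1} (\<lambda>t. K i (\<gamma> t) c)"
      unfolding \<gamma>_def by (rule continuous_on_compose2) (use ray in auto)
    then show "continuous_on {0..1} (\<lambda>t. (1/2) * (K i (\<gamma> t) c $ j))" by (intro continuous_intros)
  next
    fix i
    have "\<gamma> 0 = p" using c by (simp add: \<gamma>_def inv_chart_left)
    then show "U i (\<gamma> 0) = 0" unfolding U_def using y Ye[of p i] c V_def by simp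
  qed simp
  have "\<gamma> 1 = q" using c q by (simp add: \<gamma>_def w_def inv_chart_left)
  then have U0: "U i q = 0" for i using zero by simp
  have vt: "v \<in> tangent_space A q" using v by (simp add: eigdist_def)
  have "2 *\<^sub>R df q v = (\<Sum>j\<in>UNIV. (v c $ j) *\<^sub>R df q (Y j q))"
    using df_proj_expansion[OF c(1) q, of \<sigma> "v c"] tvec_at_component[OF c(1) q vt] df_proj_eigdist[OF v \<sigma>]
    by (simp add: Y_def)
  from arg_cong[OF this, of "\<lambda>z. y \<bullet> z"] show ?thesis
    using U0 by (simp add: inner_sum_right U_def)
qed

section \<open>Constant conormals of the eigendistributions\<close>

lemma eigdist_subspace: "subspace (df p ` eigdist \<sigma> p)"
proof (rule subspaceI)
  have z: "df p tzero = 0" using df_tcomb[OF tzero_tangent tzero_tangent, of p 0 0]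
    by (simp add: tcomb_def tzero_def)
  then have "tzero \<in> eigdist \<sigma> p" by (simp add: eigdist_def tzero_tangent paraJ_simps)
  then show "0 \<in> df p ` eigdist \<sigma> p" using z by (metis image_eqI)
next
  fix x y assume "x \<in> df p ` eigdist \<sigma> p" "y \<in> df p ` eigdist \<sigma> p"
  then obtain v w where vw: "v \<in> eigdist \<sigma> p" "w \<in> eigdist \<sigma> p" "x = df p v" "y = df p w" by blast
  then have "tcomb 1 v 1 w \<in> eigdist \<sigma> p" "x + y = df p (tcomb 1 v 1 w)"
    by (simp_all add: eigdist_def df_tcomb tcomb_tangent paraJ_simps scaleR_add_right)
  then show "x + y \<in> df p ` eigdist \<sigma> p" by blast
next
  fix a x assume "x \<in> df p ` eigdist \<sigma> p"
  then obtain v where v: "v \<in> eigdist \<sigma> p" "x = df p v" by blast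
  then have "tcomb a v 0 v \<in> eigdist \<sigma> p" "a *\<^sub>R x = df p (tcomb a v 0 v)"
    by (simp_all add: eigdist_def df_tcomb tcomb_tangent paraJ_simps)
  then show "a *\<^sub>R x \<in> df p ` eigdist \<sigma> p" by blast
qed

text \<open>\<open>S\<close> is the image of \<open>eigdist \<sigma> p\<close> plus the whole
  opposite eigenspace of J. It misses \<open>C p\<close>, so the component of \<open>C p\<close>
  orthogonal to \<open>S\<close> is nonzero; orthogonality to the opposite eigenspace forces it to
  be a \<sigma>-eigenvector.\<close>

lemma conormal_exists:
  assumes \<sigma>: "\<sigma> * \<sigma> = 1"
  obtains y where "y \<noteq> 0" "paraJ y = \<sigma> *\<^sub>R y" "\<And>v. v \<in> eigdist \<sigma> p \<Longrightarrow> y \<bullet> df p v = 0"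
proof -
  define E where "E = {z::'k pspace. paraJ z = - \<sigma> *\<^sub>R z}"
  define S where "S = {s + e | s e. s \<in> df p ` eigdist \<sigma> p \<and> e \<in> E}"
  have E: "subspace E" unfolding E_def by (rule subspaceI) (auto simp: paraJ_simps algebra_simps)
  have SI: "s + e \<in> S" if "s \<in> df p ` eigdist \<sigma> p" "e \<in> E" for s e
    using that unfolding S_def by blast
  have S: "subspace S" unfolding S_def by (rule subspace_sums[OF eigdist_subspace E])
  have "C p \<notin> S"
  proof
    assume "C p \<in> S"
    then obtain s e where se: "s \<in> df p ` eigdist \<sigma> p" "e \<in> E" "C p = s + e"
      unfolding S_def by blast
    then obtain v where v: "v \<in> eigdist \<sigma> p" and C: "C p = df p v + e" by blast
    have e: "paraJ e = - \<sigma> *\<^sub>R e" using se(2) by (simp add: E_def)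
    have vt: "v \<in> tangent_space A p" using v by (simp add: eigdist_def)
    have "paraJ (C p) = \<sigma> *\<^sub>R df p v - \<sigma> *\<^sub>R e"
      using v e by (simp add: C paraJ_simps eigdist_def)
    \<comment> \<open>Eliminating \<open>e\<close> gives C = 2 df v - \<sigma> J C. The right side
      is tangent because J C is the image of \<open>\<xi> p\<close>.\<close>
    then have "\<sigma> *\<^sub>R paraJ (C p) = df p v - e" using \<sigma> by (simp add: scaleR_diff_right)
    moreover have "df p (tcomb 2 v (- \<sigma>) (\<xi> p)) = 2 *\<^sub>R df p v - \<sigma> *\<^sub>R paraJ (C p)"
      using df_tcomb[OF vt xi(1)] xi(2) by simp
    ultimately have "df p (tcomb 2 v (- \<sigma>) (\<xi> p)) = C p"
      unfolding C by (simp add: scaleR_2)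
    then show False using C_transversal tcomb_tangent[OF vt xi(1)] by (metis image_eqI)
  qed
  obtain s z where s: "s \<in> span S" and z: "\<And>w. w \<in> span S \<Longrightarrow> orthogonal z w" and eq: "C p = s + z"
    using orthogonal_subspace_decomp_exists[of S "C p"] by metis
  have "z \<noteq> 0" using \<open>C p \<notin> S\<close> s eq S by (auto simp: span_eq_iff[THEN iffD2])
  have zS: "z \<bullet> w = 0" if "w \<in> S" for w using z[OF span_base[OF that]] by (simp add: orthogonal_def)
  have "z \<bullet> df p v = 0" if "v \<in> eigdist \<sigma> p" for v
    using zS[OF SI[OF imageI[OF that] subspace_0[OF E]]] by simp
  moreover have "paraJ z = \<sigma> *\<^sub>R z"
  proof -
    \<comment> \<open>\<open>d\<close> is twice the component of \<open>z\<close> in the opposite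
      eigenspace, so \<open>z\<close> is orthogonal to it; self-adjointness of J then gives that
      \<open>d\<close> is orthogonal to itself.\<close>
    define d where "d = z - \<sigma> *\<^sub>R paraJ z"
    have "d \<in> E" unfolding d_def E_def using \<sigma> by (simp add: paraJ_simps algebra_simps)
    then have "d \<in> S" using SI[OF subspace_0[OF eigdist_subspace]] by fastforce
    then have zd: "z \<bullet> d = 0" by (rule zS)
    have "paraJ z \<bullet> d = z \<bullet> paraJ d" by (rule paraJ_inner)
    also have "\<dots> = 0" using \<open>d \<in> E\<close> zd by (simp add: E_def)
    finally have "d \<bullet> d = 0" using zd by (subst (1) d_def) (simp add: inner_diff_left)
    then have "z = \<sigma> *\<^sub>R paraJ z" by (simp add: d_def)
    then show ?thesis using \<sigma> by (metis scaleR_one scaleR_scaleR)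
  qed
  ultimately show thesis using that \<open>z \<noteq> 0\<close> by blast
qed

text \<open>\<open>y\<close> annihilates the image of \<open>eigdist \<sigma>\<close> by hypothesis
  and that of the opposite eigendistribution by orthogonality of eigenspaces. So its pairing with
  \<open>df q\<close> vanishes on the kernel of \<open>\<eta>\<close>, and \<open>a\<close> is its
  value on \<open>\<xi> q\<close>. Were \<open>a\<close> zero, \<open>y\<close> would also be
  orthogonal to \<open>C q\<close>, hence to the whole space.\<close>

lemma conormal_df:
  assumes y: "y \<noteq> 0" "paraJ y = \<sigma> *\<^sub>R y" "\<And>v. v \<in> eigdist \<sigma> q \<Longrightarrow> y \<bullet> df q v = 0" and \<sigma>: "\<sigma> * \<sigma> = 1"
  obtains a where "a \<noteq> 0" "\<And>v. v \<in> tangent_space A q \<Longrightarrow> y \<bullet> df q v = a * \<eta> q v"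
proof -
  have d0: "y \<bullet> df q d = 0" if d: "d \<in> pdist A f q" for d
  proof -
    have t: "d \<in> tangent_space A q" using d by (simp add: pdist_iff)
    have "proj \<sigma> q d \<in> eigdist \<sigma> q" by (rule proj_eigdist[OF t \<sigma>])
    then have "y \<bullet> (df q d + \<sigma> *\<^sub>R paraJ (df q d)) = 0" using y(3) df_proj[OF d] by metis
    moreover have "y \<bullet> (df q d - \<sigma> *\<^sub>R paraJ (df q d)) = 0"
      by (rule inner_eig_opposite[OF y(2) _ \<sigma>]) (use \<sigma> in \<open>simp add: paraJ_simps algebra_simps\<close>)
    ultimately show ?thesis by (simp add: inner_add_right inner_diff_right)
  qed
  define a where "a = y \<bullet> paraJ (C q)"
  have eq: "y \<bullet> df q v = a * \<eta> q v" if v: "v \<in> tangent_space A q" for v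
    using d0[OF minus_xi_pdist[OF v]] v xi by (simp add: df_tcomb a_def inner_diff_right)
  have "a \<noteq> 0"
  proof
    assume "a = 0"
    then have "y \<bullet> C q = 0" using paraJ_inner[of y "C q"] y(2) \<sigma> by (auto simp: a_def)
    obtain v r where "v \<in> tangent_space A q" "y = df q v + r *\<^sub>R C q"
      using tangent_plus_transversal[OF C_transversal] .
    then have "y \<bullet> y = 0" using eq \<open>a = 0\<close> \<open>y \<bullet> C q = 0\<close>
      by (metis (no_types, lifting) inner_add_right inner_scaleR_right mult_zero_left mult_zero_right add_0)
    then show False using y(1) by simp
  qed
  then show thesis using that eq by blast
qed

text \<open>Both eigendistributions yield a conormal that is constant near \<open>p\<close>. The
  pairings of \<open>ya\<close> and \<open>yb\<close> with \<open>df\<close> are nonzero multiples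
  of the same form \<open>\<eta>\<close>, hence of each other.\<close>

lemma local_conormals:
  obtains W ya yb where "open W" "p \<in> W" "paraJ ya = ya" "paraJ yb = - yb"
    and "\<And>q. q \<in> W \<Longrightarrow> \<exists>v\<in>tangent_space A q. ya \<bullet> df q v \<noteq> 0"
    and "\<And>q. q \<in> W \<Longrightarrow> \<exists>l. l \<noteq> 0 \<and> (\<forall>v\<in>tangent_space A q. yb \<bullet> df q v = l * (ya \<bullet> df q v))"
proof -
  obtain c0 where c0: "c0 \<in> A" "p \<in> fst c0" by (rule chart_exists)
  \<comment> \<open>\<open>new_chart\<close> is applied to the coordinate map of \<open>c0\<close>
    itself, only to shrink its domain until the image is a ball.\<close>
  have self: "(snd c0 \<circ> inv_chart c0 has_derivative (\<lambda>u. u)) (at (snd c0 p))"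
    by (rule has_derivative_transform_within_open[OF has_derivative_ident open_image[OF c0(1)]])
      (use c0 in \<open>auto simp: inv_chart_left\<close>)
  have sm: "smooth_map_on A (fst c0) (snd c0)"
    unfolding smooth_map_on_def
    using smooth_transition[OF _ c0(1)] by (simp add: transition_def)
  have "inj (frechet_derivative (snd c0 \<circ> inv_chart c0) (at (snd c0 p)))"
    using frechet_derivative_at[OF self] by (metis inj_on_id2)
  from new_chart[OF c0 open_dom[OF c0(1)] c0(2) sm this]
  obtain W r where W: "(W, snd c0) \<in> A" "p \<in> W" "snd c0 ` W = ball (snd c0 p) r" by metis
  define c where "c = (W, snd c0)"
  have c: "c \<in> A" "p \<in> fst c" "snd c ` fst c = ball (snd c p) r" using W by (auto simp: c_def)
  obtain ya where ya: "ya \<noteq> 0" "paraJ ya = 1 *\<^sub>R ya" "\<And>v. v \<in> eigdist 1 p \<Longrightarrow> ya \<bullet> df p v = 0"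
    by (rule conormal_exists[of 1 p]) auto
  obtain yb where yb: "yb \<noteq> 0" "paraJ yb = (-1) *\<^sub>R yb" "\<And>v. v \<in> eigdist (-1) p \<Longrightarrow> yb \<bullet> df p v = 0"
    by (rule conormal_exists[of "-1" p]) auto
  have main: "\<exists>a b. a \<noteq> 0 \<and> b \<noteq> 0 \<and> (\<forall>v\<in>tangent_space A q. ya \<bullet> df q v = a * \<eta> q v \<and> yb \<bullet> df q v = b * \<eta> q v)"
    if q: "q \<in> W" for q
  proof -
    have qc: "q \<in> fst c" using q by (simp add: c_def)
    have "ya \<bullet> df q v = 0" if "v \<in> eigdist 1 q" for v
      by (rule eigdist_orthogonal_in_ball[OF c, of 1]) (use ya(3) qc that in auto)
    then obtain a where "a \<noteq> 0" "\<And>v. v \<in> tangent_space A q \<Longrightarrow> ya \<bullet> df q v = a * \<eta> q v"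
      using conormal_df[OF ya(1,2), of q] by auto
    moreover have "yb \<bullet> df q v = 0" if "v \<in> eigdist (-1) q" for v
      by (rule eigdist_orthogonal_in_ball[OF c, of "-1"]) (use yb(3) qc that in auto)
    then obtain b where "b \<noteq> 0" "\<And>v. v \<in> tangent_space A q \<Longrightarrow> yb \<bullet> df q v = b * \<eta> q v"
      using conormal_df[OF yb(1,2), of q] by auto
    ultimately show ?thesis by blast
  qed
  show thesis
  proof (rule that)
    show "open W" using open_dom[OF c(1)] by (simp add: c_def)
    show "\<exists>v\<in>tangent_space A q. ya \<bullet> df q v \<noteq> 0" if "q \<in> W" for q
      using main[OF that] xi[of q] by force
    show "\<exists>l. l \<noteq> 0 \<and> (\<forall>v\<in>tangent_space A q. yb \<bullet> df q v = l * (ya \<bullet> df q v))" if q: "q \<in> W" for q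
    proof -
      obtain a b where ab: "a \<noteq> 0" "b \<noteq> 0" "\<forall>v\<in>tangent_space A q. ya \<bullet> df q v = a * \<eta> q v \<and> yb \<bullet> df q v = b * \<eta> q v"
        using main[OF q] by blast
      then have "b / a \<noteq> 0 \<and> (\<forall>v\<in>tangent_space A q. yb \<bullet> df q v = (b / a) * (ya \<bullet> df q v))" by simp
      then show ?thesis by blast
    qed
  qed (use W ya yb in auto)
qed

end

subsection \<open>Coordinates adapted to the eigendistributions\<close>

lemma subspace_paraJ_eig: "subspace {z. paraJ z = \<sigma> *\<^sub>R z}"
  by (rule subspaceI) (auto simp: paraJ_simps algebra_simps)

text \<open>The eigenspace is the graph of multiplication by \<sigma>.\<close>

lemma dim_paraJ_eig:
  assumes "\<sigma> * \<sigma> = 1"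
  shows "dim {z::'k::finite pspace. paraJ z = \<sigma> *\<^sub>R z} = CARD('k)"
proof -
  define L :: "real ^ 'k \<Rightarrow> 'k pspace" where "L x = (x, \<sigma> *\<^sub>R x)" for x
  have lin: "linear L" unfolding L_def by (rule linearI) (auto simp: algebra_simps)
  have "inj L" unfolding L_def by (rule injI) simp
  have "{z. paraJ z = \<sigma> *\<^sub>R z} = range L"
  proof (intro equalityI subsetI)
    fix z assume "z \<in> {z::'k pspace. paraJ z = \<sigma> *\<^sub>R z}"
    then have "paraJ z = \<sigma> *\<^sub>R z" by simp
    from arg_cong[OF this, of fst] have "snd z = \<sigma> *\<^sub>R fst z" by (simp add: paraJ_def)
    then have "z = L (fst z)" unfolding L_def by (metis prod.collapse)
    then show "z \<in> range L" by blast
  qed (use assms in \<open>auto simp: L_def paraJ_def\<close>)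
  then show ?thesis using dim_image_eq[OF lin, of UNIV] \<open>inj L\<close> by simp
qed

text \<open>An orthonormal basis of the orthogonal complement of \<open>y\<close> in an eigenspace
  of dimension n+1. The last property is completeness, phrased so that a vector can be shown to
  vanish by its inner products.\<close>

lemma eig_frame:
  fixes y :: "'k::finite pspace"
  assumes \<sigma>: "\<sigma> * \<sigma> = 1" and y: "paraJ y = \<sigma> *\<^sub>R y" "y \<noteq> 0" and card: "CARD('k) = n + 1"
  obtains b :: "nat \<Rightarrow> 'k pspace" where
    "\<And>i. i \<in> {1..n} \<Longrightarrow> paraJ (b i) = \<sigma> *\<^sub>R b i" "\<And>i. i \<in> {1..n} \<Longrightarrow> b i \<bullet> y = 0"
    "\<And>i j. i \<in> {1..n} \<Longrightarrow> j \<in> {1..n} \<Longrightarrow> b i \<bullet> b j = (if i = j then 1 else 0)"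
    "\<And>z. paraJ z = \<sigma> *\<^sub>R z \<Longrightarrow> z \<bullet> y = 0 \<Longrightarrow> (\<And>i. i \<in> {1..n} \<Longrightarrow> z \<bullet> b i = 0) \<Longrightarrow> z = 0"
proof -
  define E where "E = {z::'k pspace. paraJ z = \<sigma> *\<^sub>R z}"
  define S where "S = {z\<in>E. \<forall>x\<in>span {y}. orthogonal x z}"
  have E: "subspace E" unfolding E_def by (rule subspace_paraJ_eig)
  have S: "subspace S" unfolding S_def by (rule subspaceI)
    (use E in \<open>auto simp: orthogonal_clauses subspace_0 subspace_add subspace_scale\<close>)
  have "dim (span {y}) = 1" using y(2) by (simp add: dim_singleton)
  moreover have "span {y} \<subseteq> E" by (rule span_minimal[OF _ E]) (use y in \<open>simp add: E_def\<close>)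
  ultimately have "dim S + 1 = n + 1"
    using dim_subspace_orthogonal_to_vectors[OF subspace_span E, of "{y}"] dim_paraJ_eig[OF \<sigma>, where 'k = 'k] card
    by (simp add: S_def E_def)
  then have dimS: "dim S = n" by simp
  obtain B where B: "B \<subseteq> S" "pairwise orthogonal B" "\<And>x. x \<in> B \<Longrightarrow> norm x = 1"
    "independent B" "card B = dim S" "span B = S"
    using orthonormal_basis_subspace[OF S] by metis
  obtain b where b: "bij_betw b {1..n} B"
    using ex_bij_betw_nat_finite_1[of B] B(4,5) dimS independent_imp_finite by metis
  have bB: "b i \<in> B" if "i \<in> {1..n}" for i using b that by (meson bij_betw_apply)
  have 1: "b i \<bullet> b j = (if i = j then 1 else 0)" if ij: "i \<in> {1..n}" "j \<in> {1..n}" for i j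
  proof (cases "i = j")
    case True
    then show ?thesis using B(3)[OF bB[OF ij(1)]] by (simp add: norm_eq_1)
  next
    case False
    then have "b i \<noteq> b j" using b ij by (meson bij_betw_def inj_onD)
    then show ?thesis using B(2) bB ij False by (simp add: pairwise_def orthogonal_def)
  qed
  have 2: "z = 0" if z: "paraJ z = \<sigma> *\<^sub>R z" "z \<bullet> y = 0" "\<And>i. i \<in> {1..n} \<Longrightarrow> z \<bullet> b i = 0" for z
  proof -
    have "orthogonal x z" if "x \<in> span {y}" for x
      using that z(2) by (auto simp: span_singleton orthogonal_def inner_commute)
    then have "z \<in> span B" unfolding B(6) S_def E_def using z(1) by blast
    moreover have "orthogonal z x" if "x \<in> B" for x
      using b that z(3) by (auto simp: orthogonal_def bij_betw_def)
    ultimately have "orthogonal z z" using orthogonal_to_span by blast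
    then show ?thesis by (simp add: orthogonal_def)
  qed
  have 3: "paraJ (b i) = \<sigma> *\<^sub>R b i \<and> b i \<bullet> y = 0" if "i \<in> {1..n}" for i
    using bB[OF that] B(1) span_base[of y "{y}"] by (auto simp: S_def E_def orthogonal_def inner_commute)
  show thesis by (rule that[OF conjunct1[OF 3] conjunct2[OF 3] 1 2])
qed

text \<open>The bases of the two eigenspaces are orthogonal to each other and can be concatenated.
  Completeness is tested separately on z + J z and z - J z.\<close>

lemma adapted_frame:
  fixes ya yb :: "'k::finite pspace"
  assumes "paraJ ya = ya" "paraJ yb = - yb" "ya \<noteq> 0" "yb \<noteq> 0" and card: "CARD('k) = n + 1"
  obtains b :: "nat \<Rightarrow> 'k pspace" where
    "\<And>i. i \<in> {1..n} \<Longrightarrow> paraJ (b i) = b i" "\<And>i. i \<in> {n+1..2*n} \<Longrightarrow> paraJ (b i) = - b i"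
    "\<And>i j. i \<in> {1..2*n} \<Longrightarrow> j \<in> {1..2*n} \<Longrightarrow> b i \<bullet> b j = (if i = j then 1 else 0)"
    "\<And>i. i \<in> {1..2*n} \<Longrightarrow> b i \<bullet> ya = 0" "\<And>i. i \<in> {1..2*n} \<Longrightarrow> b i \<bullet> yb = 0"
    "\<And>z. (\<And>i. i \<in> {1..2*n} \<Longrightarrow> z \<bullet> b i = 0) \<Longrightarrow> z \<bullet> ya = 0 \<Longrightarrow> z \<bullet> yb = 0 \<Longrightarrow> z = 0"
proof -
  obtain g where g: "\<And>i. i \<in> {1..n} \<Longrightarrow> paraJ (g i) = g i" "\<And>i. i \<in> {1..n} \<Longrightarrow> g i \<bullet> ya = 0"
    "\<And>i j. i \<in> {1..n} \<Longrightarrow> j \<in> {1..n} \<Longrightarrow> g i \<bullet> g j = (if i = j then 1 else 0)"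
    "\<And>z. paraJ z = z \<Longrightarrow> z \<bullet> ya = 0 \<Longrightarrow> (\<And>i. i \<in> {1..n} \<Longrightarrow> z \<bullet> g i = 0) \<Longrightarrow> z = 0"
    using eig_frame[of 1 ya n] assms by auto
  obtain h where h: "\<And>i. i \<in> {1..n} \<Longrightarrow> paraJ (h i) = - h i" "\<And>i. i \<in> {1..n} \<Longrightarrow> h i \<bullet> yb = 0"
    "\<And>i j. i \<in> {1..n} \<Longrightarrow> j \<in> {1..n} \<Longrightarrow> h i \<bullet> h j = (if i = j then 1 else 0)"
    "\<And>z. paraJ z = - z \<Longrightarrow> z \<bullet> yb = 0 \<Longrightarrow> (\<And>i. i \<in> {1..n} \<Longrightarrow> z \<bullet> h i = 0) \<Longrightarrow> z = 0"
    using eig_frame[of "-1" yb n] assms by auto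
  have opp: "u \<bullet> w = 0" if "paraJ u = u" "paraJ w = - w" for u w :: "'k pspace"
    using paraJ_inner[of u w] that by simp
  define b where "b i = (if i \<le> n then g i else h (i - n))" for i
  have split: "(i \<in> {1..n} \<and> b i = g i) \<or> (i - n \<in> {1..n} \<and> \<not> i \<le> n \<and> b i = h (i - n))"
    if "i \<in> {1..2*n}" for i
  proof (cases "i \<le> n")
    case False
    then have "i - n \<in> {1..n}" using that by auto
    then show ?thesis using False by (simp add: b_def)
  qed (use that in \<open>simp add: b_def\<close>)
  show thesis
  proof (rule that[of b])
    show "paraJ (b i) = b i" if "i \<in> {1..n}" for i using g(1)[OF that] that by (simp add: b_def)
    show "paraJ (b i) = - b i" if "i \<in> {n+1..2*n}" for i
    proof -
      have "i - n \<in> {1..n}" "\<not> i \<le> n" using that by auto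
      then show ?thesis using h(1) by (simp add: b_def)
    qed
    show "b i \<bullet> ya = 0" if i: "i \<in> {1..2*n}" for i
      using split[OF i] g(2)[of i] opp[OF assms(1) h(1), of "i - n"] by (auto simp: inner_commute)
    show "b i \<bullet> yb = 0" if i: "i \<in> {1..2*n}" for i
      using split[OF i] h(2)[of "i - n"] opp[OF g(1) assms(2), of i] by auto
    show "b i \<bullet> b j = (if i = j then 1 else 0)" if i: "i \<in> {1..2*n}" and j: "j \<in> {1..2*n}" for i j
      using split[OF i] split[OF j]
    proof (elim disjE conjE)
      assume "i \<in> {1..n}" "b i = g i" "j - n \<in> {1..n}" "\<not> j \<le> n" "b j = h (j - n)"
      then show ?thesis using opp[OF g(1) h(1), of i "j - n"] by auto
    next
      assume "j \<in> {1..n}" "b j = g j" "i - n \<in> {1..n}" "\<not> i \<le> n" "b i = h (i - n)"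
      then show ?thesis using opp[OF g(1) h(1), of j "i - n"] by (auto simp: inner_commute)
    next
      assume "i - n \<in> {1..n}" "\<not> i \<le> n" "b i = h (i - n)" "j - n \<in> {1..n}" "\<not> j \<le> n" "b j = h (j - n)"
      then show ?thesis using h(3)[of "i - n" "j - n"] by auto
    qed (use g(3) in simp)
    show "z = 0" if z: "\<And>i. i \<in> {1..2*n} \<Longrightarrow> z \<bullet> b i = 0" "z \<bullet> ya = 0" "z \<bullet> yb = 0" for z
    proof -
      define zp where "zp = z + paraJ z"
      define zm where "zm = z - paraJ z"
      have J: "paraJ zp = zp" "paraJ zm = - zm" by (simp_all add: zp_def zm_def paraJ_simps add.commute)
      have "zp \<bullet> ya = 0" using paraJ_inner[of z ya] z assms by (simp add: zp_def inner_add_left)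
      moreover have "zp \<bullet> g i = 0" if i: "i \<in> {1..n}" for i
        using paraJ_inner[of z "g i"] z(1)[of i] g(1)[OF i] i by (simp add: zp_def inner_add_left b_def)
      ultimately have "zp = 0" using g(4)[OF J(1)] by blast
      have "zm \<bullet> yb = 0" using paraJ_inner[of z yb] z assms by (simp add: zm_def inner_diff_left)
      moreover have "zm \<bullet> h i = 0" if i: "i \<in> {1..n}" for i
        using paraJ_inner[of z "h i"] z(1)[of "i + n"] h(1)[OF i] i by (simp add: zm_def inner_diff_left b_def)
      ultimately have "zm = 0" using h(4)[OF J(2)] by blast
      have "2 *\<^sub>R z = zp + zm" by (simp add: zp_def zm_def scaleR_2)
      then show "z = 0" using \<open>zp = 0\<close> \<open>zm = 0\<close> by simp
    qed
  qed
qed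

text \<open>Intermediate value theorem. The sign is returned as a factor \<epsilon> so that both
  cases can share the square root of \<epsilon>\<gamma> later.\<close>

lemma constant_sign:
  fixes \<gamma> :: "real \<Rightarrow> real"
  assumes "continuous_on {a<..<b} \<gamma>" "\<And>s. s \<in> {a<..<b} \<Longrightarrow> \<gamma> s \<noteq> 0"
  obtains \<epsilon> where "\<epsilon> * \<epsilon> = 1" "\<And>s. s \<in> {a<..<b} \<Longrightarrow> \<epsilon> * \<gamma> s > 0"
proof (cases "\<exists>s\<in>{a<..<b}. \<gamma> s > 0")
  case True
  then obtain s0 where s0: "s0 \<in> {a<..<b}" "\<gamma> s0 > 0" by blast
  have conn: "connected (\<gamma> ` {a<..<b})" by (rule connected_continuous_image[OF assms(1)]) simp
  have "\<gamma> s > 0" if "s \<in> {a<..<b}" for s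
  proof (rule ccontr)
    assume "\<not> \<gamma> s > 0"
    then have "0 \<in> \<gamma> ` {a<..<b}"
      using connectedD_interval[OF conn imageI[OF that] imageI[OF s0(1)], of 0] s0(2) by simp
    then show False using assms(2) by force
  qed
  then show thesis using that[of 1] by simp
next
  case False
  then have "- 1 * \<gamma> s > 0" if "s \<in> {a<..<b}" for s using assms(2)[OF that] that by force
  then show thesis using that[of "-1"] by simp
qed

section \<open>Charts built from inner products with an adapted frame\<close>

locale framed_hypersurface = para_hypersurface n A f
  for n and A :: "('m::{t2_space, second_countable_topology}, 'd::finite) chart set"
    and f :: "'m \<Rightarrow> 'k::finite pspace" +
  fixes ya yb :: "'k pspace" and b :: "nat \<Rightarrow> 'k pspace" and e :: "nat \<Rightarrow> 'd"
  assumes J_ya: "paraJ ya = ya" and J_yb: "paraJ yb = - yb"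
    and J_b_plus: "\<And>i. i \<in> {1..n} \<Longrightarrow> paraJ (b i) = b i"
    and J_b_minus: "\<And>i. i \<in> {n+1..2*n} \<Longrightarrow> paraJ (b i) = - b i"
    and b_ortho: "\<And>i j. i \<in> {1..2*n} \<Longrightarrow> j \<in> {1..2*n} \<Longrightarrow> b i \<bullet> b j = (if i = j then 1 else 0)"
    and b_ya: "\<And>i. i \<in> {1..2*n} \<Longrightarrow> b i \<bullet> ya = 0"
    and b_yb: "\<And>i. i \<in> {1..2*n} \<Longrightarrow> b i \<bullet> yb = 0"
    and frame_complete: "\<And>z. (\<And>i. i \<in> {1..2*n} \<Longrightarrow> z \<bullet> b i = 0) \<Longrightarrow> z \<bullet> ya = 0 \<Longrightarrow> z \<bullet> yb = 0 \<Longrightarrow> z = 0"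
    and e_bij: "bij_betw e {1..2*n+1} UNIV"
begin

definition last_ix :: 'd where "last_ix = e (2 * n + 1)"

definition idx :: "'d \<Rightarrow> nat" where "idx k = inv_into {1..2*n+1} e k"

lemma idx_e: "i \<in> {1..2*n+1} \<Longrightarrow> idx (e i) = i"
  unfolding idx_def using e_bij by (meson bij_betw_inv_into_left)

lemma e_idx: "e (idx k) = k"
  unfolding idx_def using e_bij by (meson UNIV_I bij_betw_inv_into_right)

lemma idx_range: "k \<noteq> last_ix \<Longrightarrow> idx k \<in> {1..2*n}"
proof -
  assume "k \<noteq> last_ix"
  moreover have "idx k \<in> {1..2*n+1}"
    unfolding idx_def by (rule inv_into_into) (use e_bij in \<open>auto simp: bij_betw_def\<close>)
  ultimately show ?thesis using e_idx[of k] by (cases "idx k = 2 * n + 1") (auto simp: last_ix_def)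
qed

lemma e_neq_last: "i \<in> {1..2*n} \<Longrightarrow> e i \<noteq> last_ix"
  using idx_e[of i] idx_e[of "2 * n + 1"] by (auto simp: last_ix_def)

text \<open>\<open>T\<close> is the freedom to reparametrise the curve factor. It is the identity
  while \<gamma> is being found and an antiderivative of the square root of \<epsilon>\<gamma> in
  the final chart.\<close>

definition coords :: "(real \<Rightarrow> real) \<Rightarrow> 'm \<Rightarrow> real ^ 'd" where
  "coords T q = (\<chi> k. if k = last_ix then T (f q \<bullet> ya) else f q \<bullet> b (idx k))"

lemma smooth_inner:
  assumes c: "c \<in> A"
  shows "smooth_on (snd c ` fst c) (\<lambda>x. f (inv_chart c x) \<bullet> z)"
  using smooth_on_linear[OF bounded_linear_inner_left smooth_map_onD[OF smooth_f c], of z]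
    open_image[OF c] by (simp add: comp_def)

lemma smooth_coords:
  assumes "open U" "smooth_on I T" "\<And>q. q \<in> U \<Longrightarrow> f q \<bullet> ya \<in> I"
  shows "smooth_map_on A U (coords T)"
  unfolding smooth_map_on_def
proof
  fix c assume c: "c \<in> A"
  define S where "S = snd c ` (fst c \<inter> U)"
  have S: "open S" "S \<subseteq> snd c ` fst c"
    unfolding S_def using open_chart_image[OF c assms(1)] by auto
  have i: "smooth_on S (\<lambda>x. f (inv_chart c x) \<bullet> z)" for z
    by (rule smooth_on_subset[OF smooth_inner[OF c] S(2)])
  have "smooth_on S (\<lambda>x. T (f (inv_chart c x) \<bullet> ya))"
    by (rule smooth_on_compose[OF assms(2) i _ S(1)])
      (use assms(3) c in \<open>auto simp: S_def inv_chart_left\<close>)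
  then have "smooth_on S (\<lambda>x. coords T (inv_chart c x) $ k)" for k
    using i by (cases "k = last_ix") (simp_all add: coords_def)
  then show "smooth_on (snd c ` (fst c \<inter> U)) (coords T \<circ> inv_chart c)"
    unfolding S_def[symmetric] by (intro smooth_on_vec S(1)) simp
qed

lemma frechet_coords:
  assumes c: "c \<in> A" "q \<in> fst c" and T: "(T has_real_derivative T') (at (f q \<bullet> ya))"
    and d: "(coords T \<circ> inv_chart c has_derivative D) (at (snd c q))"
  shows "D u $ k = (if k = last_ix
    then T' * (frechet_derivative (f \<circ> inv_chart c) (at (snd c q)) u \<bullet> ya)
    else frechet_derivative (f \<circ> inv_chart c) (at (snd c q)) u \<bullet> b (idx k))"
proof -
  let ?F' = "frechet_derivative (f \<circ> inv_chart c) (at (snd c q))"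
  have inner: "((\<lambda>x. f (inv_chart c x) \<bullet> z) has_derivative (\<lambda>u. ?F' u \<bullet> z)) (at (snd c q))" for z
    using bounded_linear.has_derivative[OF bounded_linear_inner_left
        smooth_map_on_has_derivative[OF smooth_f UNIV_I c], of z] by (simp add: comp_def)
  have "((\<lambda>x. T (f (inv_chart c x) \<bullet> ya)) has_derivative (\<lambda>u. T' * (?F' u \<bullet> ya))) (at (snd c q))"
    by (rule has_derivative_compose[OF inner]) (use T c in \<open>simp add: inv_chart_left has_field_derivative_def\<close>)
  then have 1: "((\<lambda>x. (coords T \<circ> inv_chart c) x $ k) has_derivative
      (\<lambda>u. if k = last_ix then T' * (?F' u \<bullet> ya) else ?F' u \<bullet> b (idx k))) (at (snd c q))"
    using inner by (cases "k = last_ix") (simp_all add: coords_def)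
  have 2: "((\<lambda>x. (coords T \<circ> inv_chart c) x $ k) has_derivative (\<lambda>u. D u $ k)) (at (snd c q))"
    by (rule bounded_linear.has_derivative[OF bounded_linear_vec_nth d])
  from fun_cong[OF has_derivative_unique[OF 2 1], of u] show ?thesis .
qed

text \<open>The differential is injective: a vector in its kernel has an image orthogonal to all
  \<open>b i\<close> and, as \<open>T'\<close> is nonzero, to \<open>ya\<close>; proportionality of
  the conormals adds \<open>yb\<close>, and the frame is complete.\<close>

lemma coords_chart:
  assumes U: "open U" "p \<in> U" and T: "smooth_on I T" "\<And>q. q \<in> U \<Longrightarrow> f q \<bullet> ya \<in> I"
    and T': "(T has_real_derivative T') (at (f p \<bullet> ya))" "T' \<noteq> 0"
    and l: "\<And>v. v \<in> tangent_space A p \<Longrightarrow> yb \<bullet> df p v = l * (ya \<bullet> df p v)"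
  obtains W r where "(W, coords T) \<in> A" "p \<in> W" "W \<subseteq> U" "r > 0" "coords T ` W = ball (coords T p) r"
proof -
  obtain c where c: "c \<in> A" "p \<in> fst c" by (rule chart_exists)
  let ?F' = "frechet_derivative (f \<circ> inv_chart c) (at (snd c p))"
  let ?D = "frechet_derivative (coords T \<circ> inv_chart c) (at (snd c p))"
  have sm: "smooth_map_on A U (coords T)" by (rule smooth_coords[OF U(1) T])
  have D: "(coords T \<circ> inv_chart c has_derivative ?D) (at (snd c p))"
    by (rule smooth_map_on_has_derivative[OF sm U(2) c])
  have "u = 0" if "?D u = 0" for u
  proof -
    have F'u: "?F' u = df p (tvec_at A c p u)" using tderiv_tvec_at[OF smooth_f UNIV_I c] by simp
    have comp: "(if k = last_ix then T' * (?F' u \<bullet> ya) else ?F' u \<bullet> b (idx k)) = 0" for k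
      using frechet_coords[OF c T'(1) D, of u k] that by simp
    have "?F' u \<bullet> b i = 0" if "i \<in> {1..2*n}" for i
      using comp[of "e i"] e_neq_last[OF that] idx_e[of i] that by simp
    moreover have ya0: "?F' u \<bullet> ya = 0" using comp[of last_ix] T'(2) by simp
    moreover have "?F' u \<bullet> yb = 0"
      using l[OF tvec_at_tangent[OF c], of u] ya0 unfolding F'u by (simp add: inner_commute)
    ultimately have "?F' u = 0" by (rule frame_complete)
    then show "u = 0" using inj_frechet_f[OF c] linear_frechet_f[OF c] by (metis injD linear_0)
  qed
  then have "inj ?D" using has_derivative_linear[OF D] by (simp add: linear_injective_0)
  from new_chart[OF c U sm this] show thesis using that by metis
qed

text \<open>Read in its own chart the map \<open>coords T\<close> is the identity, so
  \<open>frechet_coords\<close> can be compared with the components of \<open>u\<close>.\<close>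

lemma coords_chart_frechet:
  assumes c: "(W, coords T) \<in> A" and q: "q \<in> W" and T: "(T has_real_derivative T') (at (f q \<bullet> ya))"
  defines "F' \<equiv> frechet_derivative (f \<circ> inv_chart (W, coords T)) (at (coords T q))"
  shows "k \<noteq> last_ix \<Longrightarrow> F' u \<bullet> b (idx k) = u $ k" and "T' * (F' u \<bullet> ya) = u $ last_ix"
proof -
  let ?c = "(W, coords T)"
  have "(coords T \<circ> inv_chart ?c has_derivative (\<lambda>u. u)) (at (coords T q))"
    by (rule has_derivative_transform_within_open[OF has_derivative_ident open_image[OF c]])
      (use inv_chart_right[OF c] q in auto)
  then have "u $ k = (if k = last_ix then T' * (F' u \<bullet> ya) else F' u \<bullet> b (idx k))" for k
    unfolding F'_def using frechet_coords[OF c _ T, of "\<lambda>u. u" u k] q by simp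
  from this[of k] this[of last_ix]
  show "k \<noteq> last_ix \<Longrightarrow> F' u \<bullet> b (idx k) = u $ k" "T' * (F' u \<bullet> ya) = u $ last_ix" by simp_all
qed

lemma df_coords_chart:
  assumes "(W, coords T) \<in> A" "q \<in> W"
  shows "frechet_derivative (f \<circ> inv_chart (W, coords T)) (at (coords T q)) u = df q (tvec_at A (W, coords T) q u)"
  using tderiv_tvec_at[OF smooth_f UNIV_I assms(1), of q u] assms(2) by simp

text \<open>In the chart with last coordinate \<open>f \<bullet> ya\<close>, the function \<open>f \<bullet> yb\<close> depends on that coordinate only,
  and \<open>\<gamma>\<close> is its derivative.\<close>

lemma conormal_ratio:
  assumes W: "open W" "p \<in> W"
    and ratio: "\<And>q. q \<in> W \<Longrightarrow> \<exists>l. l \<noteq> 0 \<and> (\<forall>v\<in>tangent_space A q. yb \<bullet> df q v = l * (ya \<bullet> df q v))"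
  obtains U r \<gamma> where "open U" "p \<in> U" "r > 0" "smooth_on {f p \<bullet> ya - r<..<f p \<bullet> ya + r} \<gamma>"
    "\<And>s. s \<in> {f p \<bullet> ya - r<..<f p \<bullet> ya + r} \<Longrightarrow> \<gamma> s \<noteq> 0"
    "\<And>q. q \<in> U \<Longrightarrow> f q \<bullet> ya \<in> {f p \<bullet> ya - r<..<f p \<bullet> ya + r}"
    "\<And>q v. q \<in> U \<Longrightarrow> v \<in> tangent_space A q \<Longrightarrow> yb \<bullet> df q v = \<gamma> (f q \<bullet> ya) * (ya \<bullet> df q v)"
proof -
  obtain l where l: "\<And>q. q \<in> W \<Longrightarrow> l q \<noteq> 0"
    "\<And>q v. q \<in> W \<Longrightarrow> v \<in> tangent_space A q \<Longrightarrow> yb \<bullet> df q v = l q * (ya \<bullet> df q v)"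
    using ratio by metis
  have id: "((\<lambda>s. s) has_real_derivative 1) (at s)" for s :: real by (rule DERIV_ident)
  obtain U r where U: "(U, coords (\<lambda>s. s)) \<in> A" "p \<in> U" "U \<subseteq> W" and r: "r > 0"
    and ball: "coords (\<lambda>s. s) ` U = ball (coords (\<lambda>s. s) p) r"
    by (rule coords_chart[OF W smooth_on_ident[OF open_UNIV] UNIV_I id _ l(2)[OF W(2)]]) auto
  define c where "c = (U, coords (\<lambda>s. s))"
  have c: "c \<in> A" "fst c = U" "snd c = coords (\<lambda>s. s)" using U by (simp_all add: c_def)
  define x0 where "x0 = coords (\<lambda>s. s) p"
  define F' where "F' x = frechet_derivative (f \<circ> inv_chart c) (at x)" for x
  define G where "G x = f (inv_chart c x) \<bullet> yb" for x
  have img: "snd c ` fst c = ball x0 r" using ball c x0_def by simp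
  have last: "x $ last_ix = f (inv_chart c x) \<bullet> ya" if "x \<in> ball x0 r" for x
  proof -
    have "snd c (inv_chart c x) = x" by (rule inv_chart_right[OF c(1)]) (simp only: img that)
    then have "coords (\<lambda>s. s) (inv_chart c x) = x" by (simp only: c(3))
    from arg_cong[OF this, of "\<lambda>x. x $ last_ix"] show ?thesis by (simp add: coords_def)
  qed
  have x0_last: "x0 $ last_ix = f p \<bullet> ya" by (simp add: x0_def coords_def)
  have Gs: "smooth_on (ball x0 r) G" unfolding G_def[abs_def] using smooth_inner[OF c(1)] img by simp
  \<comment> \<open>\<open>l\<close> is a mere pointwise choice without known regularity. This
    identifies it as the partial derivative of \<open>G\<close> in the last coordinate and shows
    that the other partial derivatives vanish.\<close>
  have DG: "frechet_derivative G (at x) u = l (inv_chart c x) * u $ last_ix"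
    and inU: "inv_chart c x \<in> U" if x: "x \<in> ball x0 r" for x u
  proof -
    define q where "q = inv_chart c x"
    have q: "q \<in> U" "coords (\<lambda>s. s) q = x"
      using inv_chart_right[OF c(1)] inv_chart_dom[OF c(1)] x img c unfolding q_def by auto
    show "inv_chart c x \<in> U" using q q_def by simp
    have "(f \<circ> inv_chart c has_derivative F' x) (at x)"
      using smooth_map_on_has_derivative[OF smooth_f UNIV_I c(1), of q] q c by (simp add: F'_def)
    from bounded_linear.has_derivative[OF bounded_linear_inner_left this, of yb]
    have "(G has_derivative (\<lambda>u. F' x u \<bullet> yb)) (at x)" by (simp add: G_def[abs_def] comp_def)
    then have "frechet_derivative G (at x) u = F' x u \<bullet> yb" using frechet_derivative_at by metis
    also have "\<dots> = yb \<bullet> df q (tvec_at A c q u)"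
      using df_coords_chart[OF U(1) q(1), of u] q(2) by (simp add: F'_def c_def inner_commute)
    also have "\<dots> = l q * (ya \<bullet> df q (tvec_at A c q u))"
      using l(2) q U(3) tvec_at_tangent[OF c(1)] c(2) by blast
    also have "ya \<bullet> df q (tvec_at A c q u) = F' x u \<bullet> ya"
      using df_coords_chart[OF U(1) q(1), of u] q(2) by (simp add: F'_def c_def inner_commute)
    also have "F' x u \<bullet> ya = u $ last_ix"
      using coords_chart_frechet(2)[OF U(1) q(1) id, of u] q(2) by (simp add: F'_def c_def)
    finally show "frechet_derivative G (at x) u = l (inv_chart c x) * u $ last_ix" by (simp add: q_def)
  qed
  define a where "a = (axis last_ix 1 :: real ^ 'd)"
  have a: "a $ last_ix = 1" "norm a = 1" by (simp_all add: a_def)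
  define I where "I = {f p \<bullet> ya - r<..<f p \<bullet> ya + r}"
  \<comment> \<open>The point with last coordinate \<open>s\<close> whose other coordinates are
    those of \<open>x0\<close>; it stays in the ball for \<open>s\<close> in
    \<open>I\<close>.\<close>
  define line where "line s = x0 + (s - x0 $ last_ix) *\<^sub>R a" for s
  have line: "line s \<in> ball x0 r" if "s \<in> I" for s
    using that a by (auto simp: line_def I_def dist_norm x0_last)
  define \<gamma> where "\<gamma> s = frechet_derivative G (at (line s)) a" for s
  have line_smooth: "smooth_on I line"
    unfolding line_def[abs_def]
  proof (rule smooth_onI_deriv)
    show "((\<lambda>s. x0 + (s - x0 $ last_ix) *\<^sub>R a) has_derivative (\<lambda>v. v *\<^sub>R a)) (at s)" for s
      by (auto intro!: derivative_eq_intros)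
  qed (auto simp: I_def)
  have smooth: "smooth_on I \<gamma>"
    unfolding \<gamma>_def[abs_def]
    by (rule smooth_on_compose[OF smooth_on_frechet[OF Gs] line_smooth]) (use line in \<open>auto simp: I_def\<close>)
  have nz: "\<gamma> s \<noteq> 0" if "s \<in> I" for s
    unfolding \<gamma>_def DG[OF line[OF that]] using l(1) inU[OF line[OF that]] U(3) a by auto
  have lastI: "x $ last_ix \<in> I" if "x \<in> ball x0 r" for x
  proof -
    have "\<bar>(x - x0) $ last_ix\<bar> < r"
      using component_le_norm_cart[of "x - x0" last_ix] that by (simp add: dist_norm norm_minus_commute)
    then show ?thesis by (auto simp: I_def x0_last)
  qed
  \<comment> \<open>The segment from \<open>x\<close> to \<open>line (x $ last_ix)\<close> fixes the
    last coordinate and lies in the convex ball; by \<open>DG\<close> the derivative of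
    \<open>G\<close> along it is zero.\<close>
  have const: "G x = G (line (x $ last_ix))" if x: "x \<in> ball x0 r" for x
  proof -
    define d where "d = line (x $ last_ix) - x"
    have d: "d $ last_ix = 0" by (simp add: d_def line_def a)
    have seg: "x + t *\<^sub>R d \<in> ball x0 r" if "t \<in> {0..1}" for t
    proof -
      have "x + t *\<^sub>R d = (1 - t) *\<^sub>R x + t *\<^sub>R line (x $ last_ix)" by (simp add: d_def algebra_simps)
      then show ?thesis
        using convexD[OF convex_ball x line[OF lastI[OF x]], of "1 - t" t] that by auto
    qed
    have "\<exists>k. \<forall>t\<in>{0..1}. G (x + t *\<^sub>R d) = k"
    proof (rule has_derivative_zero_constant)
      fix t :: real assume t: "t \<in> {0..1}"
      have "((\<lambda>t. x + t *\<^sub>R d) has_derivative (\<lambda>h. h *\<^sub>R d)) (at t)"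
        by (auto intro!: derivative_eq_intros)
      from has_derivative_compose[OF this smooth_on_has_derivative[OF Gs seg[OF t]]]
      have "((\<lambda>t. G (x + t *\<^sub>R d)) has_derivative (\<lambda>h. 0)) (at t)"
        by (simp add: DG[OF seg[OF t]] d)
      then show "((\<lambda>t. G (x + t *\<^sub>R d)) has_derivative (\<lambda>h. 0)) (at t within {0..1})"
        by (rule has_derivative_at_withinI)
    qed simp
    then obtain k where k: "\<And>t. t \<in> {0..1} \<Longrightarrow> G (x + t *\<^sub>R d) = k" by blast
    show ?thesis using k[of 0] k[of 1] by (simp add: d_def)
  qed
  \<comment> \<open>Differentiating \<open>const\<close> expresses the partial derivative of
    \<open>G\<close>, which is \<open>l\<close>, through the last coordinate alone.\<close>
  have gam: "l (inv_chart c x) = \<gamma> (x $ last_ix)" if x: "x \<in> ball x0 r" for x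
  proof -
    have "((\<lambda>x. x $ last_ix) has_derivative (\<lambda>u. u $ last_ix)) (at x)"
      by (rule bounded_linear_imp_has_derivative[OF bounded_linear_vec_nth])
    moreover have "(line has_derivative (\<lambda>v. v *\<^sub>R a)) (at (x $ last_ix))"
      unfolding line_def[abs_def] by (auto intro!: derivative_eq_intros)
    ultimately have "((\<lambda>x. line (x $ last_ix)) has_derivative (\<lambda>u. u $ last_ix *\<^sub>R a)) (at x)"
      by (rule has_derivative_compose)
    from has_derivative_compose[OF this smooth_on_has_derivative[OF Gs line[OF lastI[OF x]]]]
    have "((\<lambda>x. G (line (x $ last_ix))) has_derivative
        (\<lambda>u. frechet_derivative G (at (line (x $ last_ix))) (u $ last_ix *\<^sub>R a))) (at x)" .
    then have "(G has_derivative
        (\<lambda>u. frechet_derivative G (at (line (x $ last_ix))) (u $ last_ix *\<^sub>R a))) (at x)"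
      by (rule has_derivative_transform_within_open[OF _ open_ball x]) (use const in simp)
    then have "frechet_derivative G (at x) a = \<gamma> (x $ last_ix)"
      unfolding \<gamma>_def using frechet_derivative_at by (metis (no_types, lifting) a(1) scaleR_one)
    then show ?thesis using DG[OF x, of a] a by simp
  qed
  show thesis
  proof (rule that[of U r \<gamma>])
    show "open U" using open_dom[OF c(1)] c by simp
    fix q assume q: "q \<in> U"
    then have x: "snd c q \<in> ball x0 r" using img c by auto
    have inv: "inv_chart c (snd c q) = q" using inv_chart_left[OF c(1)] q c by simp
    show "f q \<bullet> ya \<in> {f p \<bullet> ya - r<..<f p \<bullet> ya + r}" using lastI[OF x] last[OF x] inv I_def by simp
    fix v assume "v \<in> tangent_space A q"
    then show "yb \<bullet> df q v = \<gamma> (f q \<bullet> ya) * (ya \<bullet> df q v)"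
      using l(2) q U(3) gam[OF x] last[OF x] inv by auto
  qed (use U r smooth nz I_def in auto)
qed

text \<open>With last coordinate \<open>T (f q \<bullet> ya)\<close> and T' = \<tau>, the last
  coordinate field \<open>w\<close> has w \<bullet> ya = 1/\<tau> and w \<bullet> yb =
  \<gamma>/\<tau>. As \<tau>^2 = \<epsilon>\<gamma> and \<epsilon>^2 = 1, the product is \<epsilon>.
  The other coordinate fields annihilate \<open>ya\<close>, hence \<open>yb\<close>, and so agree
  with the constant vectors \<open>b i\<close>.\<close>

lemma flat_chart:
  assumes W: "open W" "p \<in> W"
    and ratio: "\<And>q. q \<in> W \<Longrightarrow> \<exists>l. l \<noteq> 0 \<and> (\<forall>v\<in>tangent_space A q. yb \<bullet> df q v = l * (ya \<bullet> df q v))"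
  obtains c \<epsilon> where "c \<in> A" "p \<in> fst c" "\<epsilon> \<noteq> 0"
    "\<And>q i. q \<in> fst c \<Longrightarrow> i \<in> {1..2*n} \<Longrightarrow> df q (tvec_at A c q (axis (e i) 1)) = b i"
    "\<And>q i. q \<in> fst c \<Longrightarrow> i \<in> {1..2*n} \<Longrightarrow> df q (tvec_at A c q (axis last_ix 1)) \<bullet> b i = 0"
    "\<And>q. q \<in> fst c \<Longrightarrow>
      (df q (tvec_at A c q (axis last_ix 1)) \<bullet> ya) * (df q (tvec_at A c q (axis last_ix 1)) \<bullet> yb) = \<epsilon>"
proof -
  define s0 where "s0 = f p \<bullet> ya"
  obtain U r \<gamma> where U: "open U" "p \<in> U" and r: "r > 0" and \<gamma>: "smooth_on {s0 - r<..<s0 + r} \<gamma>"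
    and nz: "\<And>s. s \<in> {s0 - r<..<s0 + r} \<Longrightarrow> \<gamma> s \<noteq> 0"
    and rat: "\<And>q v. q \<in> U \<Longrightarrow> v \<in> tangent_space A q \<Longrightarrow> yb \<bullet> df q v = \<gamma> (f q \<bullet> ya) * (ya \<bullet> df q v)"
    unfolding s0_def using conormal_ratio[OF W ratio] by metis
  obtain \<epsilon> where \<epsilon>: "\<epsilon> * \<epsilon> = 1" "\<And>s. s \<in> {s0 - r<..<s0 + r} \<Longrightarrow> \<epsilon> * \<gamma> s > 0"
    using constant_sign[OF smooth_on_imp_continuous_on[OF \<gamma>] nz] by blast
  define \<tau> where "\<tau> s = sqrt (\<epsilon> * \<gamma> s)" for s
  have "smooth_on {s0 - r<..<s0 + r} \<tau>"
    unfolding \<tau>_def[abs_def] by (intro smooth_on_sqrt smooth_on_linear[OF bounded_linear_mult_right] \<gamma> \<epsilon>(2)) auto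
  then obtain T where T: "smooth_on {s0 - r/2<..<s0 + r/2} T"
    "\<And>s. s \<in> {s0 - r/2<..<s0 + r/2} \<Longrightarrow> (T has_real_derivative \<tau> s) (at s)"
    using smooth_antiderivative[of "s0 - r" "s0 + r" \<tau> "s0 - r/2" "s0 + r/2"] r by auto
  have \<tau>: "\<tau> s > 0" "\<tau> s * \<tau> s = \<epsilon> * \<gamma> s" if "s \<in> {s0 - r/2<..<s0 + r/2}" for s
  proof -
    have "s \<in> {s0 - r<..<s0 + r}" using that r by auto
    from \<epsilon>(2)[OF this] show "\<tau> s > 0" "\<tau> s * \<tau> s = \<epsilon> * \<gamma> s" by (simp_all add: \<tau>_def)
  qed
  obtain c0 where c0: "c0 \<in> A" "p \<in> fst c0" by (rule chart_exists)
  \<comment> \<open>The points whose \<open>ya\<close>-component lies in the halved interval, where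
    \<open>T\<close> is defined. Openness is obtained through a chart because \<open>f\<close> is
    known to be smooth only in charts.\<close>
  define X where "X = snd c0 ` fst c0 \<inter> (\<lambda>x. f (inv_chart c0 x) \<bullet> ya) -` {s0 - r/2<..<s0 + r/2}"
  have "open X"
    unfolding X_def using continuous_on_open_vimage[OF open_image[OF c0(1)]]
      smooth_on_imp_continuous_on[OF smooth_inner[OF c0(1)]] by (metis Int_commute open_greaterThanLessThan)
  then have "open (inv_chart c0 ` X)"
    by (rule is_chart_open_inv_image[OF is_chart[OF c0(1)]]) (simp add: X_def)
  then have V: "open (U \<inter> inv_chart c0 ` X)" using U by blast
  have "p \<in> inv_chart c0 ` X"
    by (rule image_eqI[of _ _ "snd c0 p"]) (use c0 r in \<open>auto simp: X_def inv_chart_left s0_def\<close>)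
  then have pV: "p \<in> U \<inter> inv_chart c0 ` X" using U by blast
  have range: "f q \<bullet> ya \<in> {s0 - r/2<..<s0 + r/2}" if "q \<in> U \<inter> inv_chart c0 ` X" for q
    using that by (auto simp: X_def)
  have Tp: "(T has_real_derivative \<tau> (f p \<bullet> ya)) (at (f p \<bullet> ya))" "\<tau> (f p \<bullet> ya) \<noteq> 0"
    using T(2) \<tau>(1) range[OF pV] by (auto simp: less_imp_neq[THEN not_sym])
  obtain W' where W': "(W', coords T) \<in> A" "p \<in> W'" "W' \<subseteq> U \<inter> inv_chart c0 ` X"
    by (rule coords_chart[OF V pV T(1) range Tp rat[OF U(2)]])
  define c where "c = (W', coords T)"
  have c: "c \<in> A" "fst c = W'" using W' by (simp_all add: c_def)
  have comp: "df q (tvec_at A c q u) \<bullet> b i = u $ e i" if q: "q \<in> W'" and i: "i \<in> {1..2*n}" for q u i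
  proof -
    have "(T has_real_derivative \<tau> (f q \<bullet> ya)) (at (f q \<bullet> ya))" using T(2) range q W'(3) by blast
    from coords_chart_frechet(1)[OF W'(1) q this e_neq_last[OF i], where u = u,
        unfolded df_coords_chart[OF W'(1) q]]
    show ?thesis using idx_e[of i] i by (simp add: c_def)
  qed
  have comp_ya: "\<tau> (f q \<bullet> ya) * (df q (tvec_at A c q u) \<bullet> ya) = u $ last_ix" if q: "q \<in> W'" for q u
  proof -
    have "(T has_real_derivative \<tau> (f q \<bullet> ya)) (at (f q \<bullet> ya))" using T(2) range q W'(3) by blast
    from coords_chart_frechet(2)[OF W'(1) q this, where u = u, unfolded df_coords_chart[OF W'(1) q]]
    show ?thesis by (simp add: c_def)
  qed
  have comp_yb: "df q (tvec_at A c q u) \<bullet> yb = \<gamma> (f q \<bullet> ya) * (df q (tvec_at A c q u) \<bullet> ya)"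
    if "q \<in> W'" for q u
    using rat[of q "tvec_at A c q u"] tvec_at_tangent[OF c(1)] that W'(3) c(2) by (auto simp: inner_commute)
  show thesis
  proof (rule that[of c \<epsilon>])
    fix q assume "q \<in> fst c"
    then have q: "q \<in> W'" by (simp add: c)
    then have sq: "f q \<bullet> ya \<in> {s0 - r/2<..<s0 + r/2}" using range W'(3) by blast
    let ?w = "df q (tvec_at A c q (axis last_ix 1))"
    have w: "\<tau> (f q \<bullet> ya) * (?w \<bullet> ya) = 1" using comp_ya[OF q] by simp
    have "(?w \<bullet> ya) * (?w \<bullet> yb) = \<gamma> (f q \<bullet> ya) * ((?w \<bullet> ya) * (?w \<bullet> ya))"
      using comp_yb[OF q] by simp
    also have "\<gamma> (f q \<bullet> ya) = \<epsilon> * (\<tau> (f q \<bullet> ya) * \<tau> (f q \<bullet> ya))"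
      using \<tau>(2)[OF sq] \<epsilon>(1) by (simp add: mult.assoc[symmetric])
    also have "\<dots> * ((?w \<bullet> ya) * (?w \<bullet> ya)) = \<epsilon> * (\<tau> (f q \<bullet> ya) * (?w \<bullet> ya)) * (\<tau> (f q \<bullet> ya) * (?w \<bullet> ya))"
      by (simp add: algebra_simps)
    finally show "(?w \<bullet> ya) * (?w \<bullet> yb) = \<epsilon>" using w by simp
    fix i assume i: "i \<in> {1..2*n}"
    show "?w \<bullet> b i = 0" using comp[OF q i] e_neq_last[OF i] by (simp add: axis_def)
    let ?z = "df q (tvec_at A c q (axis (e i) 1))"
    have "?z \<bullet> ya = 0" using comp_ya[OF q, of "axis (e i) 1"] \<tau>(1)[OF sq] e_neq_last[OF i] by (simp add: axis_def)
    moreover from this have "?z \<bullet> yb = 0" using comp_yb[OF q] by simp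
    moreover have "?z \<bullet> b j = b i \<bullet> b j" if j: "j \<in> {1..2*n}" for j
      using comp[OF q j, of "axis (e i) 1"] b_ortho[OF i j] idx_e[of i] idx_e[of j] i j
      by (auto simp: axis_def)
    ultimately have "?z - b i = 0"
      using b_ya[OF i] b_yb[OF i] by (intro frame_complete) (simp_all add: inner_diff_left)
    then show "?z = b i" by simp
  qed (use c W' \<epsilon>(1) in auto)
qed

end

subsection \<open>The flat structure\<close>

lemma (in smooth_manifold) smooth_vfield_tvec_at:
  assumes "c \<in> A" "V \<subseteq> fst c" "open V" "smooth_on (snd c ` V) u"
    and eq: "\<And>q. q \<in> V \<Longrightarrow> G q = u (snd c q)"
  shows "smooth_vfield_on A V (\<lambda>q. tvec_at A c q (G q))"
proof (rule smooth_vfield_onI_chart[OF assms(1-3)])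
  show "tvec_at A c q (G q) \<in> tangent_space A q" if "q \<in> V" for q
    using tvec_at_tangent assms(1,2) that by blast
  have "open (snd c ` V)" using open_chart_image[OF assms(1,3)] assms(2) by (simp add: Int_absorb1)
  then show "smooth_on (snd c ` V) (\<lambda>x. tvec_at A c (inv_chart c x) (G (inv_chart c x)) c)"
  proof (rule smooth_on_cong[OF assms(4)])
    fix x assume "x \<in> snd c ` V"
    then obtain q where q: "q \<in> V" "x = snd c q" by blast
    then have "q \<in> fst c" using assms(2) by blast
    then show "u x = tvec_at A c (inv_chart c x) (G (inv_chart c x)) c"
      using q eq assms(1) by (simp add: inv_chart_left tvec_at_self)
  qed
qed

locale flat_chart_hypersurface = framed_hypersurface n A f ya yb b e
  for n and A :: "('m::{t2_space, second_countable_topology}, 'd::finite) chart set"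
    and f :: "'m \<Rightarrow> 'k::finite pspace" and ya yb b e +
  fixes c :: "('m, 'd) chart" and \<epsilon> :: real
  assumes c: "c \<in> A" and eps: "\<epsilon> \<noteq> 0"
    and df_axis: "\<And>q i. q \<in> fst c \<Longrightarrow> i \<in> {1..2*n} \<Longrightarrow> df q (tvec_at A c q (axis (e i) 1)) = b i"
    and df_last_b: "\<And>q i. q \<in> fst c \<Longrightarrow> i \<in> {1..2*n} \<Longrightarrow>
      df q (tvec_at A c q (axis last_ix 1)) \<bullet> b i = 0"
    and df_last_prod: "\<And>q. q \<in> fst c \<Longrightarrow>
      (df q (tvec_at A c q (axis last_ix 1)) \<bullet> ya) * (df q (tvec_at A c q (axis last_ix 1)) \<bullet> yb) = \<epsilon>"
begin

abbreviation U :: "'m set" where "U \<equiv> fst c"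

definition w :: "'m \<Rightarrow> 'k pspace" where "w q = df q (tvec_at A c q (axis last_ix 1))"

text \<open>The value 0 at \<open>last_ix\<close> lets \<open>B\<close> sum over the whole index
  type: \<open>B\<close> is the part of \<open>df\<close> in the constant 2n-plane, and the last
  component multiplies \<open>w\<close>.\<close>

definition bb :: "'d \<Rightarrow> 'k pspace" where "bb k = (if k = last_ix then 0 else b (idx k))"

definition B :: "real ^ 'd \<Rightarrow> 'k pspace" where "B u = (\<Sum>k\<in>UNIV. (u $ k) *\<^sub>R bb k)"

text \<open>Eigenvalues of the new paracontact tensor on the coordinate fields, with 0 for the Reeb
  field. That they are constant is what makes the tensor parallel; \<open>M\<close> is its
  matrix.\<close>

definition sg :: "'d \<Rightarrow> real" where "sg k = (if k = last_ix then 0 else if idx k \<le> n then 1 else -1)"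

definition M :: "real ^ 'd \<Rightarrow> real ^ 'd" where "M u = (\<chi> k. sg k * u $ k)"

lemma bounded_linear_B: "bounded_linear B"
  unfolding B_def[abs_def]
  by (intro bounded_linear_sum bounded_linear_scaleR_const bounded_linear_vec_nth)

lemma bounded_linear_M: "bounded_linear M"
  unfolding linear_linear by (rule linearI) (auto simp: M_def vec_eq_iff algebra_simps)

lemma open_chart: "open U"
  by (rule open_dom[OF c])

lemma w_b: "q \<in> U \<Longrightarrow> i \<in> {1..2*n} \<Longrightarrow> w q \<bullet> b i = 0"
  and w_prod: "q \<in> U \<Longrightarrow> (w q \<bullet> ya) * (w q \<bullet> yb) = \<epsilon>"
  using df_last_b df_last_prod by (simp_all add: w_def)

lemma bb_y: "bb k \<bullet> ya = 0" "bb k \<bullet> yb = 0"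
  using b_ya b_yb idx_range by (auto simp: bb_def)

lemma B_y: "B u \<bullet> ya = 0" "B u \<bullet> yb = 0"
  by (simp_all add: B_def inner_sum_left bb_y)

lemma paraJ_bb: "paraJ (bb k) = sg k *\<^sub>R bb k"
proof (cases "k = last_ix")
  case False
  have "idx k \<in> {1..n} \<or> (idx k \<in> {n+1..2*n} \<and> \<not> idx k \<le> n)" using idx_range[OF False] by auto
  then show ?thesis using J_b_plus J_b_minus False by (auto simp: bb_def sg_def)
qed (simp add: bb_def paraJ_simps)

lemma paraJ_B: "paraJ (B u) = B (M u)"
  unfolding B_def by (simp add: linear_sum[OF linear_paraJ] paraJ_simps paraJ_bb M_def mult.commute)

lemma df_eq:
  assumes q: "q \<in> U" and v: "v \<in> tangent_space A q"
  shows "df q v = B (v c) + (v c $ last_ix) *\<^sub>R w q"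
proof -
  define L where "L u = df q (tvec_at A c q u)" for u
  have L: "L u = frechet_derivative (f \<circ> inv_chart c) (at (snd c q)) u" for u
    unfolding L_def by (rule tderiv_tvec_at[OF smooth_f UNIV_I c q])
  have "linear L" using linear_frechet_f[OF c q] L by (metis (no_types, lifting) ext)
  have Lk: "L (axis k 1) = bb k + (if k = last_ix then w q else 0)" for k
  proof (cases "k = last_ix")
    case False
    then show ?thesis using df_axis[OF q idx_range[OF False]] e_idx[of k] by (simp add: L_def bb_def)
  qed (simp add: L_def w_def bb_def)
  have "df q v = L (v c)" unfolding L_def using tvec_at_component[OF c q v] by simp
  also have "\<dots> = L (\<Sum>k\<in>UNIV. (v c $ k) *\<^sub>R axis k 1)"
    using basis_expansion[of "v c"] by (simp add: scalar_mult_eq_scaleR)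
  also have "\<dots> = (\<Sum>k\<in>UNIV. (v c $ k) *\<^sub>R L (axis k 1))"
    using \<open>linear L\<close> by (simp add: linear_sum linear_scale)
  also have "\<dots> = (\<Sum>k\<in>UNIV. (v c $ k) *\<^sub>R bb k + (if k = last_ix then (v c $ k) *\<^sub>R w q else 0))"
    by (rule sum.cong) (auto simp: Lk scaleR_add_right)
  also have "\<dots> = B (v c) + (v c $ last_ix) *\<^sub>R w q"
    by (simp add: sum.distrib B_def)
  finally show ?thesis .
qed

lemma df_tvec_at: "q \<in> U \<Longrightarrow> df q (tvec_at A c q u) = B u + (u $ last_ix) *\<^sub>R w q"
  using df_eq[OF _ tvec_at_tangent[OF c]] tvec_at_self[OF c] by simp

text \<open>A linear form whose kernel is the tangent space.\<close>

lemma df_image_form: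
  assumes "q \<in> U" "z \<in> df q ` tangent_space A q"
  shows "(z \<bullet> ya) * (w q \<bullet> yb) - (z \<bullet> yb) * (w q \<bullet> ya) = 0"
  using assms df_eq by (auto simp: inner_add_left B_y)

lemma paraJ_w_y: "paraJ (w q) \<bullet> ya = w q \<bullet> ya" "paraJ (w q) \<bullet> yb = - (w q \<bullet> yb)"
  by (simp_all add: paraJ_inner J_ya J_yb)

text \<open>J negates the \<open>yb\<close>-component only, so the form of
  \<open>df_image_form\<close> takes the value 2\<epsilon> on J w.\<close>

lemma paraJ_w_not_tangent:
  assumes q: "q \<in> U"
  shows "paraJ (w q) \<notin> df q ` tangent_space A q"
proof
  assume "paraJ (w q) \<in> df q ` tangent_space A q"
  from df_image_form[OF q this] have "2 * \<epsilon> = 0"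
    using w_prod[OF q] by (simp add: paraJ_w_y algebra_simps)
  then show False using eps by simp
qed

text \<open>J(df v) is tangent. The form annihilating tangent vectors ignores the
  \<open>B\<close>-part and leaves 2\<epsilon> times the last component of \<open>v\<close>.\<close>

lemma pdist_last:
  assumes q: "q \<in> U" and v: "v \<in> pdist A f q"
  shows "v c $ last_ix = 0"
proof -
  obtain v' where v': "v \<in> tangent_space A q" "v' \<in> tangent_space A q" "df q v = paraJ (df q v')"
    using v by (auto simp: pdist_iff)
  then have "paraJ (df q v) = df q v'" by simp
  then have "paraJ (df q v) \<in> df q ` tangent_space A q" using v'(2) by blast
  from df_image_form[OF q this] have "(v c $ last_ix) * (2 * \<epsilon>) = 0"
    using w_prod[OF q]
    by (simp add: df_eq[OF q v'(1)] paraJ_simps paraJ_B paraJ_w_y inner_add_left B_y algebra_simps)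
  then show ?thesis using eps by simp
qed

definition wx :: "real ^ 'd \<Rightarrow> 'k pspace" where "wx x = w (inv_chart c x)"

lemma wx_snd: "q \<in> U \<Longrightarrow> wx (snd c q) = w q"
  by (simp add: wx_def inv_chart_left c)

lemma smooth_wx: "smooth_on (snd c ` U) wx"
proof (rule smooth_on_cong[OF _ open_image[OF c]])
  show "smooth_on (snd c ` U) (\<lambda>x. frechet_derivative (f \<circ> inv_chart c) (at x) (axis last_ix 1))"
    using smooth_on_frechet[OF smooth_map_onD[OF smooth_f c]] by simp
  fix x assume "x \<in> snd c ` U"
  then show "frechet_derivative (f \<circ> inv_chart c) (at x) (axis last_ix 1) = wx x"
    using tderiv_tvec_at[OF smooth_f UNIV_I c] by (auto simp: wx_snd w_def)
qed

text \<open>The factor in w' = \<lambda> J w, read off by pairing with \<open>ya\<close>; the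
  denominator is the \<open>ya\<close>-component of J w because J fixes \<open>ya\<close>.\<close>

definition lam :: "real ^ 'd \<Rightarrow> real ^ 'd \<Rightarrow> real" where
  "lam x u = (frechet_derivative wx (at x) u \<bullet> ya) / (wx x \<bullet> ya)"

text \<open>Both sides are compared on the frame. The \<open>b i\<close>-components vanish, those
  along \<open>ya\<close> agree by the choice of \<open>lam\<close>, and those along
  \<open>yb\<close> agree by differentiating the constancy of the product of the two components of
  \<open>w\<close>.\<close>

lemma frechet_wx:
  assumes x: "x \<in> snd c ` U"
  shows "frechet_derivative wx (at x) u = lam x u *\<^sub>R paraJ (wx x)"
proof -
  let ?D = "frechet_derivative wx (at x)"
  have D: "(wx has_derivative ?D) (at x)" by (rule smooth_on_has_derivative[OF smooth_wx x])
  have inner: "((\<lambda>x. wx x \<bullet> z) has_derivative (\<lambda>u. ?D u \<bullet> z)) (at x)" for z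
    by (rule bounded_linear.has_derivative[OF bounded_linear_inner_left D])
  have prod: "(wx x' \<bullet> ya) * (wx x' \<bullet> yb) = \<epsilon>" if "x' \<in> snd c ` U" for x'
    using that w_prod by (auto simp: wx_snd)
  then have nz: "wx x \<bullet> ya \<noteq> 0" using eps x by force
  have const: "D' u = 0" if "(g has_derivative D') (at x)" "\<And>x'. x' \<in> snd c ` U \<Longrightarrow> g x' = r"
    for g :: "real ^ 'd \<Rightarrow> real" and D' r
  proof -
    have "(g has_derivative (\<lambda>u. 0)) (at x)"
      by (rule has_derivative_transform_within_open[OF has_derivative_const open_image[OF c] x, of r])
        (simp add: that(2))
    from has_derivative_unique[OF that(1) this] show ?thesis by simp
  qed
  define z where "z = ?D u - lam x u *\<^sub>R paraJ (wx x)"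
  have "z \<bullet> b i = 0" if i: "i \<in> {1..2*n}" for i
  proof -
    have wb: "wx x' \<bullet> b i = 0" if "x' \<in> snd c ` U" for x' using that w_b[OF _ i] by (auto simp: wx_snd)
    have "?D u \<bullet> b i = 0" by (rule const[OF inner wb])
    moreover have "paraJ (b i) = b i \<or> paraJ (b i) = - b i"
      using J_b_plus[of i] J_b_minus[of i] i by (cases "i \<le> n") auto
    ultimately show ?thesis using wb[OF x] by (auto simp: z_def inner_diff_left paraJ_inner)
  qed
  moreover have "z \<bullet> ya = 0"
    using nz by (simp add: z_def inner_diff_left paraJ_inner J_ya lam_def)
  moreover have "z \<bullet> yb = 0"
  proof -
    have "(wx x \<bullet> ya) * (?D u \<bullet> yb) + (?D u \<bullet> ya) * (wx x \<bullet> yb) = 0"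
      using const[OF has_derivative_mult[OF inner inner] prod] by simp
    then show ?thesis
      using nz by (simp add: z_def inner_diff_left paraJ_inner J_yb lam_def field_simps)
  qed
  ultimately have "z = 0" by (rule frame_complete)
  then show ?thesis by (simp add: z_def)
qed

section \<open>The new transversal field and its induced structure\<close>

definition C' :: "'m \<Rightarrow> 'k pspace" where "C' q = paraJ (w q)"

definition comp :: "('m, 'd) vfield \<Rightarrow> real ^ 'd \<Rightarrow> real ^ 'd" where
  "comp X x = X (inv_chart c x) c"

text \<open>The flat connection of the chart: it differentiates the components of
  \<open>Y\<close>.\<close>

definition nabla' :: "('m, 'd) connection" where
  "nabla' X Y q = tvec_at A c q (frechet_derivative (comp Y) (at (snd c q)) (X q c))"

text \<open>Only the last component of \<open>Y\<close> multiplies a vector that varies, namely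
  \<open>w\<close>, and the derivative of \<open>w\<close> is \<open>lam\<close> times
  \<open>C'\<close>.\<close>

definition h' :: "'m \<Rightarrow> ('m, 'd) tvec \<Rightarrow> ('m, 'd) tvec \<Rightarrow> real" where
  "h' q v v' = (v' c $ last_ix) * lam (snd c q) (v c)"

definition \<phi>' :: "'m \<Rightarrow> ('m, 'd) tvec \<Rightarrow> ('m, 'd) tvec" where
  "\<phi>' q v = tvec_at A c q (M (v c))"

definition \<xi>' :: "('m, 'd) vfield" where
  "\<xi>' q = tvec_at A c q (axis last_ix 1)"

definition \<eta>' :: "'m \<Rightarrow> ('m, 'd) tvec \<Rightarrow> real" where
  "\<eta>' q v = v c $ last_ix"

lemma open_V_image: "open V \<Longrightarrow> V \<subseteq> U \<Longrightarrow> open (snd c ` V)"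
  using open_chart_image[OF c, of V] by (simp add: Int_absorb1)

lemma smooth_comp: "smooth_vfield_on A V X \<Longrightarrow> V \<subseteq> U \<Longrightarrow> smooth_on (snd c ` V) (comp X)"
  using smooth_vfield_onD(1)[OF _ c, of V X] by (simp add: comp_def[abs_def] Int_absorb1)

lemma comp_snd: "q \<in> U \<Longrightarrow> comp X (snd c q) = X q c"
  by (simp add: comp_def inv_chart_left c)

lemma transversal': "transversal_on A f U C'"
  unfolding transversal_on_def
proof
  show "smooth_map_on A U C'"
  proof (rule smooth_map_onI_chart[OF c order_refl open_chart])
    show "smooth_on (snd c ` U) (C' \<circ> inv_chart c)"
      using smooth_on_linear[OF bounded_linear_paraJ smooth_wx open_image[OF c]]
      by (simp add: wx_def C'_def o_def)
  qed
qed (simp add: C'_def paraJ_w_not_tangent)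

lemma xi'_tangent: "q \<in> U \<Longrightarrow> \<xi>' q \<in> tangent_space A q"
  unfolding \<xi>'_def by (rule tvec_at_tangent[OF c])

lemma df_xi': "df q (\<xi>' q) = paraJ (C' q)"
  by (simp add: \<xi>'_def C'_def w_def)

lemma J_tangent': "J_tangent_on A f U C'"
  unfolding J_tangent_on_def using df_xi' xi'_tangent by (metis image_eqI)

lemma smooth_nabla':
  assumes "open V" "V \<subseteq> U" "smooth_vfield_on A V X" "smooth_vfield_on A V Y"
  shows "smooth_vfield_on A V (nabla' X Y)"
proof -
  have "smooth_on (snd c ` V) (\<lambda>x. frechet_derivative (comp Y) (at x) (comp X x))"
    by (intro smooth_on_frechet_apply smooth_comp assms open_V_image)
  then have "smooth_vfield_on A V
      (\<lambda>q. tvec_at A c q (frechet_derivative (comp Y) (at (snd c q)) (X q c)))"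
    by (rule smooth_vfield_tvec_at[OF c assms(2,1)]) (use assms(2) comp_snd in auto)
  then show ?thesis by (simp add: nabla'_def[abs_def])
qed

text \<open>Product rule for df Y = B(Y) + Y_last w: differentiating the components gives
  \<open>nabla'\<close>, differentiating \<open>w\<close> gives a multiple of \<open>C'\<close> by
  \<open>frechet_wx\<close>.\<close>

lemma gauss':
  assumes V: "open V" "V \<subseteq> U" and X: "smooth_vfield_on A V X" and Y: "smooth_vfield_on A V Y"
    and p: "p \<in> V"
  shows "tderiv A (\<lambda>q. df q (Y q)) p (X p) = df p (nabla' X Y p) + h' p (X p) (Y p) *\<^sub>R C' p"
proof -
  have pU: "p \<in> U" using p V by blast
  define x where "x = snd c p"
  have xV: "x \<in> snd c ` V" and xU: "x \<in> snd c ` U" using p pU by (auto simp: x_def)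
  let ?D = "frechet_derivative (comp Y) (at x)"
  have DY: "(comp Y has_derivative ?D) (at x)"
    by (rule smooth_on_has_derivative[OF smooth_comp[OF Y V(2)] xV])
  have "((\<lambda>x. B (comp Y x) + (comp Y x $ last_ix) *\<^sub>R wx x) has_derivative
      (\<lambda>u. B (?D u) + ((comp Y x $ last_ix) *\<^sub>R frechet_derivative wx (at x) u + (?D u $ last_ix) *\<^sub>R wx x))) (at x)"
    by (intro has_derivative_add has_derivative_scaleR DY bounded_linear.has_derivative[OF bounded_linear_B DY]
        bounded_linear.has_derivative[OF bounded_linear_vec_nth DY] smooth_on_has_derivative[OF smooth_wx xU])
  then have "((\<lambda>q. df q (Y q)) \<circ> inv_chart c has_derivative
      (\<lambda>u. B (?D u) + ((comp Y x $ last_ix) *\<^sub>R frechet_derivative wx (at x) u + (?D u $ last_ix) *\<^sub>R wx x))) (at x)"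
  proof (rule has_derivative_transform_within_open[OF _ open_V_image[OF V] xV])
    fix x' assume "x' \<in> snd c ` V"
    then obtain q where q: "q \<in> V" "x' = snd c q" by blast
    then have qU: "q \<in> U" using V by blast
    show "B (comp Y x') + (comp Y x' $ last_ix) *\<^sub>R wx x' = ((\<lambda>q. df q (Y q)) \<circ> inv_chart c) x'"
      using df_eq[OF qU smooth_vfield_onD(2)[OF Y q(1)]]
      by (simp add: q(2) comp_snd[OF qU] wx_snd[OF qU] inv_chart_left[OF c qU])
  qed
  from tderiv_chart[OF c pU smooth_vfield_onD(2)[OF X p] this[unfolded x_def]]
  show ?thesis
    by (simp add: nabla'_def df_tvec_at[OF pU] h'_def C'_def comp_snd[OF pU] wx_snd[OF pU]
        frechet_wx[OF imageI[OF pU]] scaleR_add_right)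
qed

lemma connection': "induced_connection_on A f U C' nabla' h'"
  unfolding induced_connection_on_def using smooth_nabla' gauss' by blast

lemma smooth_xi': "smooth_vfield_on A U \<xi>'"
  using smooth_tvec_at[OF c order_refl open_chart] by (simp add: \<xi>'_def[abs_def])

lemma one_form': "one_form_on A U \<eta>'"
  unfolding one_form_on_def
proof (intro conjI allI impI)
  fix V X assume *: "open V \<and> V \<subseteq> U \<and> smooth_vfield_on A V X"
  show "smooth_map_on A V (\<lambda>p. \<eta>' p (X p))"
  proof (rule smooth_map_onI_chart[OF c])
    have "smooth_on (snd c ` V) (\<lambda>x. comp X x $ last_ix)"
      using * by (intro smooth_on_vec_nth smooth_comp open_V_image) auto
    then show "smooth_on (snd c ` V) ((\<lambda>p. \<eta>' p (X p)) \<circ> inv_chart c)"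
      by (simp add: o_def comp_def \<eta>'_def)
  qed (use * in auto)
qed (simp add: \<eta>'_def tcomb_def)

lemma tensor': "tensor11_on A U \<phi>'"
  unfolding tensor11_on_def
proof (intro conjI allI impI ballI)
  fix V X assume *: "open V \<and> V \<subseteq> U \<and> smooth_vfield_on A V X"
  have "smooth_on (snd c ` V) (\<lambda>x. M (comp X x))"
    using * by (intro smooth_on_linear[OF bounded_linear_M] smooth_comp open_V_image) auto
  then show "smooth_vfield_on A V (\<lambda>p. \<phi>' p (X p))"
    unfolding \<phi>'_def by (rule smooth_vfield_tvec_at[OF c, rotated 2]) (use * comp_snd in auto)
next
  fix p v assume "p \<in> U"
  then show "\<phi>' p v \<in> tangent_space A p" unfolding \<phi>'_def by (rule tvec_at_tangent[OF c])
next
  fix p v v' r s assume p: "p \<in> U"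
  have "M (tcomb r v s v' c) = r *\<^sub>R M (v c) + s *\<^sub>R M (v' c)"
    by (simp add: tcomb_def M_def vec_eq_iff algebra_simps)
  then show "\<phi>' p (tcomb r v s v') = tcomb r (\<phi>' p v) s (\<phi>' p v')"
    by (simp add: \<phi>'_def tvec_at_linear_comb[OF c p])
qed

lemma paracontact': "induced_paracontact_on A f U C' \<phi>' \<xi>' \<eta>'"
  unfolding induced_paracontact_on_def
proof (intro conjI ballI smooth_xi' one_form' tensor' df_xi')
  fix p assume p: "p \<in> U"
  show "\<eta>' p (\<xi>' p) = 1" by (simp add: \<eta>'_def \<xi>'_def tvec_at_self[OF c p])
  have "M (axis last_ix 1) = 0" by (simp add: M_def vec_eq_iff axis_def sg_def)
  moreover have "tvec_at A c p 0 = tzero"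
    using linear_0[OF linear_transition[OF c _ p]]
    by (auto simp: tvec_at_def tzero_def charts_at_def fun_eq_iff)
  ultimately show "\<phi>' p (\<xi>' p) = tzero" by (simp add: \<phi>'_def \<xi>'_def tvec_at_self[OF c p])
  fix v assume v: "v \<in> pdist A f p"
  show "\<eta>' p v = 0" using pdist_last[OF p v] by (simp add: \<eta>'_def)
  have "v \<in> tangent_space A p" using v by (simp add: pdist_iff)
  then show "df p (\<phi>' p v) = paraJ (df p v)"
    using pdist_last[OF p v]
    by (simp add: \<phi>'_def df_tvec_at[OF p] df_eq[OF p] paraJ_B M_def)
qed

section \<open>Parallelism of the flat structure\<close>

lemma nabla'_const:
  assumes "p \<in> U" and "\<And>q. q \<in> U \<Longrightarrow> Y q c = u"
  shows "nabla' X Y p = tzero"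
proof -
  have "(comp Y has_derivative (\<lambda>u. 0)) (at (snd c p))"
    by (rule has_derivative_transform_within_open[OF has_derivative_const[of u] open_image[OF c]])
      (use assms comp_snd in auto)
  then have "frechet_derivative (comp Y) (at (snd c p)) = (\<lambda>u. 0)" by (rule frechet_derivative_at[symmetric])
  then show ?thesis
    using linear_0[OF linear_transition[OF c _ assms(1)]]
    by (auto simp: nabla'_def tvec_at_def tzero_def charts_at_def fun_eq_iff)
qed

text \<open>\<open>M\<close> is a constant linear map and so commutes with the componentwise
  derivative \<open>nabla'\<close>.\<close>

lemma parallel_tensor': "parallel_tensor11_on A U nabla' \<phi>'"
  unfolding parallel_tensor11_on_def
proof (intro allI impI ballI)
  fix V X Y p
  assume *: "open V \<and> V \<subseteq> U \<and> smooth_vfield_on A V X \<and> smooth_vfield_on A V Y" and p: "p \<in> V"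
  then have pU: "p \<in> U" and xV: "snd c p \<in> snd c ` V" by auto
  have DY: "(comp Y has_derivative frechet_derivative (comp Y) (at (snd c p))) (at (snd c p))"
    by (rule smooth_on_has_derivative[OF smooth_comp xV]) (use * in auto)
  have "comp (\<lambda>q. \<phi>' q (Y q)) x = M (comp Y x)" if "x \<in> snd c ` V" for x
    using that * tvec_at_self[OF c] by (auto simp: comp_snd \<phi>'_def subset_iff)
  then have "(comp (\<lambda>q. \<phi>' q (Y q)) has_derivative
      (\<lambda>u. M (frechet_derivative (comp Y) (at (snd c p)) u))) (at (snd c p))"
    using has_derivative_transform_within_open[OF bounded_linear.has_derivative[OF bounded_linear_M DY] _ xV]
      open_V_image * by (metis (no_types, lifting))
  then have "frechet_derivative (comp (\<lambda>q. \<phi>' q (Y q))) (at (snd c p)) =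
      (\<lambda>u. M (frechet_derivative (comp Y) (at (snd c p)) u))" by (rule frechet_derivative_at[symmetric])
  then have "nabla' X (\<lambda>q. \<phi>' q (Y q)) p = \<phi>' p (nabla' X Y p)"
    by (simp add: nabla'_def \<phi>'_def tvec_at_self[OF c pU])
  then show "tcomb 1 (nabla' X (\<lambda>q. \<phi>' q (Y q)) p) (- 1) (\<phi>' p (nabla' X Y p)) = tzero"
    by (simp add: tcomb_def tzero_def)
qed

lemma parallel_form': "parallel_form_on A U nabla' \<eta>'"
  unfolding parallel_form_on_def
proof (intro allI impI ballI)
  fix V X Y p
  assume *: "open V \<and> V \<subseteq> U \<and> smooth_vfield_on A V X \<and> smooth_vfield_on A V Y" and p: "p \<in> V"
  then have pU: "p \<in> U" and xV: "snd c p \<in> snd c ` V" by auto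
  have DY: "(comp Y has_derivative frechet_derivative (comp Y) (at (snd c p))) (at (snd c p))"
    by (rule smooth_on_has_derivative[OF smooth_comp xV]) (use * in auto)
  have "(\<lambda>q. \<eta>' q (Y q)) \<circ> inv_chart c = (\<lambda>x. comp Y x $ last_ix)"
    by (simp add: o_def \<eta>'_def comp_def)
  then have "((\<lambda>q. \<eta>' q (Y q)) \<circ> inv_chart c has_derivative
      (\<lambda>u. frechet_derivative (comp Y) (at (snd c p)) u $ last_ix)) (at (snd c p))"
    using bounded_linear.has_derivative[OF bounded_linear_vec_nth DY] by simp
  moreover have "X p \<in> tangent_space A p" using smooth_vfield_onD(2) * p by blast
  ultimately have "tderiv A (\<lambda>q. \<eta>' q (Y q)) p (X p)
      = frechet_derivative (comp Y) (at (snd c p)) (X p c) $ last_ix"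
    using tderiv_chart[OF c pU] by blast
  then show "tderiv A (\<lambda>q. \<eta>' q (Y q)) p (X p) - \<eta>' p (nabla' X Y p) = 0"
    by (simp add: \<eta>'_def nabla'_def tvec_at_self[OF c pU])
qed

lemma parallel_structure': "parallel_structure_on A U nabla' \<phi>' \<xi>' \<eta>'"
  unfolding parallel_structure_on_def parallel_vfield_on_def
proof (intro conjI allI impI ballI parallel_tensor' parallel_form')
  fix V X p assume "open V \<and> V \<subseteq> U \<and> smooth_vfield_on A V X" "p \<in> V"
  then show "nabla' X \<xi>' p = tzero"
    by (intro nabla'_const[of _ _ "axis last_ix 1"]) (auto simp: \<xi>'_def tvec_at_self[OF c])
qed

lemma coord_field_pdist:
  assumes q: "q \<in> U"
  shows "i \<in> {1..n} \<Longrightarrow> coord_field A c (e i) q \<in> pdist_plus A f q"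
    and "i \<in> {n+1..2*n} \<Longrightarrow> coord_field A c (e i) q \<in> pdist_minus A f q"
  using df_axis[OF q, of i] J_b_plus[of i] J_b_minus[of i] tvec_at_tangent[OF c q]
  by (simp_all add: pdist_plus_eq pdist_minus_eq eigdist_def coord_field_eq_tvec_at)

lemma parallel_flat_structure:
  assumes "p \<in> U"
  shows "\<exists>U C' nabla' h' \<phi>' \<xi>' \<eta>'.
    open U \<and> p \<in> U \<and>
    transversal_on A f U C' \<and> J_tangent_on A f U C' \<and>
    induced_connection_on A f U C' nabla' h' \<and>
    induced_paracontact_on A f U C' \<phi>' \<xi>' \<eta>' \<and>
    parallel_structure_on A U nabla' \<phi>' \<xi>' \<eta>' \<and>
    (\<exists>c \<in> A. \<exists>e :: nat \<Rightarrow> 'd. p \<in> dom_of c \<and> dom_of c \<subseteq> U \<and>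
      bij_betw e {1..2 * n + 1} UNIV \<and>
      (\<forall>q \<in> dom_of c.
        (\<forall>i \<in> {1..n}. coord_field A c (e i) q \<in> pdist_plus A f q) \<and>
        (\<forall>i \<in> {n + 1..2 * n}. coord_field A c (e i) q \<in> pdist_minus A f q) \<and>
        (\<forall>i \<in> {1..2 * n + 1}. \<forall>j \<in> {1..2 * n + 1}.
          nabla' (coord_field A c (e i)) (coord_field A c (e j)) q = tzero) \<and>
        coord_field A c (e (2 * n + 1)) q = \<xi>' q))"
\<comment> \<open>The neighbourhood is the domain of the flat chart, which also serves as the
  required coordinate system.\<close>
proof (rule exI[of _ U], rule exI[of _ C'], rule exI[of _ nabla'], rule exI[of _ h'],
    rule exI[of _ \<phi>'], rule exI[of _ \<xi>'], rule exI[of _ \<eta>'],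
    intro conjI bexI[OF _ c] exI[of _ e] ballI order_refl)
  fix q i j assume q: "q \<in> U"
  show "nabla' (coord_field A c (e i)) (coord_field A c (e j)) q = tzero"
    by (rule nabla'_const[OF q]) (simp add: coord_field_eq_tvec_at tvec_at_self[OF c])
  show "coord_field A c (e (2 * n + 1)) q = \<xi>' q"
    by (simp only: coord_field_eq_tvec_at \<xi>'_def last_ix_def)
qed (use assms open_chart transversal' J_tangent' connection' paracontact' parallel_structure'
    e_bij coord_field_pdist in simp_all)

end

theorem theorem4p10:
  fixes n :: nat
    and A :: "('m::{t2_space, second_countable_topology}, 'd::finite) chart set"
    and f C :: "'m \<Rightarrow> 'k::finite pspace"
    and nabla :: "('m, 'd) connection"
    and h :: "'m \<Rightarrow> ('m, 'd) tvec \<Rightarrow> ('m, 'd) tvec \<Rightarrow> real"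
    and \<phi> :: "'m \<Rightarrow> ('m, 'd) tvec \<Rightarrow> ('m, 'd) tvec"
    and \<xi> :: "('m, 'd) vfield"
    and \<eta> :: "'m \<Rightarrow> ('m, 'd) tvec \<Rightarrow> real"
    and p :: 'm
  assumes "affine_hypersurface n A f"
    and "transversal_on A f UNIV C" and "J_tangent_on A f UNIV C"
    and "induced_connection_on A f UNIV C nabla h"
    and "induced_paracontact_on A f UNIV C \<phi> \<xi> \<eta>"
    and "parallel_form_on A UNIV nabla \<eta>"
  shows "\<exists>U C' nabla' h' \<phi>' \<xi>' \<eta>'.
    open U \<and> p \<in> U \<and>
    transversal_on A f U C' \<and> J_tangent_on A f U C' \<and>
    induced_connection_on A f U C' nabla' h' \<and>
    induced_paracontact_on A f U C' \<phi>' \<xi>' \<eta>' \<and>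
    parallel_structure_on A U nabla' \<phi>' \<xi>' \<eta>' \<and>
    (\<exists>c \<in> A. \<exists>e :: nat \<Rightarrow> 'd. p \<in> dom_of c \<and> dom_of c \<subseteq> U \<and>
      bij_betw e {1..2 * n + 1} UNIV \<and>
      (\<forall>q \<in> dom_of c.
        (\<forall>i \<in> {1..n}. coord_field A c (e i) q \<in> pdist_plus A f q) \<and>
        (\<forall>i \<in> {n + 1..2 * n}. coord_field A c (e i) q \<in> pdist_minus A f q) \<and>
        (\<forall>i \<in> {1..2 * n + 1}. \<forall>j \<in> {1..2 * n + 1}.
          nabla' (coord_field A c (e i)) (coord_field A c (e j)) q = tzero) \<and>
        coord_field A c (e (2 * n + 1)) q = \<xi>' q))"
proof -
  interpret parallel_eta n A f C nabla h \<phi> \<xi> \<eta>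
    by unfold_locales (use assms in auto)
  obtain W ya yb where W: "open W" "p \<in> W" and J: "paraJ ya = ya" "paraJ yb = - yb"
    and ya: "\<And>q. q \<in> W \<Longrightarrow> \<exists>v\<in>tangent_space A q. ya \<bullet> df q v \<noteq> 0"
    and ratio: "\<And>q. q \<in> W \<Longrightarrow> \<exists>l. l \<noteq> 0 \<and> (\<forall>v\<in>tangent_space A q. yb \<bullet> df q v = l * (ya \<bullet> df q v))"
    using local_conormals[of p] by metis
  have "ya \<noteq> 0" using ya[OF W(2)] by auto
  \<comment> \<open>The pairing of \<open>ya\<close> with \<open>df\<close> is not identically zero,
    and the ratio \<open>l\<close> is nonzero.\<close>
  moreover have "yb \<noteq> 0" using ya[OF W(2)] ratio[OF W(2)] by (metis inner_zero_left mult_eq_0_iff)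
  ultimately obtain b where b: "\<And>i. i \<in> {1..n} \<Longrightarrow> paraJ (b i) = b i"
    "\<And>i. i \<in> {n+1..2*n} \<Longrightarrow> paraJ (b i) = - b i"
    "\<And>i j. i \<in> {1..2*n} \<Longrightarrow> j \<in> {1..2*n} \<Longrightarrow> b i \<bullet> b j = (if i = j then 1 else 0)"
    "\<And>i. i \<in> {1..2*n} \<Longrightarrow> b i \<bullet> ya = 0" "\<And>i. i \<in> {1..2*n} \<Longrightarrow> b i \<bullet> yb = 0"
    "\<And>z. (\<And>i. i \<in> {1..2*n} \<Longrightarrow> z \<bullet> b i = 0) \<Longrightarrow> z \<bullet> ya = 0 \<Longrightarrow> z \<bullet> yb = 0 \<Longrightarrow> z = 0"
    using adapted_frame[OF J _ _ card_k] by blast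
  obtain e :: "nat \<Rightarrow> 'd" where e: "bij_betw e {1..2*n+1} UNIV"
    using ex_bij_betw_nat_finite_1[of "UNIV :: 'd set"] card_d by auto
  interpret framed_hypersurface n A f ya yb b e
    by unfold_locales (fact J b e)+
  obtain c \<epsilon> where chart: "c \<in> A" "p \<in> fst c" "\<epsilon> \<noteq> 0"
    "\<And>q i. q \<in> fst c \<Longrightarrow> i \<in> {1..2*n} \<Longrightarrow> df q (tvec_at A c q (axis (e i) 1)) = b i"
    "\<And>q i. q \<in> fst c \<Longrightarrow> i \<in> {1..2*n} \<Longrightarrow> df q (tvec_at A c q (axis last_ix 1)) \<bullet> b i = 0"
    "\<And>q. q \<in> fst c \<Longrightarrow>
      (df q (tvec_at A c q (axis last_ix 1)) \<bullet> ya) * (df q (tvec_at A c q (axis last_ix 1)) \<bullet> yb) = \<epsilon>"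
    using flat_chart[OF W ratio] by blast
  interpret flat_chart_hypersurface n A f ya yb b e c \<epsilon>
    by unfold_locales (fact chart)+
  show ?thesis by (rule parallel_flat_structure[OF chart(2)])
qed

end
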